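(* Let $A$ be a commutative unital real algebra, $T\subseteq A$ a linear subspace such that $T\cup\{1\}$ generates $A$ as an algebra, and $S$ a vector space basis of $T$. Let $\mathcal{T}$ denote $T$ equipped with a nuclear locally convex Hausdorff topology, with continuous dual $\mathcal{T}'$. Let $L$ be a linear functional on $A$ such that one of the following assumptions holds: (i) $L$ is $A_+$-positive, that is, $L(a)\geq 0$ for all $a\in A_+$; (ii) $L$ is positive, that is, $L(a^2)\geq 0$ for all $a\in A$, and Carleman's condition $\sum_{n=1}^\infty L(t^{2n})^{-\frac{1}{2n}}=+\infty$ holds for all $t\in S$. Suppose that there exists a continuous seminorm $q$ on $\mathcal{T}$ such that $L(t^2)\leq q(t)^2$ for all $t\in\mathcal{T}$. Then there exists a ($\sigma$-additive) measure $\mu$ on the $\sigma$-algebra $\mathcal{B}(\mathcal{T})$ of subsets of $\mathcal{T}'$ generated by the cylinder sets such that $$L(f)=\int_{\mathcal{T}'} f(\chi)\,d\mu(\chi)\quad\text{for all } f\in A,$$ i.e. for all $k\in\mathbb{N}$, $t_1,\dots,t_k\in T$ and $p\in\mathbb{R}[x_1,\dots,x_k]$ the function $\chi\mapsto p(\chi(t_1),\dots,\chi(t_k))$ is $\mu$-integrable and $L(p(t_1,\dots,t_k))=\int_{\mathcal{T}'}p(\chi(t_1),\dots,\chi(t_k))\,d\mu(\chi)$. If $\mathcal{T}'\subseteq\{\chi\lceil T:\chi\in\hat{A}\}$, then $L$ is a moment functional with representing measure $\mu$, i.e. the displayed formula is an integral over characters of $A$ with respect to $\mu$.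
   Context: Characters: $\hat{A}$ is the set of algebra homomorphisms $\chi:A\to\mathbb{R}$ with $\chi(1)=1$; for $f\in A$, $\chi\in\hat{A}$ write $f(\chi):=\chi(f)$. $A_+:=\{f\in A: f(\chi)\geq 0 \text{ for all }\chi\in\hat{A}\}$. A character is determined by its restriction $\chi\lceil T$ to $T$, and $\chi\in\hat{A}$ is identified with $\chi\lceil T$. For a general $\chi\in\mathcal{T}'$ and $f=p(t_1,\dots,t_k)$ with $t_i\in T$ and $p$ a real polynomial, $f(\chi)$ stands for $p(\chi(t_1),\dots,\chi(t_k))$ (the integral formula is asserted for every such representation of $f$); if $\chi$ is the restriction of a character this equals $\chi(f)$. Carleman's condition: a term with $L(t^{2n})=0$ is read as $+\infty$. Cylinder sets: for a finite-dimensional subspace $F\subseteq\mathcal{T}$ put $F^\circ=\{\ell\in\mathcal{T}':\ell(f)=0\text{ for }f\in F\}$. A cylinder set in $\mathcal{T}'$ is a set $\{\ell\in\mathcal{T}':\ell+F^\circ\in M\}$ with $F$ finite-dimensional and $M$ a Borel subset of the finite-dimensional space $\mathcal{T}'/F^\circ$. $\mathcal{B}(\mathcal{T})$ is the $\sigma$-algebra on $\mathcal{T}'$ generated by all cylinder sets. *)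

theory Defs
  imports "HOL-Analysis.Analysis" "HOL-Library.Poly_Mapping"
begin

definition linear_functional_on :: "'a::real_vector set \<Rightarrow> ('a \<Rightarrow> real) \<Rightarrow> bool" where
  "linear_functional_on T l \<longleftrightarrow>
     (\<forall>x\<in>T. \<forall>y\<in>T. l (x + y) = l x + l y) \<and> (\<forall>c. \<forall>x\<in>T. l (c *\<^sub>R x) = c * l x)"

definition seminorm_on :: "'a::real_vector set \<Rightarrow> ('a \<Rightarrow> real) \<Rightarrow> bool" where
  "seminorm_on T p \<longleftrightarrow>
     (\<forall>x\<in>T. 0 \<le> p x) \<and> (\<forall>x\<in>T. \<forall>y\<in>T. p (x + y) \<le> p x + p y) \<and>
     (\<forall>c. \<forall>x\<in>T. p (c *\<^sub>R x) = \<bar>c\<bar> * p x)"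

definition continuous_seminorm :: "'a::real_vector topology \<Rightarrow> ('a \<Rightarrow> real) \<Rightarrow> bool" where
  "continuous_seminorm X p \<longleftrightarrow> seminorm_on (topspace X) p \<and> continuous_map X euclideanreal p"

definition locally_convex_space :: "'a::real_vector topology \<Rightarrow> bool" where
  "locally_convex_space X \<longleftrightarrow>
     subspace (topspace X) \<and>
     continuous_map (prod_topology X X) X (\<lambda>(x, y). x + y) \<and>
     continuous_map (prod_topology euclideanreal X) X (\<lambda>(c, x). c *\<^sub>R x) \<and>
     (\<forall>U. openin X U \<and> 0 \<in> U \<longrightarrow> (\<exists>V. openin X V \<and> 0 \<in> V \<and> convex V \<and> V \<subseteq> U))"

definition seminorm_Cauchy :: "('a::real_vector \<Rightarrow> real) \<Rightarrow> (nat \<Rightarrow> 'a) \<Rightarrow> bool" where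
  "seminorm_Cauchy p y \<longleftrightarrow> (\<forall>e>0. \<exists>N. \<forall>m\<ge>N. \<forall>n\<ge>N. p (y m - y n) < e)"

text \<open>
  For seminorms \<open>p \<le> q\<close> on \<open>T\<close>, let \<open>T_p\<close>, \<open>T_q\<close> denote the Banach completions of \<open>T / ker p\<close>,
  \<open>T / ker q\<close>. The definition says that the canonical map from \<open>T_q\<close> to \<open>T_p\<close> is nuclear, that is,
  of the form \<open>x \<mapsto> \<Sum>n. g n x *\<^sub>R y n\<close> with \<open>g n\<close> in the dual of \<open>T_q\<close>, \<open>y n\<close> in \<open>T_p\<close> and
  \<open>\<Sum>n. \<parallel>g n\<parallel> * \<parallel>y n\<parallel> < \<infinity>\<close>. The vector \<open>y n\<close> of \<open>T_p\<close> is represented by a \<open>p\<close>-Cauchy sequence in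
  \<open>T\<close>, so that its norm is \<open>lim (\<lambda>k. p (y n k))\<close>; \<open>c n\<close> is a bound for the norm of \<open>g n\<close>. By
  density and continuity the functionals are determined by their values on \<open>T\<close>, and it suffices
  to require the expansion for \<open>x \<in> T\<close>.
\<close>
definition nuclear_canonical_map ::
    "'a::real_vector set \<Rightarrow> ('a \<Rightarrow> real) \<Rightarrow> ('a \<Rightarrow> real) \<Rightarrow> bool" where
  "nuclear_canonical_map T q p \<longleftrightarrow>
     (\<exists>(c :: nat \<Rightarrow> real) (g :: nat \<Rightarrow> 'a \<Rightarrow> real) (y :: nat \<Rightarrow> nat \<Rightarrow> 'a).
        (\<forall>n. 0 \<le> c n \<and> linear_functional_on T (g n) \<and> (\<forall>x\<in>T. \<bar>g n x\<bar> \<le> c n * q x)) \<and>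
        (\<forall>n. (\<forall>k. y n k \<in> T) \<and> seminorm_Cauchy p (y n)) \<and>
        summable (\<lambda>n. c n * lim (\<lambda>k. p (y n k))) \<and>
        (\<forall>x\<in>T. (\<lambda>N. lim (\<lambda>k. p (x - (\<Sum>n<N. g n x *\<^sub>R y n k)))) \<longlonglongrightarrow> 0))"

definition nuclear_space :: "'a::real_vector topology \<Rightarrow> bool" where
  "nuclear_space X \<longleftrightarrow>
     locally_convex_space X \<and> Hausdorff_space X \<and>
     (\<forall>p. continuous_seminorm X p \<longrightarrow>
        (\<exists>q. continuous_seminorm X q \<and> (\<forall>x\<in>topspace X. p x \<le> q x) \<and>
             nuclear_canonical_map (topspace X) q p))"

text \<open>
  Functionals on a subspace are normalised to be \<open>undefined\<close> outside it, so that equal functionals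
  are equal functions, and the restriction of a functional to \<open>T\<close> is \<open>restrict \<phi> T\<close>.
\<close>
definition continuous_dual :: "'a::real_vector topology \<Rightarrow> ('a \<Rightarrow> real) set" where
  "continuous_dual X =
     {l \<in> extensional (topspace X). linear_functional_on (topspace X) l \<and>
        continuous_map X euclideanreal l}"

definition annihilator :: "'a::real_vector topology \<Rightarrow> 'a set \<Rightarrow> ('a \<Rightarrow> real) set" where
  "annihilator X F = {l \<in> continuous_dual X. \<forall>f\<in>F. l f = 0}"

definition dual_coset ::
    "'a::real_vector topology \<Rightarrow> 'a set \<Rightarrow> ('a \<Rightarrow> real) \<Rightarrow> ('a \<Rightarrow> real) set" where
  "dual_coset X F l = (\<lambda>m. restrict (\<lambda>t. l t + m t) (topspace X)) ` annihilator X F"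

definition dual_quotient :: "'a::real_vector topology \<Rightarrow> 'a set \<Rightarrow> ('a \<Rightarrow> real) set set" where
  "dual_quotient X F = dual_coset X F ` continuous_dual X"

text \<open>
  All members of a coset of the annihilator of \<open>F\<close> agree on \<open>F\<close>, so evaluation at \<open>f \<in> F\<close> is well
  defined on cosets, and these evaluations embed the quotient linearly into the space of real
  functions on \<open>F\<close>. The topology of pointwise convergence on \<open>F\<close> is thus a Hausdorff vector
  topology; when \<open>F\<close>, hence the quotient, is finite-dimensional, it is the only one.
\<close>
definition dual_quotient_topology ::
    "'a::real_vector topology \<Rightarrow> 'a set \<Rightarrow> ('a \<Rightarrow> real) set topology" where
  "dual_quotient_topology X F =
     pullback_topology (dual_quotient X F) (\<lambda>C. \<lambda>f\<in>F. the_elem ((\<lambda>l. l f) ` C))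
       (product_topology (\<lambda>_. euclideanreal) F)"

definition dual_quotient_borel :: "'a::real_vector topology \<Rightarrow> 'a set \<Rightarrow> ('a \<Rightarrow> real) set set set" where
  "dual_quotient_borel X F =
     sigma_sets (dual_quotient X F) {U. openin (dual_quotient_topology X F) U}"

definition cylinder_sets :: "'a::real_vector topology \<Rightarrow> ('a \<Rightarrow> real) set set" where
  "cylinder_sets X =
     {{l \<in> continuous_dual X. dual_coset X F l \<in> M} | F M.
        subspace F \<and> F \<subseteq> topspace X \<and> (\<exists>B. finite B \<and> span B = F) \<and> M \<in> dual_quotient_borel X F}"

definition cylinder_algebra :: "'a::real_vector topology \<Rightarrow> ('a \<Rightarrow> real) measure" where
  "cylinder_algebra X = sigma (continuous_dual X) (cylinder_sets X)"

definition characters :: "('a::{comm_ring_1, real_algebra_1} \<Rightarrow> real) set" where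
  "characters = {\<phi>. linear \<phi> \<and> (\<forall>x y. \<phi> (x * y) = \<phi> x * \<phi> y) \<and> \<phi> 1 = 1}"

definition nonneg_on_characters :: "'a::{comm_ring_1, real_algebra_1} set" where
  "nonneg_on_characters = {f. \<forall>\<phi>\<in>characters. 0 \<le> \<phi> f}"

definition generates_algebra :: "'a::{comm_ring_1, real_algebra_1} set \<Rightarrow> bool" where
  "generates_algebra G \<longleftrightarrow> (\<lambda>B. subspace B \<and> (\<forall>x\<in>B. \<forall>y\<in>B. x * y \<in> B)) hull G = UNIV"

definition carleman_condition ::
    "('a::{comm_ring_1, real_algebra_1} \<Rightarrow> real) \<Rightarrow> 'a \<Rightarrow> bool" where
  "carleman_condition L t \<longleftrightarrow>
     suminf (\<lambda>n. if L (t ^ (2 * Suc n)) = 0 then \<infinity>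
           else ennreal (L (t ^ (2 * Suc n)) powr (- 1 / (2 * real (Suc n))))) = (\<infinity>::ennreal)"

text \<open>
  Real polynomials in variables indexed by \<^typ>\<open>nat\<close> are finitely supported families of real
  coefficients indexed by monomials, a monomial being a finitely supported family of exponents.
\<close>
type_synonym real_mpoly = "(nat \<Rightarrow>\<^sub>0 nat) \<Rightarrow>\<^sub>0 real"

definition mpoly_vars :: "real_mpoly \<Rightarrow> nat set" where
  "mpoly_vars p = (\<Union>m\<in>Poly_Mapping.keys p. Poly_Mapping.keys m)"

definition mpoly_eval :: "real_mpoly \<Rightarrow> (nat \<Rightarrow> 'b::{comm_ring_1, real_algebra_1}) \<Rightarrow> 'b" where
  "mpoly_eval p x =
     (\<Sum>m\<in>Poly_Mapping.keys p. Poly_Mapping.lookup p m *\<^sub>R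
        (\<Prod>i\<in>Poly_Mapping.keys m. x i ^ Poly_Mapping.lookup m i))"

text \<open>
  When \<open>T \<union> {1}\<close> generates the algebra, a character is determined by its restriction to \<open>T\<close>, and
  \<open>extend_character T l\<close> is the unique character with restriction \<open>l\<close>, if there is one.
\<close>
definition extend_character ::
    "'a::{comm_ring_1, real_algebra_1} set \<Rightarrow> ('a \<Rightarrow> real) \<Rightarrow> 'a \<Rightarrow> real" where
  "extend_character T = inv_into characters (\<lambda>\<phi>. restrict \<phi> T)"

text \<open>
  Characters are identified with their restrictions to \<open>T\<close>, so a measure on a set of such
  restrictions counts as a measure on characters.
\<close>
definition character_representing_measure ::
    "'a::{comm_ring_1, real_algebra_1} set \<Rightarrow> ('a \<Rightarrow> real) \<Rightarrow> ('a \<Rightarrow> real) measure \<Rightarrow> bool" where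
  "character_representing_measure T L \<mu> \<longleftrightarrow>
     space \<mu> \<subseteq> (\<lambda>\<phi>. restrict \<phi> T) ` characters \<and>
     (\<forall>f. integrable \<mu> (\<lambda>l. extend_character T l f) \<and>
          L f = (\<integral>l. extend_character T l f \<partial>\<mu>))"

end

theory Submission
  imports Defs
begin

text \<open>
  Carleman's condition for \<open>x\<close> makes the multiples of \<open>x - \<i>\<close> dense in the pre-Hilbert space of
  complex polynomials in \<open>x\<close>, for \<open>L\<close> and for \<open>L\<close> weighted by a sum of squares: otherwise evaluation
  at \<open>\<i>\<close> would be bounded, and Green's formula for orthogonal polynomials would make the reciprocal
  Jacobi parameters summable. So \<open>1\<close> is a limit of elements \<open>(x - \<i>)\<close> to the power \<open>M\<close> times \<open>f\<close>.
  Averaging over the squares \<open>(1 + r x)\<close> to the power \<open>2 N\<close>, with real \<open>r\<close>, then shows that a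
  polynomial \<open>P\<close> in \<open>x\<close> with coefficients in the algebra satisfies \<open>L (P(x) f^2) \<ge> 0\<close> for all \<open>f\<close>
  as soon as all \<open>P(r)\<close> do. Substituting the variables one by one, \<open>L\<close> is nonnegative on the
  polynomials in \<open>S\<close> that are nonnegative functions; under assumption (i) this is immediate.

  By M. Riesz's extension theorem \<open>L\<close> extends to a positive functional on all polynomially bounded
  functions on the space of real functions on \<open>S\<close>, hence defines a finitely additive measure on
  all its subsets. It is countably additive on the Stone space, where limits of the coordinate
  functions along ultrafilters form a random linear functional \<open>W\<close> on \<open>T\<close> with moments \<open>L\<close>.

  Nuclearity provides an expansion \<open>t = (\<Sum>i. g i t *\<^sub>R y i)\<close> with \<open>\<bar>g i t\<bar> \<le> c i * q' t\<close> and
  \<open>(\<Sum>i. c i * q (y i)) < \<infinity>\<close>. As \<open>\<bar>W (y i)\<bar>\<close> has expectation at most a multiple of \<open>q (y i)\<close>, the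
  series \<open>\<Sum>i. c i * \<bar>W (y i)\<bar>\<close> converges almost surely, and \<open>t \<mapsto> (\<Sum>i. g i t * W (y i))\<close> is a
  version of \<open>W\<close> with values in the continuous dual. Its law is the measure \<open>\<mu>\<close>.
\<close>

section \<open>Orthogonal polynomials and Carleman's condition\<close>

text \<open>Nonnegative polynomials in several variables need not be sums of squares, so positivity
  on squares gives no direct control of them, and Carleman's condition speaks about single elements
  of \<open>S\<close> only. Hence the passage through one variable at a time, the other variables
  being absorbed into coefficients. The property \<open>square_positive L a\<close> is the
  substitute for pointwise nonnegativity of \<open>a\<close> that survives each substitution.
  Divided by (1 + x^2)^N, the square (1 + r x)^(2 N) is peaked at the real point r. This division is
  impossible in the algebra; approximate units divisible by powers of x - \<i> supply the missing
  factor 1 + x^2 instead. As \<open>S\<close> may be uncountable, a representing random functional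
  is determined only almost surely for each single t. Its continuity has to be arranged for all t at
  once, and nuclearity does so from countably many of its values.\<close>

definition square_positive :: "('a::comm_ring_1 \<Rightarrow> real) \<Rightarrow> 'a \<Rightarrow> bool" where
  "square_positive L a \<longleftrightarrow> (\<forall>f. 0 \<le> L (a * f^2))"

lemma square_positiveD: "square_positive L a \<Longrightarrow> 0 \<le> L (a * f^2)" by (simp add: square_positive_def)

lemma linear_scale_of_real:
  fixes L :: "'a::{comm_ring_1, real_algebra_1} \<Rightarrow> real"
  assumes "linear L"
  shows "L (of_real c * a) = c * L a" "L (a * of_real c) = c * L a"
  using linear_cmul[OF assms, of c a] by (simp_all add: scaleR_conv_of_real mult.commute)

text \<open>The quadratic form in two real parameters (s, t) is nonnegative. For p > 0 the choice
  (r, -p) yields p * (p * q - r^2) >= 0; for p = 0 a nonzero r is refuted by parameters at which the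
  form equals -1.\<close>

lemma square_positive_Cauchy_Schwarz:
  fixes L :: "'a::{comm_ring_1, real_algebra_1} \<Rightarrow> real"
  assumes L: "linear L" and W: "square_positive L W"
  shows "(L (W * (a * b)))^2 \<le> L (W * a^2) * L (W * b^2)"
proof -
  define p q r where "p = L (W * a^2)" and "q = L (W * b^2)" and "r = L (W * (a * b))"
  have quad: "0 \<le> s^2 * p + 2 * s * t * r + t^2 * q" for s t :: real
  proof -
    have "W * (of_real s * a + of_real t * b)^2 =
        of_real (s^2) * (W * a^2) + of_real (2 * s * t) * (W * (a * b)) + of_real (t^2) * (W * b^2)"
      by (simp add: power2_eq_square algebra_simps)
    hence "L (W * (of_real s * a + of_real t * b)^2) = s^2 * p + 2 * s * t * r + t^2 * q"
      unfolding p_def q_def r_def by (simp only: linear_add[OF L] linear_scale_of_real[OF L])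
    thus ?thesis using square_positiveD[OF W] by metis
  qed
  have p0: "0 \<le> p" and q0: "0 \<le> q" using W by (simp_all add: p_def q_def square_positive_def)
  have "r^2 \<le> p * q"
  proof (cases "p = 0")
    case True
    have "r = 0"
    proof (rule ccontr)
      assume "r \<noteq> 0"
      thus False
        using quad[of "- (q + 1) / (2 * r)" 1] True by (simp add: field_simps)
    qed
    thus ?thesis using True by simp
  next
    case False
    have "0 \<le> p * (p * q - r^2)"
      using quad[of r "- p"] by (simp add: power2_eq_square algebra_simps)
    thus ?thesis using False p0 by (simp add: zero_le_mult_iff)
  qed
  thus ?thesis by (simp add: p_def q_def r_def)
qed

section \<open>Carleman's inequality for series of geometric means\<close>

text \<open>Polya's weights: the arithmetic-geometric mean inequality is applied to c k * a k, where
  the product of the c k telescopes to (n+2)^(n+1), so that its root of order n+1 is exactly n+2.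
  The factor e comes from (1 + 1/(k+1))^(k+1) <= e, which gives c k <= e * (k+1).\<close>

lemma geometric_mean_le_weighted_sum:
  fixes a :: "nat \<Rightarrow> real"
  assumes "\<And>k. 0 < a k"
  shows "(\<Prod>k\<le>n. a k) powr (1 / real (Suc n)) \<le>
    (\<Sum>k\<le>n. exp 1 * (real (Suc k) * a k)) / (real (Suc n) * real (Suc (Suc n)))"
proof -
  define c where "c k = real (Suc (Suc k)) ^ Suc k / real (Suc k) ^ k" for k
  have cpos: "0 < c k" for k by (simp add: c_def)
  have prodc: "(\<Prod>k\<le>n. c k) = real (Suc (Suc n)) ^ Suc n" by (induction n) (simp_all add: c_def)
  have cle: "c k \<le> exp 1 * real (Suc k)" for k
  proof -
    have "(1 + 1 / real (Suc k)) ^ Suc k \<le> exp (1 / real (Suc k)) ^ Suc k"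
      by (intro power_mono exp_ge_add_one_self) simp
    also have "... = exp 1" by (simp add: exp_of_nat_mult[symmetric] del: power_Suc)
    finally have "(1 + 1 / real (Suc k)) ^ Suc k \<le> exp 1" .
    moreover have "c k = (1 + 1 / real (Suc k)) ^ Suc k * real (Suc k)"
    proof -
      have "1 + 1 / real (Suc k) = real (Suc (Suc k)) / real (Suc k)" by (simp add: field_simps)
      thus ?thesis by (simp add: c_def power_divide)
    qed
    ultimately show ?thesis by (simp add: mult_right_mono)
  qed
  have "real (Suc (Suc n)) * (\<Prod>k\<le>n. a k) powr (1 / real (Suc n)) =
      (real (Suc (Suc n)) ^ Suc n * (\<Prod>k\<le>n. a k)) powr (1 / real (Suc n))"
    using assms by (simp add: powr_mult prod_pos powr_realpow[symmetric] powr_powr less_imp_le prod_nonneg del: power_Suc)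
  also have "... = (\<Prod>k\<in>{..n}. c k * a k) powr (1 / card {..n})" by (simp add: prod.distrib prodc)
  also have "... \<le> (\<Sum>k\<in>{..n}. c k * a k / card {..n})"
    by (rule arith_geom_mean) (use assms cpos in \<open>auto intro: less_imp_le mult_pos_pos\<close>)
  also have "... = (\<Sum>k\<in>{..n}. c k * a k) / real (Suc n)" by (simp add: sum_divide_distrib)
  finally have "(\<Prod>k\<le>n. a k) powr (1 / real (Suc n)) \<le>
      (\<Sum>k\<in>{..n}. c k * a k) / (real (Suc n) * real (Suc (Suc n)))"
    by (simp add: field_simps del: of_nat_Suc)
  also have "... \<le> (\<Sum>k\<le>n. exp 1 * (real (Suc k) * a k)) / (real (Suc n) * real (Suc (Suc n)))"
    using cle assms by (intro divide_right_mono sum_mono) (simp_all add: mult.assoc[symmetric] mult_right_mono less_imp_le)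
  finally show ?thesis .
qed

text \<open>After exchanging the sums, the weights 1/((n+1)(n+2)) with n >= k telescope to at most
  1/(k+1), which cancels the factor k+1 in front of a k.\<close>

lemma Carleman_inequality:
  fixes a :: "nat \<Rightarrow> real"
  assumes pos: "\<And>k. 0 < a k" and summ: "summable a"
  shows "summable (\<lambda>n. (\<Prod>k\<le>n. a k) powr (1 / real (Suc n)))"
proof (rule summableI_nonneg_bounded)
  fix N
  have tele: "(\<Sum>n\<in>{k..<N}. 1 / (real (Suc n) * real (Suc (Suc n)))) \<le> 1 / real (Suc k)" for k
  proof (cases "k \<le> N")
    case True
    have "(\<Sum>n\<in>{k..<N}. 1 / (real (Suc n) * real (Suc (Suc n)))) =
        (\<Sum>n\<in>{k..<N}. - 1 / real (Suc (Suc n)) - (- 1 / real (Suc n)))"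
      by (intro sum.cong refl) (simp add: divide_simps)
    also have "... = - 1 / real (Suc N) - (- 1 / real (Suc k))" using True by (rule sum_Suc_diff')
    finally show ?thesis by simp
  qed simp
  have "(\<Sum>n<N. (\<Prod>k\<le>n. a k) powr (1 / real (Suc n))) \<le>
      (\<Sum>n<N. \<Sum>k\<le>n. exp 1 * (real (Suc k) * a k) * (1 / (real (Suc n) * real (Suc (Suc n)))))"
    using geometric_mean_le_weighted_sum[of a, OF pos] 
    by (intro sum_mono) (simp add: sum_divide_distrib)
  also have "... = (\<Sum>k<N. \<Sum>n\<in>{k..<N}. exp 1 * (real (Suc k) * a k) * (1 / (real (Suc n) * real (Suc (Suc n)))))"
  proof -
    have "(\<Sum>n<N. \<Sum>k\<le>n. f k n) = (\<Sum>k<N. \<Sum>n\<in>{k..<N}. f k n)" for f :: "nat \<Rightarrow> nat \<Rightarrow> real"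
      by (subst sum.Sigma, simp, simp, subst sum.Sigma, simp, simp)
        (rule sum.reindex_bij_witness[where i="\<lambda>(a,b). (b,a)" and j="\<lambda>(a,b). (b,a)"], auto)
    thus ?thesis .
  qed
  also have "... = (\<Sum>k<N. exp 1 * (real (Suc k) * a k) * (\<Sum>n\<in>{k..<N}. 1 / (real (Suc n) * real (Suc (Suc n)))))"
    by (simp only: sum_distrib_left)
  also have "... \<le> (\<Sum>k<N. exp 1 * (real (Suc k) * a k) * (1 / real (Suc k)))"
    by (intro sum_mono mult_left_mono tele) (use pos in \<open>auto intro!: mult_nonneg_nonneg less_imp_le\<close>)
  also have "... = (\<Sum>k<N. exp 1 * a k)" by (intro sum.cong refl) (simp add: field_simps)
  also have "... \<le> exp 1 * suminf a"
    using summ pos by (simp add: sum_distrib_left[symmetric] sum_le_suminf less_imp_le)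
  finally show "(\<Sum>n<N. (\<Prod>k\<le>n. a k) powr (1 / real (Suc n))) \<le> exp 1 * suminf a" .
qed simp

section \<open>Orthogonal polynomials of a positive functional\<close>

text \<open>
  The orthogonal polynomials in \<open>x\<close> are elements of the algebra, generated by their three-term
  recurrence; the index is shifted by one, and the quotient in the last term is \<open>c / 0 = 0\<close> in the
  first step. \<open>orth_i\<close> is their evaluation at the point \<open>\<i>\<close>.
\<close>
locale positive_functional =
  fixes l :: "'a::{comm_ring_1, real_algebra_1} \<Rightarrow> real" and x :: 'a
  assumes linear: "linear l" and nonneg: "0 \<le> l (f^2)"
begin

fun orth :: "nat \<Rightarrow> 'a" where
  "orth 0 = 0"
| "orth (Suc 0) = 1"
| "orth (Suc (Suc n)) =
    (x - of_real (l (x * (orth (Suc n))^2) / l ((orth (Suc n))^2))) * orth (Suc n)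
     - of_real (l ((orth (Suc n))^2) / l ((orth n)^2)) * orth n"

definition sqnorm :: "nat \<Rightarrow> real" where "sqnorm n = l ((orth n)^2)"

definition diag :: "nat \<Rightarrow> real" where "diag n = l (x * (orth n)^2) / sqnorm n"

fun orth_i :: "nat \<Rightarrow> complex" where
  "orth_i 0 = 0"
| "orth_i (Suc 0) = 1"
| "orth_i (Suc (Suc n)) =
    (\<i> - diag (Suc n)) * orth_i (Suc n) - sqnorm (Suc n) / sqnorm n * orth_i n"

lemma orth_Suc_Suc:
  "orth (Suc (Suc n)) = x * orth (Suc n) - of_real (diag (Suc n)) * orth (Suc n)
     - of_real (sqnorm (Suc n) / sqnorm n) * orth n"
  by (simp add: diag_def sqnorm_def algebra_simps)

lemma x_orth:
  "x * orth (Suc n) = orth (Suc (Suc n)) + of_real (diag (Suc n)) * orth (Suc n)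
     + of_real (sqnorm (Suc n) / sqnorm n) * orth n" by (simp only: orth_Suc_Suc) simp

declare orth.simps(3)[simp del] orth_i.simps(3)[simp del]

lemma sqnorm_0 [simp]: "sqnorm 0 = 0" using linear_0[OF linear] by (simp add: sqnorm_def)

lemma sqnorm_nonneg: "0 \<le> sqnorm n" by (simp add: sqnorm_def nonneg)

lemmas l_simps = linear_add[OF linear] linear_diff[OF linear] linear_scale_of_real[OF linear]

lemma l_expand:
  "l (a * (b + of_real c * d + of_real e * f)) = l (a * b) + c * l (a * d) + e * l (a * f)"
proof -
  have "a * (b + of_real c * d + of_real e * f) = a * b + of_real c * (a * d) + of_real e * (a * f)"
    by (simp add: algebra_simps)
  thus ?thesis by (simp only: l_simps)
qed

text \<open>Multiplication by x is symmetric for the form \<open>l (a * b)\<close>, so the factor x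
  can be moved from \<open>orth n\<close> to \<open>orth i\<close>, where the recurrence applies.
  Only the norms below n have to be nonzero, so the first null polynomial is still covered.\<close>

lemma orthogonal:
  assumes "\<forall>j. 0 < j \<and> j < n \<longrightarrow> sqnorm j \<noteq> 0" and "i < j" and "j \<le> n"
  shows "l (orth i * orth j) = 0" using assms
proof (induction n arbitrary: i j)
  case (Suc n)
  have IH: "l (orth i * orth j) = 0" if "i < j" "j \<le> n" for i j
    using Suc.IH[of i j] Suc.prems(1) that by auto
  have IH': "l (orth i * orth j) = (if i = j then sqnorm i else 0)" if "i \<le> n" "j \<le> n" for i j
    using IH[of i j] IH[of j i] that by (auto simp: sqnorm_def power2_eq_square mult.commute neq_iff)
  show ?case
  proof (cases "j = Suc n \<and> 0 < i")
    case False
    thus ?thesis using IH[of i j] Suc.prems linear_0[OF linear] by auto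
  next
    case True
    then obtain k m where i: "i = Suc k" and n: "n = Suc m"
      using Suc.prems by (cases i; cases n) auto
    have km: "k \<le> m" using True Suc.prems i n by auto
    have nz: "sqnorm (Suc m) \<noteq> 0" using Suc.prems(1) n by auto
    have "l (orth i * orth j) = l (orth i * (x * orth n)) - diag n * l (orth i * orth n)
        - sqnorm n / sqnorm m * l (orth i * orth m)"
    proof -
      have "orth i * orth (Suc (Suc m)) = orth i * (x * orth (Suc m))
          - of_real (diag (Suc m)) * (orth i * orth (Suc m))
          - of_real (sqnorm (Suc m) / sqnorm m) * (orth i * orth m)"
        by (simp only: orth_Suc_Suc) (simp add: algebra_simps)
      thus ?thesis using True n by (simp only: l_simps)
    qed
    also have "l (orth i * (x * orth n)) =
        l (orth n * orth (Suc i)) + diag i * l (orth n * orth i) + sqnorm i / sqnorm k * l (orth n * orth k)"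
    proof -
      have "orth i * (x * orth n) = orth n * (x * orth (Suc k))" by (simp add: i ac_simps)
      thus ?thesis by (simp only: x_orth l_expand i)
    qed
    also have "... - diag n * l (orth i * orth n) - sqnorm n / sqnorm m * l (orth i * orth m) = 0"
    proof -
      \<comment> \<open>The cases are i = n, i = n - 1 and i < n - 1: the diagonal coefficient
        cancels the first, the quotient of norms the second, and in the third every term
        vanishes.\<close>
      consider "k = m" | "m = Suc k" | "Suc k < m" using km by linarith
      thus ?thesis
      proof cases
        case 1
        have "l (orth n * orth (Suc i)) + diag i * l (orth n * orth i) = l (x * (orth n)^2)
            - sqnorm i / sqnorm k * l (orth n * orth k)"
          using 1 i n l_expand[of "orth n" "orth (Suc i)" "diag i" "orth i" "sqnorm i / sqnorm k" "orth k"]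
          by (simp add: x_orth[symmetric] power2_eq_square mult.left_commute)
        moreover have "l (x * (orth n)^2) = diag n * sqnorm n" using nz n by (simp add: diag_def)
        ultimately show ?thesis using 1 i n IH'[of n n] IH'[of n m] by simp
      next
        case 2
        hence "sqnorm m \<noteq> 0" using Suc.prems(1) n by auto
        thus ?thesis using 2 i n by (simp add: IH')
      next
        case 3
        thus ?thesis using i n by (simp add: IH')
      qed
    qed
    finally show ?thesis .
  qed
qed simp

text \<open>For n > 0 the polynomial \<open>orth n\<close> is monic of degree n - 1, hence
  orthogonal to lower powers, while its product with x^(n-1) gives its own squared norm.\<close>

lemma orthogonal_power:
  assumes nz: "\<And>j. 0 < j \<Longrightarrow> sqnorm j \<noteq> 0"
  shows "j + 1 \<le> n \<Longrightarrow> l (orth n * x ^ j) = (if j + 1 = n then sqnorm n else 0)"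
proof (induction j arbitrary: n)
  case 0
  thus ?case using orthogonal[of n 1 n] nz by (auto simp: sqnorm_def power2_eq_square)
next
  case (Suc j)
  then obtain m where n: "n = Suc m" by (cases n) auto
  have "orth n * x ^ Suc j = x ^ j * (x * orth (Suc m))" by (simp add: n ac_simps)
  hence "l (orth n * x ^ Suc j) =
      l (x ^ j * orth (Suc n)) + diag n * l (x ^ j * orth n) + sqnorm n / sqnorm m * l (x ^ j * orth m)"
    by (simp only: x_orth l_expand n)
  thus ?case using Suc.IH[of "Suc n"] Suc.IH[of n] Suc.IH[of m] Suc.prems n nz[of m]
    by (auto simp: mult.commute)
qed

lemma Cauchy_Schwarz: "(l (a * b))^2 \<le> l (a^2) * l (b^2)"
  using square_positive_Cauchy_Schwarz[OF linear, of 1 a b] nonneg by (simp add: square_positive_def)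

text \<open>Cauchy-Schwarz for \<open>orth (Suc n)\<close> and x^n, whose product is the squared
  norm of \<open>orth (Suc n)\<close>.\<close>

lemma sqnorm_le_moment:
  assumes nz: "\<And>j. 0 < j \<Longrightarrow> sqnorm j \<noteq> 0"
  shows "sqnorm (Suc n) \<le> l (x ^ (2 * n))"
proof -
  have "(sqnorm (Suc n))^2 \<le> sqnorm (Suc n) * l (x ^ (2 * n))"
    using Cauchy_Schwarz[of "orth (Suc n)" "x ^ n"] orthogonal_power[of n "Suc n", OF nz]
    by (simp add: sqnorm_def power_mult[symmetric] mult.commute)
  thus ?thesis using nz[of "Suc n"] sqnorm_nonneg[of "Suc n"] by (simp add: power2_eq_square)
qed

text \<open>The Christoffel-Darboux formula at the points \<i> and -\<i>. As \<open>diag\<close> is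
  real, only the \<i> of the recurrence adds a squared modulus to the imaginary part, and the lower
  term returns the formula for n.\<close>

lemma Green_formula:
  assumes nz: "\<And>j. 0 < j \<Longrightarrow> j \<le> n \<Longrightarrow> sqnorm j \<noteq> 0"
  shows "Im (orth_i (Suc n) * cnj (orth_i n)) = sqnorm n * (\<Sum>k\<le>n. (cmod (orth_i k))^2 / sqnorm k)"
  using assms
proof (induction n)
  case (Suc n)
  have IH: "Im (orth_i (Suc n) * cnj (orth_i n)) = sqnorm n * (\<Sum>k\<le>n. (cmod (orth_i k))^2 / sqnorm k)"
    using Suc by auto
  have "Im (orth_i (Suc (Suc n)) * cnj (orth_i (Suc n))) =
      (cmod (orth_i (Suc n)))^2 + sqnorm (Suc n) / sqnorm n * Im (orth_i (Suc n) * cnj (orth_i n))"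
    unfolding cmod_power2 by (simp add: orth_i.simps(3) power2_eq_square algebra_simps diff_divide_distrib)
  also have "sqnorm (Suc n) / sqnorm n * Im (orth_i (Suc n) * cnj (orth_i n)) =
      sqnorm (Suc n) * (\<Sum>k\<le>n. (cmod (orth_i k))^2 / sqnorm k)"
    \<comment> \<open>For n = 0 the quotient is c / 0 = 0, and the sum vanishes because
      \<open>orth_i 0\<close> is 0.\<close>
    using IH Suc.prems[of n] by (cases n) auto
  finally show ?case using Suc.prems[of "Suc n"] by (simp add: field_simps)
qed simp

text \<open>The polynomial \<open>orth n - orth_i n\<close> is divisible by \<open>x - \<i>\<close>, with quotient \<open>u + \<i> v\<close>.\<close>
lemma orth_divisible:
  "\<exists>u v. orth n - of_real (Re (orth_i n)) = x * u + v \<and> - of_real (Im (orth_i n)) = x * v - u"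
proof (induction n rule: induct_nat_012)
  case 0
  show ?case by (rule exI[of _ 0], rule exI[of _ 0]) simp
next
  case 1
  show ?case by (rule exI[of _ 0], rule exI[of _ 0]) simp
next
  case (ge2 n)
  obtain u v where uv: "orth (Suc n) - of_real (Re (orth_i (Suc n))) = x * u + v"
      "- of_real (Im (orth_i (Suc n))) = x * v - u" using ge2 by blast
  obtain u' v' where uv': "orth n - of_real (Re (orth_i n)) = x * u' + v'"
      "- of_real (Im (orth_i n)) = x * v' - u'" using ge2 by blast
  define a c :: 'a where "a = of_real (diag (Suc n))" and "c = of_real (sqnorm (Suc n) / sqnorm n)"
  have o: "orth (Suc (Suc n)) = x * orth (Suc n) - a * orth (Suc n) - c * orth n"
    by (simp only: orth_Suc_Suc a_def c_def)
  have "of_real (Re (orth_i (Suc (Suc n)))) =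
      - of_real (Im (orth_i (Suc n))) - a * of_real (Re (orth_i (Suc n))) - c * of_real (Re (orth_i n))"
    "of_real (Im (orth_i (Suc (Suc n)))) =
      of_real (Re (orth_i (Suc n))) - a * of_real (Im (orth_i (Suc n))) - c * of_real (Im (orth_i n))"
    unfolding a_def c_def of_real_mult[symmetric] of_real_diff[symmetric] of_real_minus[symmetric]
    by (simp_all add: orth_i.simps(3) algebra_simps)
  moreover have "of_real (Re (orth_i (Suc n))) = orth (Suc n) - (x * u + v)"
    "of_real (Im (orth_i (Suc n))) = u - x * v" "of_real (Re (orth_i n)) = orth n - (x * u' + v')"
    "of_real (Im (orth_i n)) = u' - x * v'"
    using uv uv' by (simp_all add: algebra_simps minus_equation_iff[of "of_real _"])
  ultimately show ?case
    \<comment> \<open>From (x - a) P - (\<i> - a) p = (x - \<i>) P + (\<i> - a) (P - p), the new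
      quotient is \<open>orth (Suc n)\<close> plus \<i> - a times the last quotient minus c times
      the one before. The witnesses are its real and imaginary parts.\<close>
    by (intro exI[of _ "orth (Suc n) - a * u - v - c * u'"] exI[of _ "u - a * v - c * v'"])
      (simp add: o algebra_simps)
qed

text \<open>Divisibility by x - \<i> for complex combinations with coefficients w; real and
  imaginary parts are separate equations because the algebra is real.\<close>

lemma combination_divisible:
  "\<exists>u v. (\<Sum>k\<le>n. of_real (Re (w k)) * orth k) - of_real (Re (\<Sum>k\<le>n. w k * orth_i k)) = x * u + v \<and>
         (\<Sum>k\<le>n. of_real (Im (w k)) * orth k) - of_real (Im (\<Sum>k\<le>n. w k * orth_i k)) = x * v - u"
proof (induction n)
  case 0
  show ?case by (rule exI[of _ 0], rule exI[of _ 0]) simp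
next
  case (Suc n)
  then obtain u v where
    "(\<Sum>k\<le>n. of_real (Re (w k)) * orth k) - of_real (Re (\<Sum>k\<le>n. w k * orth_i k)) = x * u + v"
    "(\<Sum>k\<le>n. of_real (Im (w k)) * orth k) - of_real (Im (\<Sum>k\<le>n. w k * orth_i k)) = x * v - u"
    by blast
  note uv = this[unfolded diff_eq_eq]
  obtain u' v' where uv': "orth (Suc n) - of_real (Re (orth_i (Suc n))) = x * u' + v'"
      "- of_real (Im (orth_i (Suc n))) = x * v' - u'" using orth_divisible by blast
  have re: "of_real (Re (orth_i (Suc n))) = orth (Suc n) - (x * u' + v')"
    and im: "of_real (Im (orth_i (Suc n))) = u' - x * v'"
    using uv' by (simp_all add: algebra_simps minus_equation_iff[of "of_real _"])
  define r s where "r = (of_real (Re (w (Suc n))) :: 'a)" and "s = (of_real (Im (w (Suc n))) :: 'a)"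
  show ?case by (rule exI[of _ "u + r * u' - s * v'"], rule exI[of _ "v + r * v' + s * u'"])
      (simp add: uv re im r_def[symmetric] s_def[symmetric] del: Re_sum Im_sum, simp add: algebra_simps)
qed

lemma norm_combination:
  assumes nz: "\<forall>j. 0 < j \<and> j < n \<longrightarrow> sqnorm j \<noteq> 0"
  shows "l ((\<Sum>k\<le>n. of_real (r k) * orth k)^2) = (\<Sum>k\<le>n. (r k)^2 * sqnorm k)"
proof -
  have "(\<Sum>k\<le>n. of_real (r k) * orth k)^2 = (\<Sum>k\<le>n. \<Sum>j\<le>n. of_real (r k * r j) * (orth k * orth j))"
    by (simp add: power2_eq_square sum_product ac_simps)
  hence "l ((\<Sum>k\<le>n. of_real (r k) * orth k)^2) =
      (\<Sum>k\<le>n. \<Sum>j\<le>n. r k * r j * l (orth k * orth j))" by (simp only: linear_sum[OF linear] l_simps)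
  also have "... = (\<Sum>k\<le>n. \<Sum>j\<le>n. if k = j then (r k)^2 * sqnorm k else 0)"
  proof (intro sum.cong refl)
    fix k j assume "k \<in> {..n}" "j \<in> {..n}"
    thus "r k * r j * l (orth k * orth j) = (if k = j then (r k)^2 * sqnorm k else 0)"
      using orthogonal[OF nz, of k j] orthogonal[OF nz, of j k]
      by (auto simp: sqnorm_def power2_eq_square neq_iff mult.commute)
  qed
  finally show ?thesis by simp
qed

text \<open>A combination with value 1 at \<i> has the form 1 - (x - \<i>) f, so its norm measures
  how well (x - \<i>) f approximates 1. The expression in u and v is the squared modulus of 1 - (x -
  \<i>) (u + \<i> v).\<close>

lemma inverse_from_combination:
  assumes nz: "\<forall>j. 0 < j \<and> j < n \<longrightarrow> sqnorm j \<noteq> 0" and w: "(\<Sum>k\<le>n. w k * orth_i k) = 1"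
  shows "\<exists>u v. l ((1 - (x * u + v))^2 + (x * v - u)^2) = (\<Sum>k\<le>n. (cmod (w k))^2 * sqnorm k)"
proof -
  obtain u v where uv: "(\<Sum>k\<le>n. of_real (Re (w k)) * orth k) - 1 = x * u + v"
      "(\<Sum>k\<le>n. of_real (Im (w k)) * orth k) = x * v - u"
    using combination_divisible[of w n] unfolding w by auto
  have "1 - (x * (- u) + (- v)) = (\<Sum>k\<le>n. of_real (Re (w k)) * orth k)"
    "x * (- v) - (- u) = - (\<Sum>k\<le>n. of_real (Im (w k)) * orth k)"
    using uv by (simp_all add: algebra_simps)
  hence "l ((1 - (x * (- u) + (- v)))^2 + (x * (- v) - (- u))^2) =
      (\<Sum>k\<le>n. (Re (w k))^2 * sqnorm k) + (\<Sum>k\<le>n. (Im (w k))^2 * sqnorm k)"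
    by (simp add: l_simps norm_combination[OF nz])
  also have "... = (\<Sum>k\<le>n. (cmod (w k))^2 * sqnorm k)"
    by (simp add: cmod_power2 sum.distrib[symmetric] algebra_simps)
  finally show ?thesis by blast
qed

text \<open>
  If no approximate inverse exists, evaluation at \<open>\<i>\<close> is bounded, so \<open>orth_i k / sqrt (sqnorm k)\<close> is
  square summable, and Green's formula turns this into summability of the reciprocals
  \<open>sqrt (sqnorm k / sqnorm (k + 1))\<close> of the off-diagonal Jacobi parameters.
\<close>
lemma approximate_inverse:
  assumes Carleman: "\<not> ((\<forall>n. 0 < l (x ^ (2 * Suc n))) \<and>
      summable (\<lambda>n. l (x ^ (2 * Suc n)) powr (- 1 / (2 * real (Suc n)))))"
    and "0 < \<epsilon>"
  shows "\<exists>u v. l ((1 - (x * u + v))^2 + (x * v - u)^2) < \<epsilon>"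
proof -
  let ?E = "\<lambda>u v. (1 - (x * u + v))^2 + (x * v - u)^2"
  show ?thesis
  proof (cases "\<exists>n>0. sqnorm n = 0")
  case True
  \<comment> \<open>The first null orthogonal polynomial, rescaled to value 1 at \<i>, gives error
    exactly 0.\<close>
  define n where "n = (LEAST n. 0 < n \<and> sqnorm n = 0)"
  have n: "0 < n" "sqnorm n = 0" and less: "\<And>j. 0 < j \<Longrightarrow> j < n \<Longrightarrow> sqnorm j \<noteq> 0"
    using LeastI_ex[OF True[unfolded Bex_def]] not_less_Least[of _ "\<lambda>n. 0 < n \<and> sqnorm n = 0"]
    unfolding n_def by auto
  \<comment> \<open>Green's formula one index lower: its right side is positive, so the product on
    the left cannot vanish.\<close>
  have "orth_i n \<noteq> 0"
  proof (cases "n = 1")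
    case False
    then obtain m where m: "n = Suc m" "0 < m" using n by (cases n) auto
    have "0 < (cmod (orth_i 1))^2 / sqnorm 1" using less[of 1] m sqnorm_nonneg[of 1] by auto
    also have "... \<le> (\<Sum>k\<le>m. (cmod (orth_i k))^2 / sqnorm k)"
      by (rule member_le_sum) (use m sqnorm_nonneg in auto)
    finally have "0 < sqnorm m * (\<Sum>k\<le>m. (cmod (orth_i k))^2 / sqnorm k)"
      using less[of m] m sqnorm_nonneg[of m] by auto
    thus ?thesis using Green_formula[of m] less m by auto
  qed simp
  hence "(\<Sum>k\<le>n. (if k = n then 1 / orth_i n else 0) * orth_i k) = 1"
    by (simp add: if_distrib[of "\<lambda>c. c * _"] cong: if_cong)
  from inverse_from_combination[OF _ this] less
  obtain u v where "l (?E u v) =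
      (\<Sum>k\<le>n. (cmod (if k = n then 1 / orth_i n else 0))^2 * sqnorm k)" by blast
  also have "... = 0" using n by (intro sum.neutral) auto
  finally have "l (?E u v) < \<epsilon>" using \<open>0 < \<epsilon>\<close> by linarith
  thus ?thesis by blast
next
  case False
  hence pos: "0 < sqnorm n" if "0 < n" for n
    using that sqnorm_nonneg[of n] by (metis less_eq_real_def)
  have nz: "\<And>j. 0 < j \<Longrightarrow> sqnorm j \<noteq> 0" by (metis pos less_irrefl)
  define b where "b k = (cmod (orth_i k))^2 / sqnorm k" for k
  define S where "S n = (\<Sum>k\<le>n. b k)" for n
  have b0: "0 \<le> b k" for k by (simp add: b_def sqnorm_nonneg)
  have S1: "1 / sqnorm 1 \<le> S n" if "0 < n" for n
  proof -
    have "b 1 \<le> S n" unfolding S_def by (rule member_le_sum) (use that b0 in auto)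
    thus ?thesis by (simp add: b_def)
  qed
  have Spos: "0 < S n" if "0 < n" for n
    using S1[OF that] pos[of 1] by (meson less_le_trans zero_less_divide_1_iff zero_less_one)
  have appr: "\<exists>u v. l (?E u v) = 1 / S n" if n: "0 < n" for n
  proof -
    \<comment> \<open>Extremal coefficients, from equality in Cauchy-Schwarz: among the combinations
      with value 1 at \<i> they reach the least squared norm 1 / S n.\<close>
    define w where "w k = cnj (orth_i k) / (sqnorm k * S n)" for k
    have "w k * orth_i k = of_real (b k / S n)" for k
      using complex_norm_square[of "orth_i k"] by (simp add: w_def b_def mult.commute)
    hence "(\<Sum>k\<le>n. w k * orth_i k) = of_real (\<Sum>k\<le>n. b k / S n)" by simp
    also have "(\<Sum>k\<le>n. b k / S n) = 1"
      using Spos[OF n] by (simp add: sum_divide_distrib[symmetric] S_def)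
    finally have w1: "(\<Sum>k\<le>n. w k * orth_i k) = 1" by simp
    have "(cmod (w k))^2 * sqnorm k = b k / (S n)^2" for k
      by (cases "sqnorm k = 0") (simp_all add: w_def b_def norm_divide norm_mult power_divide
          power_mult_distrib power2_eq_square[of "sqnorm k"])
    hence "(\<Sum>k\<le>n. (cmod (w k))^2 * sqnorm k) = S n / (S n)^2"
      by (simp add: sum_divide_distrib[symmetric] S_def)
    also have "... = 1 / S n" by (simp add: power2_eq_square)
    finally show ?thesis using inverse_from_combination[OF _ w1] nz by metis
  qed
  show ?thesis
  proof (rule ccontr)
    assume none: "\<not> ?thesis"
    have Sle: "S n \<le> 1 / \<epsilon>" for n
    proof (cases "n = 0")
      case False
      hence "\<epsilon> \<le> 1 / S n" using none appr[of n] by (metis not_less gr0I)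
      thus ?thesis using Spos[of n] False \<open>0 < \<epsilon>\<close> by (simp add: field_simps)
    qed (use \<open>0 < \<epsilon>\<close> in \<open>simp add: S_def b_def\<close>)
    have bsum: "summable b"
      by (rule bounded_imp_summable[of b "1 / \<epsilon>"]) (use b0 Sle in \<open>auto simp: S_def\<close>)
    define a where "a k = sqrt (sqnorm (Suc k) / sqnorm (Suc (Suc k)))" for k
    have apos: "0 < a k" for k using pos by (simp add: a_def)
    let ?b = "\<lambda>k. (b (Suc k) + b (Suc (Suc k))) / 2"
    \<comment> \<open>Green's formula bounds \<open>sqnorm (Suc k) * S (Suc k)\<close> by the
      product of two consecutive moduli. Since S is at least 1 / \<open>sqnorm 1\<close>, each
      reciprocal Jacobi parameter is dominated by a mean of two terms of the summable b.\<close>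
    have ale: "a k \<le> sqnorm 1 * (?b k)" for k
    proof -
      let ?u = "sqnorm (Suc k)" and ?v = "sqnorm (Suc (Suc k))"
      have "?u * (1 / sqnorm 1) \<le> ?u * S (Suc k)"
        using S1[of "Suc k"] pos[of "Suc k"] by (intro mult_left_mono) auto
      also have "... = Im (orth_i (Suc (Suc k)) * cnj (orth_i (Suc k)))"
        using Green_formula[of "Suc k"] nz by (simp add: S_def b_def)
      also have "... \<le> cmod (orth_i (Suc (Suc k))) * cmod (orth_i (Suc k))"
        by (metis abs_Im_le_cmod abs_le_D1 complex_mod_cnj norm_mult)
      also have "... = sqrt (b (Suc k) * b (Suc (Suc k))) * sqrt (?u * ?v)"
        using pos[of "Suc k"] pos[of "Suc (Suc k)"] by (simp add: b_def real_sqrt_mult real_sqrt_divide)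
      also have "... \<le> ?b k * sqrt (?u * ?v)"
        using b0 sqnorm_nonneg by (intro mult_right_mono arith_geo_mean_sqrt) auto
      finally have le: "?u * (1 / sqnorm 1) \<le> ?b k * sqrt (?u * ?v)" .
      have "a k * sqrt (?u * ?v) = sqnorm (Suc k)"
        using pos[of "Suc k"] pos[of "Suc (Suc k)"] by (simp add: a_def real_sqrt_mult real_sqrt_divide)
      hence "a k * sqrt (?u * ?v) \<le>
         sqnorm 1 * (?b k) * sqrt (?u * ?v)" using le pos[of 1] by (simp add: field_simps)
      thus ?thesis using pos[of "Suc k"] pos[of "Suc (Suc k)"] by (simp add: mult_le_cancel_right)
    qed
    have "summable (\<lambda>k. sqnorm 1 * (?b k))"
      using bsum by (intro summable_mult summable_divide summable_add)
        (simp_all add: summable_Suc_iff[of b] summable_Suc_iff[of "\<lambda>k. b (Suc k)"])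
    hence "summable a"
      by (rule summable_comparison_test') (use ale apos in \<open>auto simp: less_imp_le\<close>)
    hence Csum: "summable (\<lambda>n. (\<Prod>k\<le>n. a k) powr (1 / real (Suc n)))"
      by (rule Carleman_inequality[OF apos])
    \<comment> \<open>The norms telescope, so the geometric means of \<open>a\<close>, which are
      summable by Carleman's inequality, become roots of norms and hence dominate the terms of
      Carleman's series.\<close>
    have proda: "(\<Prod>k\<le>n. a k) = sqrt (sqnorm 1 / sqnorm (Suc (Suc n)))" for n
    proof (induction n)
      case (Suc n)
      thus ?case using pos[of "Suc (Suc n)"] by (simp add: a_def real_sqrt_mult[symmetric])
    qed (simp add: a_def)
    \<comment> \<open>Absorbs the powers of \<open>sqnorm 1\<close>, whose exponents lie between -1
      and 0.\<close>
    define C where "C = max 1 (sqnorm 1 powr - 1)"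
    have term_le: "l (x ^ (2 * Suc n)) powr (- 1 / (2 * real (Suc n))) \<le>
        C * (\<Prod>k\<le>n. a k) powr (1 / real (Suc n))" for n
    proof -
      let ?r = "1 / (2 * real (Suc n))"
      have "l (x ^ (2 * Suc n)) powr (- ?r) \<le> sqnorm (Suc (Suc n)) powr (- ?r)"
        using sqnorm_le_moment[of "Suc n", OF nz] pos[of "Suc (Suc n)"] by (intro powr_mono2') auto
      also have "... = sqnorm 1 powr (- ?r) * (sqnorm 1 / sqnorm (Suc (Suc n))) powr ?r"
        using pos[of 1] pos[of "Suc (Suc n)"]
        by (simp add: powr_divide powr_minus field_simps del: of_nat_Suc)
      also have "(sqnorm 1 / sqnorm (Suc (Suc n))) powr ?r = (\<Prod>k\<le>n. a k) powr (1 / real (Suc n))"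
        using pos[of 1] pos[of "Suc (Suc n)"] by (simp add: proda powr_half_sqrt[symmetric] powr_powr del: of_nat_Suc)
      also have "sqnorm 1 powr (- ?r) \<le> C"
      proof (cases "1 \<le> sqnorm 1")
        case True
        hence "sqnorm 1 powr (- ?r) \<le> sqnorm 1 powr 0" by (intro powr_mono) auto
        thus ?thesis using True by (simp add: C_def)
      next
        case False
        hence "sqnorm 1 powr (- ?r) \<le> sqnorm 1 powr (- 1)"
          using pos[of 1] by (intro powr_mono') (auto simp: field_simps)
        thus ?thesis by (simp add: C_def)
      qed
      finally show ?thesis by (simp add: mult_right_mono)
    qed
    have "summable (\<lambda>n. l (x ^ (2 * Suc n)) powr (- 1 / (2 * real (Suc n))))"
      by (rule summable_comparison_test'[OF summable_mult[OF Csum, of C]]) (use term_le in auto)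
    moreover have "0 < l (x ^ (2 * Suc n))" for n
      using sqnorm_le_moment[of "Suc n", OF nz] pos[of "Suc (Suc n)"] by linarith
    ultimately show False using Carleman by blast
  qed
  qed
qed

end

section \<open>Carleman's condition for weighted functionals and approximate units\<close>

lemma carleman_condition_not_summable:
  assumes "carleman_condition L t" and pos: "\<And>n. 0 < L (t ^ (2 * Suc n))"
  shows "\<not> summable (\<lambda>n. L (t ^ (2 * Suc n)) powr (- 1 / (2 * real (Suc n))))"
proof
  assume "summable (\<lambda>n. L (t ^ (2 * Suc n)) powr (- 1 / (2 * real (Suc n))))"
  hence "suminf (\<lambda>n. ennreal (L (t ^ (2 * Suc n)) powr (- 1 / (2 * real (Suc n))))) \<noteq> top"
    by (subst suminf_ennreal2) auto
  moreover have "L (t ^ (2 * Suc n)) \<noteq> 0" for n using pos[of n] by simp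
  ultimately show False
    using assms(1) unfolding carleman_condition_def by (simp del: mult_Suc_right of_nat_Suc)
qed

text \<open>Made for a comparison that reaches only every second term of \<open>g\<close>, the
  remaining terms being controlled by their predecessors.\<close>

lemma summable_even_odd:
  fixes g r :: "nat \<Rightarrow> real"
  assumes r: "summable r" and g0: "\<And>n. 0 \<le> g n"
    and even: "\<And>j. g (2 * j) \<le> C * r j" and odd: "\<And>j. g (Suc (2 * j)) \<le> D * g (2 * j)"
    and "0 \<le> C" "0 \<le> D" and r0: "\<And>j. 0 \<le> r j"
  shows "summable g"
proof (rule bounded_imp_summable[OF g0])
  fix n
  have grp: "(\<Sum>k<2 * N. g k) = (\<Sum>j<N. g (2 * j) + g (Suc (2 * j)))" for N
    by (induction N) auto
  have "g (2 * j) + g (Suc (2 * j)) \<le> (1 + D) * (C * r j)" for j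
  proof -
    have "g (2 * j) + g (Suc (2 * j)) \<le> (1 + D) * g (2 * j)"
      using odd[of j] by (simp add: algebra_simps)
    also have "... \<le> (1 + D) * (C * r j)" using even[of j] \<open>0 \<le> D\<close> by (intro mult_left_mono) auto
    finally show ?thesis .
  qed
  hence "(\<Sum>k<2 * Suc n. g k) \<le> (\<Sum>j<Suc n. (1 + D) * (C * r j))" unfolding grp by (intro sum_mono)
  also have "... = (1 + D) * C * (\<Sum>j<Suc n. r j)"
    by (simp add: sum_distrib_left mult.assoc del: sum.lessThan_Suc)
  also have "... \<le> (1 + D) * C * suminf r"
    using assms by (intro mult_left_mono sum_le_suminf) auto
  finally have "(\<Sum>k<2 * Suc n. g k) \<le> (1 + D) * C * suminf r" .
  moreover have "sum g {..n} \<le> (\<Sum>k<2 * Suc n. g k)" by (rule sum_mono2) (use g0 in auto)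
  ultimately show "sum g {..n} \<le> (1 + D) * C * suminf r" by linarith
qed

lemma power_powr:
  assumes "0 < (a::real)"
  shows "(a ^ n) powr e = a powr (real n * e)" using assms by (metis powr_powr powr_realpow)

text \<open>Cauchy-Schwarz gives L (W x^(2k))^2 <= L (W^2) L (x^(4k)). So if Carleman's series
  converged for the weighted functional, the unweighted one would converge along every second index;
  log-convexity of the moments controls the indices in between.\<close>

lemma weighted_approximate_inverse:
  fixes L :: "'a::{comm_ring_1, real_algebra_1} \<Rightarrow> real"
  assumes L: "linear L" and pos: "\<And>a. 0 \<le> L (a^2)" and W: "square_positive L W"
    and Carleman: "carleman_condition L x" and "0 < \<epsilon>"
  shows "\<exists>u v. L (W * ((1 - (x * u + v))^2 + (x * v - u)^2)) < \<epsilon>"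
proof -
  have lin: "linear (\<lambda>h. L (W * h))"
    by (rule linearI) (simp_all add: distrib_left linear_add[OF L] linear_cmul[OF L])
  interpret positive_functional "\<lambda>h. L (W * h)" x
    by (rule positive_functional.intro) (use W lin in \<open>auto simp: square_positive_def\<close>)
  have CS: "(L (a * b))^2 \<le> L (a^2) * L (b^2)" for a b
    using square_positive_Cauchy_Schwarz[OF L, of 1 a b] pos by (simp add: square_positive_def)
  show ?thesis
  proof (rule approximate_inverse[OF _ \<open>0 < \<epsilon>\<close>], rule notI)
    assume H: "(\<forall>n. 0 < L (W * x ^ (2 * Suc n))) \<and>
      summable (\<lambda>n. L (W * x ^ (2 * Suc n)) powr (- 1 / (2 * real (Suc n))))"
    define s where "s k = L (x ^ (2 * k))" for k
    define D where "D = L (W^2)"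
    have s0: "0 \<le> s k" for k using pos[of "x ^ k"] by (simp add: s_def power_mult[symmetric] mult.commute)
    have m_le: "(L (W * x ^ (2 * k)))^2 \<le> D * s (2 * k)" for k
      using CS[of W "x ^ (2 * k)"] by (simp add: D_def s_def power_mult[symmetric] mult.commute)
    have mpos: "0 < L (W * x ^ (2 * k))" if "0 < k" for k
      using H that by (cases k) auto
    have "0 < D * s (2 * k)" if "0 < k" for k
      using m_le[of k] mpos[OF that] by (smt (verit) zero_less_power)
    hence Dpos: "0 < D" and seven: "0 < s (2 * k)" if "0 < k" for k
      using that s0 pos[of W] by (auto simp: D_def zero_less_mult_iff)
    have logc: "(s (Suc k))^2 \<le> s k * s (Suc (Suc k))" for k
    proof -
      have "x ^ k * x ^ Suc (Suc k) = x ^ (2 * Suc k)"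
        by (simp add: power_add[symmetric] mult_2 del: power_Suc)
      thus ?thesis using CS[of "x ^ k" "x ^ Suc (Suc k)"]
        by (simp add: s_def power_mult[symmetric] mult.commute[of _ 2] del: power_Suc mult_Suc_right)
    qed
    have spos1: "0 < s k" if "0 < s (Suc k)" for k
    proof -
      have "0 < (s (Suc k))^2" using that by simp
      hence "0 < s k * s (Suc (Suc k))" using logc[of k] by linarith
      thus ?thesis using s0 by (auto simp: zero_less_mult_iff not_less[symmetric])
    qed
    have spos: "0 < s k" for k
    proof -
      have "s k > 0" if "s (k + j) > 0" for j using that by (induction j) (auto intro: spos1)
      from this[of "Suc k + 1"] show ?thesis using seven[of "Suc k"] by (simp add: mult_2)
    qed
    \<comment> \<open>For k > 0 this says that the k-th root of s k / s 0 increases with k.\<close>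
    have ratio: "s k ^ Suc k \<le> s (Suc k) ^ k * s 0" for k
    proof (induction k)
      case (Suc k)
      have "s (Suc k) ^ k * s (Suc k) ^ Suc (Suc k) = ((s (Suc k))^2) ^ Suc k"
        by (simp add: power_add[symmetric] power_mult[symmetric] mult_2 del: power_Suc)
      also have "... \<le> (s k * s (Suc (Suc k))) ^ Suc k" by (rule power_mono[OF logc]) simp
      also have "... \<le> (s (Suc k) ^ k * s 0) * s (Suc (Suc k)) ^ Suc k"
        unfolding power_mult_distrib by (rule mult_right_mono[OF Suc]) (use s0 in auto)
      also have "... = s (Suc k) ^ k * (s (Suc (Suc k)) ^ Suc k * s 0)" by (simp add: ac_simps)
      finally show ?case by (rule mult_left_le_imp_le) (use spos[of "Suc k"] in simp)
    qed simp
    define f where "f n = s (Suc n) powr (- 1 / (2 * real (Suc n)))" for n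
    define r where "r n = L (W * x ^ (2 * Suc n)) powr (- 1 / (2 * real (Suc n)))" for n
    have even: "f (Suc (2 * j)) \<le> max 1 D * r j" for j
    proof -
      let ?k = "Suc j" and ?m = "L (W * x ^ (2 * Suc j))"
      have m: "0 < ?m" using mpos[of ?k] by simp
      have "f (Suc (2 * j)) = s (2 * ?k) powr (- (1 / (4 * real ?k)))" by (simp add: f_def)
      also have "... \<le> (?m^2 / D) powr (- (1 / (4 * real ?k)))"
        using m_le[of ?k] Dpos[of 1] m by (intro powr_mono2') (auto simp: field_simps)
      also have "... = D powr (1 / (4 * real ?k)) * r j"
      proof -
        have "(?m^2 / D) powr (- (1 / (4 * real ?k))) =
            (?m^2) powr (- (1 / (4 * real ?k))) / D powr (- (1 / (4 * real ?k)))"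
          by (rule powr_divide)
        also have "... = D powr (1 / (4 * real ?k)) * ?m powr (real 2 * - (1 / (4 * real ?k)))"
          unfolding power_powr[OF m] by (simp add: powr_minus_divide del: of_nat_Suc mult_Suc_right)
        also have "real 2 * - (1 / (4 * real ?k)) = - 1 / (2 * real ?k)"
          by (simp add: field_simps)
        finally show ?thesis by (simp add: r_def del: of_nat_Suc mult_Suc_right)
      qed
      also have "D powr (1 / (4 * real ?k)) \<le> max 1 D"
      proof (cases "1 \<le> D")
        case True
        hence "D powr (1 / (4 * real ?k)) \<le> D powr 1" by (intro powr_mono) auto
        thus ?thesis using True by simp
      next
        case False
        thus ?thesis using Dpos[of 1] powr_le1[of "1 / (4 * real ?k)" D] by auto
      qed
      finally show ?thesis by (simp add: r_def mult_right_mono)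
    qed
    have odd: "f (Suc (Suc (2 * j))) \<le> max 1 (s 0) * f (Suc (2 * j))" for j
    proof -
      let ?k = "Suc (Suc (2 * j))"
      let ?e = "1 / (2 * real ?k * real (Suc ?k))"
      have "s ?k powr (1 / (2 * real ?k)) = (s ?k ^ Suc ?k) powr ?e"
        using spos[of ?k] by (subst power_powr) (simp_all del: of_nat_Suc)
      also have "... \<le> (s (Suc ?k) ^ ?k * s 0) powr ?e"
        using ratio[of ?k] spos[of ?k] by (intro powr_mono2) auto
      also have "... = s (Suc ?k) powr (1 / (2 * real (Suc ?k))) * s 0 powr ?e"
        using spos[of 0] spos[of "Suc ?k"]
        by (subst powr_mult) (simp_all add: power_powr del: power_Suc of_nat_Suc)
      also have "s 0 powr ?e \<le> max 1 (s 0)"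
      proof (cases "1 \<le> s 0")
        case True
        have "s 0 powr ?e \<le> s 0 powr 1" using True by (intro powr_mono) (auto simp: divide_simps algebra_simps)
        thus ?thesis using True by simp
      next
        case False
        thus ?thesis using spos[of 0] powr_le1[of ?e "s 0"] by auto
      qed
      finally have le: "s ?k powr (1 / (2 * real ?k)) \<le> s (Suc ?k) powr (1 / (2 * real (Suc ?k))) * max 1 (s 0)"
        by (simp add: mult_left_mono)
      have "f (Suc ?k - 1) = 1 / s (Suc ?k) powr (1 / (2 * real (Suc ?k)))"
        "f (?k - 1) = 1 / s ?k powr (1 / (2 * real ?k))"
        by (simp_all add: f_def powr_minus_divide del: of_nat_Suc)
      moreover have "0 < s ?k powr (1 / (2 * real ?k))" "0 < s (Suc ?k) powr (1 / (2 * real (Suc ?k)))"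
        using spos[of ?k] spos[of "Suc ?k"] by simp_all
      moreover have "1 / B \<le> C * (1 / A)" if "A \<le> B * C" "0 < A" "0 < B" for A B C :: real
        using that by (simp add: field_simps)
      ultimately show ?thesis using le by simp
    qed
    have rsum: "summable r" using H by (simp add: r_def[abs_def] del: mult_Suc_right of_nat_Suc)
    \<comment> \<open>The term f n contains the moment s (n + 1); the shift by one puts the moments
      reached by Cauchy-Schwarz at even positions.\<close>
    have "summable (\<lambda>n. f (Suc n))"
      by (rule summable_even_odd[where C = "max 1 D" and D = "max 1 (s 0)" and r = r])
        (use rsum even odd in \<open>auto simp: f_def r_def\<close>)
    hence "summable f" by (simp only: summable_Suc_iff)
    thus False
      using carleman_condition_not_summable[OF Carleman] spos unfolding f_def s_def by blast
  qed
qed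

text \<open>Put y = \<alpha> + \<i> \<beta>. The induction step multiplies y by z = (x - \<i>) (u' +
  \<i> v') close to 1. Since 1 - y z = (1 - y) + y (1 - z), closeness of z is needed in the weight W
  |y|^2, which is again square-positive.\<close>

lemma approximate_unit:
  fixes L :: "'a::{comm_ring_1, real_algebra_1} \<Rightarrow> real"
  assumes L: "linear L" and pos: "\<And>a. 0 \<le> L (a^2)" and W: "square_positive L W"
    and Carleman: "carleman_condition L x" and "0 < \<epsilon>"
  shows "\<exists>\<alpha> \<beta> u v. \<alpha>^2 + \<beta>^2 = (1 + x^2) ^ M * (u^2 + v^2) \<and> L (W * ((1 - \<alpha>)^2 + \<beta>^2)) < \<epsilon>"
  using \<open>0 < \<epsilon>\<close>
proof (induction M arbitrary: \<epsilon>)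
  case 0
  thus ?case by (intro exI[of _ 1] exI[of _ 0]) (simp add: linear_0[OF L])
next
  case (Suc M)
  hence "0 < \<epsilon> / 4" by simp
  from Suc.IH[OF this] obtain \<alpha> \<beta> u v where
    y: "\<alpha>^2 + \<beta>^2 = (1 + x^2) ^ M * (u^2 + v^2)" "L (W * ((1 - \<alpha>)^2 + \<beta>^2)) < \<epsilon> / 4" by blast
  have "square_positive L (W * (\<alpha>^2 + \<beta>^2))"
  proof (unfold square_positive_def, rule allI)
    fix f
    have "W * (\<alpha>^2 + \<beta>^2) * f^2 = W * (\<alpha> * f)^2 + W * (\<beta> * f)^2"
      by (simp add: algebra_simps power_mult_distrib)
    thus "0 \<le> L (W * (\<alpha>^2 + \<beta>^2) * f^2)"
      using square_positiveD[OF W] by (simp add: linear_add[OF L])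
  qed
  from weighted_approximate_inverse[OF L pos this Carleman \<open>0 < \<epsilon> / 4\<close>] obtain u' v' where
    z: "L (W * (\<alpha>^2 + \<beta>^2) * ((1 - (x * u' + v'))^2 + (x * v' - u')^2)) < \<epsilon> / 4" by blast
  define \<gamma> \<delta> where "\<gamma> = x * u' + v'" and "\<delta> = x * v' - u'"
  define \<alpha>' \<beta>' where "\<alpha>' = \<alpha> * \<gamma> - \<beta> * \<delta>" and "\<beta>' = \<alpha> * \<delta> + \<beta> * \<gamma>"
  have "\<alpha>'^2 + \<beta>'^2 = (\<alpha>^2 + \<beta>^2) * (\<gamma>^2 + \<delta>^2)"
    by (simp add: \<alpha>'_def \<beta>'_def power2_eq_square algebra_simps)
  also have "\<gamma>^2 + \<delta>^2 = (1 + x^2) * (u'^2 + v'^2)"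
    by (simp add: \<gamma>_def \<delta>_def power2_eq_square algebra_simps)
  also have "(\<alpha>^2 + \<beta>^2) * ((1 + x^2) * (u'^2 + v'^2)) =
      (1 + x^2) ^ Suc M * ((u^2 + v^2) * (u'^2 + v'^2))" by (simp add: y ac_simps)
  also have "(u^2 + v^2) * (u'^2 + v'^2) = (u * u' - v * v')^2 + (u * v' + v * u')^2"
    by (simp add: power2_eq_square algebra_simps)
  finally have norm: "\<alpha>'^2 + \<beta>'^2 =
      (1 + x^2) ^ Suc M * ((u * u' - v * v')^2 + (u * v' + v * u')^2)" .
  \<comment> \<open>The parallelogram identity for 1 - y and y (1 - z); each of the two errors
    enters twice, whence \<epsilon> / 4.\<close>
  have "W * ((1 - \<alpha>')^2 + \<beta>'^2) + W * (1 - 2 * \<alpha> + \<alpha>')^2 + W * (\<beta>' - 2 * \<beta>)^2 =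
      (W * ((1 - \<alpha>)^2 + \<beta>^2) + W * ((1 - \<alpha>)^2 + \<beta>^2)) +
      (W * (\<alpha>^2 + \<beta>^2) * ((1 - \<gamma>)^2 + \<delta>^2) + W * (\<alpha>^2 + \<beta>^2) * ((1 - \<gamma>)^2 + \<delta>^2))"
    by (simp add: \<alpha>'_def \<beta>'_def power2_eq_square algebra_simps)
  from arg_cong[OF this, of L] have "L (W * ((1 - \<alpha>')^2 + \<beta>'^2)) < \<epsilon>"
    using y(2) z square_positiveD[OF W, of "1 - 2 * \<alpha> + \<alpha>'"] square_positiveD[OF W, of "\<beta>' - 2 * \<beta>"]
    unfolding \<gamma>_def[symmetric] \<delta>_def[symmetric] linear_add[OF L] by linarith
  with norm show ?case by blast
qed

section \<open>Positivity of polynomials in one variable\<close>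

text \<open>These ratios are the multipliers of the normalised cosine kernel. Passing from j to j +
  1 multiplies them by (N - j) / (N + j + 1).\<close>

lemma binomial_ratio_tendsto_1:
  "(\<lambda>N. real (2 * N choose (N + j)) / real (2 * N choose N)) \<longlonglongrightarrow> 1"
proof (induction j)
  case (Suc j)
  have "(\<lambda>N. (real N - real j) / (real N + real j + 1)) \<longlonglongrightarrow> 1" by real_asymp
  from tendsto_mult[OF Suc this]
  have "(\<lambda>N. real (2 * N choose (N + j)) / real (2 * N choose N) *
      ((real N - real j) / (real N + real j + 1))) \<longlonglongrightarrow> 1" by simp
  moreover have "\<forall>\<^sub>F N in sequentially. real (2 * N choose (N + j)) / real (2 * N choose N) *
      ((real N - real j) / (real N + real j + 1)) = real (2 * N choose (N + Suc j)) / real (2 * N choose N)"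
  proof (rule eventually_mono[OF eventually_ge_at_top[of j]])
    fix N assume "j \<le> N"
    hence "Suc (N + j) * (2 * N choose Suc (N + j)) = (N - j) * (2 * N choose (N + j))"
      using choose_reduce_nat
      by (metis (no_types, lifting) add_diff_cancel_left' binomial_absorb_comp binomial_absorption
          diff_diff_left mult_2)
    hence "real (Suc (N + j)) * real (2 * N choose Suc (N + j)) = (real N - real j) * real (2 * N choose (N + j))"
      using \<open>j \<le> N\<close> by (metis of_nat_diff of_nat_mult)
    thus "real (2 * N choose (N + j)) / real (2 * N choose N) *
      ((real N - real j) / (real N + real j + 1)) = real (2 * N choose (N + Suc j)) / real (2 * N choose N)"
      by (simp add: divide_simps) (simp add: algebra_simps)
  qed
  ultimately show ?case by (rule Lim_transform_eventually)
qed simp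

lemma sum_roots_of_unity:
  fixes r :: int
  assumes "\<not> int M dvd r"
  shows "(\<Sum>j<M. cis (2 * pi * real_of_int r * real j / real M)) = 0"
proof (cases "M = 0")
  case False
  define z where "z = cis (2 * pi * real_of_int r / real M)"
  have "cis (2 * pi * real_of_int r * real j / real M) = z ^ j" for j
    unfolding z_def Complex.DeMoivre by (rule arg_cong[of _ _ cis]) (simp add: field_simps)
  moreover have "z ^ M = 1"
  proof -
    have "z ^ M = cis (2 * pi * real_of_int r)" using False by (simp add: z_def Complex.DeMoivre)
    thus ?thesis by (simp only: cis_multiple_2pi Ints_of_int)
  qed
  moreover have "z \<noteq> 1"
  proof
    assume "z = 1"
    hence "cos (2 * pi * real_of_int r / real M) = 1" by (simp add: z_def complex_eq_iff)
    then obtain k :: int where "2 * pi * real_of_int r / real M = of_int k * 2 * pi"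
      using cos_one_2pi_int by (metis mult.assoc)
    hence "real_of_int r = real_of_int (k * int M)" using False by (simp add: field_simps)
    hence "r = k * int M" by (simp only: of_int_eq_iff)
    thus False using assms by simp
  qed
  ultimately show ?thesis by (simp add: sum_gp_strict)
qed simp

lemma poly_eq_sum:
  fixes p :: "'a::comm_semiring_1 poly"
  assumes "degree p \<le> n"
  shows "poly p x = (\<Sum>k\<le>n. coeff p k * x ^ k)"
proof -
  have "poly p x = poly (\<Sum>k\<le>n. monom (coeff p k) k) x"
    by (simp only: poly_as_sum_of_monoms'[OF assms])
  thus ?thesis by (simp add: poly_sum poly_monom)
qed

text \<open>The same coefficients serve two substitutions: a = cis s, b = cis (-s) gives cos^(n-d)
  sin^d as a trigonometric polynomial, and a = 1 + \<i> x, b = 1 - \<i> x gives the monomial x^d.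
  The condition on b permits dehomogenising by a / b.\<close>

lemma homogeneous_expansion:
  assumes "d \<le> n"
  shows "\<exists>\<gamma>::nat \<Rightarrow> complex. \<forall>a b. b \<noteq> 0 \<longrightarrow>
    ((a + b) / 2) ^ (n - d) * ((a - b) / (2 * \<i>)) ^ d = (\<Sum>k\<le>n. \<gamma> k * (a ^ k * b ^ (n - k)))"
proof (intro exI allI impI)
  fix a b :: complex assume b: "b \<noteq> 0"
  let ?p = "[:1/2, 1/2:] :: complex poly" and ?q = "[:- 1 / (2 * \<i>), 1 / (2 * \<i>):]"
  define \<Gamma> where "\<Gamma> = ?p ^ (n - d) * ?q ^ d"
  have deg: "degree \<Gamma> \<le> n"
  proof -
    have "degree \<Gamma> \<le> degree (?p ^ (n - d)) + degree (?q ^ d)"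
      unfolding \<Gamma>_def by (rule degree_mult_le)
    also have "... \<le> degree ?p * (n - d) + degree ?q * d" by (intro add_mono degree_power_le)
    also have "... \<le> n" using assms by simp
    finally show ?thesis .
  qed
  have "(a + b) / 2 = b * poly ?p (a / b)"
    "(a - b) / (2 * \<i>) = b * poly ?q (a / b)" using b by (simp_all add: field_simps)
  hence "((a + b) / 2) ^ (n - d) * ((a - b) / (2 * \<i>)) ^ d =
      (b * poly ?p (a / b)) ^ (n - d) * (b * poly ?q (a / b)) ^ d" by (simp only:)
  also have "... = (b ^ (n - d) * b ^ d) * poly \<Gamma> (a / b)"
    by (simp add: \<Gamma>_def power_mult_distrib poly_power)
  also have "b ^ (n - d) * b ^ d = b ^ n" using assms by (simp add: power_add[symmetric])
  also have "poly \<Gamma> (a / b) = (\<Sum>k\<le>n. coeff \<Gamma> k * (a / b) ^ k)" by (rule poly_eq_sum[OF deg])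
  also have "b ^ n * ... = (\<Sum>k\<le>n. coeff \<Gamma> k * (a ^ k * b ^ (n - k)))"
    using b by (simp add: sum_distrib_left power_divide power_diff divide_simps mult_ac)
  finally show "((a + b) / 2) ^ (n - d) * ((a - b) / (2 * \<i>)) ^ d =
      (\<Sum>k\<le>n. coeff (?p ^ (n - d) * ?q ^ d) k * (a ^ k * b ^ (n - k)))" by (simp add: \<Gamma>_def)
qed

text \<open>
  Convolution with the de la Vallee-Poussin kernel, a power of the cosine, is diagonal in the
  trigonometric basis; sampling at roots of unity of order \<open>M\<close> is exact for the degrees involved.
  The order is odd so that no node is a zero of the cosine.
\<close>
lemma trigonometric_quadrature:
  fixes x :: real
  assumes "m \<le> N" and
    \<gamma>: "\<And>a b. b \<noteq> 0 \<Longrightarrow> ((a + b) / 2) ^ (2 * m - d) * ((a - b) / (2 * \<i>)) ^ d =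
      (\<Sum>k\<le>2 * m. \<gamma> k * (a ^ k * b ^ (2 * m - k)))"
  defines "M \<equiv> 2 * (N + m) + 1"
  defines "t \<equiv> \<lambda>j::nat. 2 * pi * real j / real M"
  shows "complex_of_real (\<Sum>j<M. cos (t j) ^ (2 * m - d) * sin (t j) ^ d * (cos (t j) + x * sin (t j)) ^ (2 * N)) =
    of_nat M / 4 ^ N * (1 + x^2) ^ (N - m) *
      (\<Sum>k\<le>2 * m. \<gamma> k * of_nat (2 * N choose (N + m - k)) * ((1 + \<i> * x) ^ k * (1 - \<i> * x) ^ (2 * m - k)))"
proof -
  define \<alpha> \<alpha>' where "\<alpha> = 1 - \<i> * x" and "\<alpha>' = 1 + \<i> * x"
  let ?c = "\<lambda>k l. \<gamma> k * of_nat (2 * N choose l) * \<alpha> ^ l * \<alpha>' ^ (2 * N - l) / 4 ^ N"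
  let ?f = "\<lambda>s. cos s ^ (2 * m - d) * sin s ^ d * (cos s + x * sin s) ^ (2 * N)"
  let ?b = "\<lambda>k. \<gamma> k * of_nat (2 * N choose (N + m - k))" and ?K = "of_nat M / 4 ^ N * (1 + x^2) ^ (N - m)"
  define r where "r k l = 2 * (int k + int l - int m - int N)" for k l
  have trig: "complex_of_real (?f s) = (\<Sum>k\<le>2 * m. \<Sum>l\<le>2 * N. ?c k l *
        cis (real_of_int (r k l) * s))" for s
  proof -
    let ?B = "\<Sum>l\<le>2 * N. of_nat (2 * N choose l) * (\<alpha> * cis s) ^ l * (\<alpha>' * cis (- s)) ^ (2 * N - l)"
    let ?A = "\<Sum>k\<le>2 * m. \<gamma> k * (cis s ^ k * cis (- s) ^ (2 * m - k))"
    have c: "complex_of_real (cos s) = (cis s + cis (- s)) / 2"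
      "complex_of_real (sin s) = (cis s - cis (- s)) / (2 * \<i>)" by (simp_all add: complex_eq_iff)
    have "complex_of_real (cos s + x * sin s) = (\<alpha> * cis s + \<alpha>' * cis (- s)) / 2"
      by (simp add: complex_eq_iff \<alpha>_def \<alpha>'_def)
    hence "complex_of_real (cos s + x * sin s) ^ (2 * N) = (\<alpha> * cis s + \<alpha>' * cis (- s)) ^ (2 * N) / 4 ^ N"
      by (simp only: power_divide power_mult) simp
    also have "(\<alpha> * cis s + \<alpha>' * cis (- s)) ^ (2 * N) = ?B" by (rule binomial_ring)
    finally have b: "complex_of_real (cos s + x * sin s) ^ (2 * N) = ... / 4 ^ N" .
    have a: "complex_of_real (cos s) ^ (2 * m - d) * complex_of_real (sin s) ^ d =
        ?A" unfolding c by (rule \<gamma>) simp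
    have e: "cis s ^ k * cis (- s) ^ (2 * m - k) * (cis s ^ l * cis (- s) ^ (2 * N - l)) = cis (real_of_int (r k l) * s)"
      if "k \<le> 2 * m" "l \<le> 2 * N" for k l
      using that by (simp add: Complex.DeMoivre cis_mult r_def of_nat_diff algebra_simps)
    have "complex_of_real (?f s) = ?A *
      (?B / 4 ^ N)" by (simp only: of_real_mult of_real_power a b)
    also have "... = (\<Sum>k\<le>2 * m. \<Sum>l\<le>2 * N. ?c k l *
        (cis s ^ k * cis (- s) ^ (2 * m - k) * (cis s ^ l * cis (- s) ^ (2 * N - l))))"
      by (simp add: sum_divide_distrib sum_product power_mult_distrib mult_ac)
    also have "... = (\<Sum>k\<le>2 * m. \<Sum>l\<le>2 * N. ?c k l *
        cis (real_of_int (r k l) * s))" by (intro sum.cong refl) (simp only: e atMost_iff)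
    finally show ?thesis .
  qed
  \<comment> \<open>All frequencies are at most 2 (N + m) < M in absolute value, so nonzero ones are
    not multiples of M, and summation over the nodes keeps exactly the terms with k + l = N +
    m.\<close>
  have orth: "(\<Sum>j<M. cis (real_of_int (r k l) * t j)) = (if l = N + m - k then of_nat M else 0)"
    if "k \<le> 2 * m" "l \<le> 2 * N" for k l
  proof (cases "l = N + m - k")
    case True
    hence "r k l = 0" using that \<open>m \<le> N\<close> by (auto simp: r_def)
    thus ?thesis using True by simp
  next
    case False
    hence "r k l \<noteq> 0" using that \<open>m \<le> N\<close> by (auto simp: r_def)
    moreover have "\<bar>r k l\<bar> < int M" using that by (auto simp: r_def M_def)
    ultimately have "\<not> int M dvd r k l" by (metis abs_of_nat dvd_imp_le_int not_less)
    from sum_roots_of_unity[OF this] show ?thesis using False by (simp add: t_def mult_ac)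
  qed
  have "complex_of_real (\<Sum>j<M. ?f (t j)) = (\<Sum>j<M. \<Sum>k\<le>2 * m. \<Sum>l\<le>2 * N. ?c k l *
        cis (real_of_int (r k l) * t j))" by (simp only: of_real_sum trig)
  also have "... = (\<Sum>k\<le>2 * m. \<Sum>l\<le>2 * N. ?c k l * (\<Sum>j<M. cis (real_of_int (r k l) * t j)))"
    unfolding sum_distrib_left by (rule trans[OF sum.swap], rule sum.cong[OF refl], rule sum.swap)
  also have "... = (\<Sum>k\<le>2 * m. \<Sum>l\<le>2 * N. if l = N + m - k then
      ?c k l * of_nat M else 0)" by (intro sum.cong refl) (simp add: orth)
  also have "... = (\<Sum>k\<le>2 * m. ?b k *
      (\<alpha> ^ (N + m - k) * \<alpha>' ^ (2 * N - (N + m - k))) / 4 ^ N * of_nat M)"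
    using \<open>m \<le> N\<close> by (intro sum.cong refl) (simp add: mult_ac)
  also have "... = (\<Sum>k\<le>2 * m. ?K * (?b k * (\<alpha>' ^ k * \<alpha> ^ (2 * m - k))))"
  proof (intro sum.cong refl)
    fix k assume k: "k \<in> {..2 * m}"
    have "\<alpha> * \<alpha>' = complex_of_real (1 + x^2)"
      by (simp add: \<alpha>_def \<alpha>'_def power2_eq_square algebra_simps)
    hence "\<alpha> ^ (N - m) * \<alpha>' ^ (N - m) = complex_of_real ((1 + x^2) ^ (N - m))"
      by (simp add: power_mult_distrib[symmetric])
    moreover have e: "\<alpha> ^ (N + m - k) = \<alpha> ^ (N - m) * \<alpha> ^ (2 * m - k)"
      "\<alpha>' ^ (2 * N - (N + m - k)) = \<alpha>' ^ (N - m) * \<alpha>' ^ k"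
      unfolding power_add[symmetric] using k \<open>m \<le> N\<close> by (auto intro!: arg_cong[where f = "power _"])
    have "\<alpha> ^ (N + m - k) * \<alpha>' ^ (2 * N - (N + m - k)) =
        (\<alpha> ^ (N - m) * \<alpha>' ^ (N - m)) * (\<alpha>' ^ k * \<alpha> ^ (2 * m - k))"
      unfolding e by (simp only: mult_ac)
    ultimately have "\<alpha> ^ (N + m - k) * \<alpha>' ^ (2 * N - (N + m - k)) =
        complex_of_real ((1 + x^2) ^ (N - m)) * (\<alpha>' ^ k * \<alpha> ^ (2 * m - k))" by (simp only:)
    thus "?b k * (\<alpha> ^ (N + m - k) * \<alpha>' ^ (2 * N - (N + m - k))) / 4 ^ N * of_nat M = ?K *
      (?b k * (\<alpha>' ^ k * \<alpha> ^ (2 * m - k)))" by (simp add: mult_ac)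
  qed
  finally show ?thesis by (simp only: sum_distrib_left[symmetric] \<alpha>_def \<alpha>'_def)
qed

text \<open>With \<xi> = tan t, the factor cos t + x sin t = sqrt (1 + x^2) cos (t - arctan x)
  becomes cos t (1 + \<xi> x). Its high even powers concentrate where \<xi> = x, so averaging
  \<xi>^d returns nearly x^d; the remaining factor (cos t)^(2m) accounts for the exponent N - m in
  place of N.\<close>

lemma polynomial_quadrature:
  "\<exists>\<beta> :: nat \<Rightarrow> nat \<Rightarrow> nat \<Rightarrow> real. (\<forall>d\<le>2 * m. \<forall>e\<le>2 * m. (\<lambda>N. \<beta> N d e) \<longlonglongrightarrow> (if d = e then 1 else 0)) \<and>
    (\<forall>N\<ge>m. \<exists>(n::nat) c \<xi>. (\<forall>j<n. 0 \<le> c j) \<and>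
       (\<forall>d\<le>2 * m. \<forall>x. (\<Sum>j<n. c j * \<xi> j ^ d * (1 + \<xi> j * x) ^ (2 * N)) =
          (1 + x^2) ^ (N - m) * (\<Sum>e\<le>2 * m. \<beta> N d e * x ^ e)))"
proof -
  let ?h = "\<lambda>a b d. ((a + b) / 2) ^ (2 * m - d) * ((a - b) / (2 * \<i>)) ^ d"
    and ?k = "\<lambda>a b k. a ^ k * b ^ (2 * m - k) :: complex"
  define \<gamma> where "\<gamma> d = (SOME \<gamma>::nat \<Rightarrow> complex. \<forall>a b. b \<noteq> 0 \<longrightarrow>
      ?h a b d = (\<Sum>k\<le>2 * m. \<gamma> k * ?k a b k))" for d
  have \<gamma>: "?h a b d = (\<Sum>k\<le>2 * m. \<gamma> d k * ?k a b k)"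
    if "d \<le> 2 * m" "b \<noteq> 0" for d a b
    using someI_ex[OF homogeneous_expansion[OF that(1)]] that(2) unfolding \<gamma>_def by blast
  define B where "B k = [:1, \<i>:] ^ k * [:1, - \<i>:] ^ (2 * m - k)" for k
  have degB: "degree (B k) \<le> 2 * m" if "k \<le> 2 * m" for k
  proof -
    have "degree (B k) \<le> degree ([:1, \<i>:] ^ k) + degree ([:1, - \<i>:] ^ (2 * m - k))"
      unfolding B_def by (rule degree_mult_le)
    also have "... \<le> degree [:1, \<i>:] * k + degree [:1, - \<i>:] * (2 * m - k)"
      by (intro add_mono degree_power_le)
    finally show ?thesis using that by simp
  qed
  have polyB: "?k (1 + \<i> * of_real x) (1 - \<i> * of_real x) k =
      (\<Sum>e\<le>2 * m. coeff (B k) e * of_real (x ^ e))" if "k \<le> 2 * m" for k x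
    using poly_eq_sum[OF degB[OF that], of "complex_of_real x"]
    by (simp add: B_def poly_power mult.commute)
  \<comment> \<open>Both sides are complex polynomials that agree at all real points, by the
    expansion at 1 + \<i> x and 1 - \<i> x.\<close>
  have B_sum: "(\<Sum>k\<le>2 * m. smult (\<gamma> d k) (B k)) = monom 1 d" (is "?p = ?q") if d: "d \<le> 2 * m" for d
  proof (rule ccontr)
    assume "?p \<noteq> ?q"
    hence "finite {z. poly (?p - ?q) z = 0}" by (intro poly_roots_finite) simp
    moreover have "range complex_of_real \<subseteq> {z. poly (?p - ?q) z = 0}"
    proof safe
      fix x :: real
      have nz: "1 - \<i> * complex_of_real x \<noteq> 0" by (simp add: complex_eq_iff)
      have "poly ?p (of_real x) = (\<Sum>k\<le>2 * m. \<gamma> d k * ?k (1 + \<i> * x) (1 - \<i> * x) k)"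
        by (simp add: poly_sum B_def poly_power mult.commute)
      also have "... = complex_of_real x ^ d" using \<gamma>[OF d nz, of "1 + \<i> * x"] by simp
      finally show "poly (?p - ?q) (of_real x) = 0" by (simp add: poly_monom)
    qed
    ultimately show False
      using finite_subset infinite_UNIV_char_0 finite_imageD[OF _ inj_of_real] by blast
  qed
  define \<rho> where "\<rho> N k = real (2 * N choose (N + m - k)) / real (2 * N choose N)" for N k
  have \<rho>: "(\<lambda>N. \<rho> N k) \<longlonglongrightarrow> 1" for k
  proof (cases "k \<le> m")
    case True
    thus ?thesis using binomial_ratio_tendsto_1[of "m - k"] by (simp add: \<rho>_def)
  next
    case False
    have "\<forall>\<^sub>F N in sequentially. real (2 * N choose (N + (k - m))) / real (2 * N choose N) = \<rho> N k"
    proof (rule eventually_mono[OF eventually_ge_at_top[of k]])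
      fix N assume "k \<le> N"
      thus "real (2 * N choose (N + (k - m))) / real (2 * N choose N) = \<rho> N k"
        using binomial_symmetric[of "N + (k - m)" "2 * N"] False by (simp add: \<rho>_def mult_2)
    qed
    from Lim_transform_eventually[OF binomial_ratio_tendsto_1[of "k - m"] this] show ?thesis .
  qed
  let ?g = "\<lambda>N d k e. \<gamma> d k * \<rho> N k * coeff (B k) e"
  \<comment> \<open>Without the ratios \<rho>, which tend to 1, these would be the coefficients of
    x^d.\<close>
  define \<beta> where "\<beta> N d e = Re (\<Sum>k\<le>2 * m. ?g N d k e)" for N d e
  have "(\<lambda>N. \<beta> N d e) \<longlonglongrightarrow> (if d = e then 1 else 0)" if "d \<le> 2 * m" for d e
  proof -
    have "(\<lambda>N. \<beta> N d e) \<longlonglongrightarrow> Re (\<Sum>k\<le>2 * m. \<gamma> d k * of_real 1 * coeff (B k) e)"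
      unfolding \<beta>_def by (intro tendsto_intros \<rho>)
    also have "(\<Sum>k\<le>2 * m. \<gamma> d k * of_real 1 * coeff (B k) e) = coeff (monom 1 d) e"
      by (simp add: B_sum[OF that, symmetric] coeff_sum)
    finally show ?thesis by (simp add: coeff_monom if_distrib[of Re] cong: if_cong)
  qed
  moreover have "\<exists>(n::nat) c \<xi>. (\<forall>j<n. 0 \<le> c j) \<and>
       (\<forall>d\<le>2 * m. \<forall>x. (\<Sum>j<n. c j * \<xi> j ^ d * (1 + \<xi> j * x) ^ (2 * N)) =
          (1 + x^2) ^ (N - m) * (\<Sum>e\<le>2 * m. \<beta> N d e * x ^ e))" if N: "m \<le> N" for N
  proof -
    define M where "M = 2 * (N + m) + 1"
    define t where "t j = 2 * pi * real j / real M" for j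
    \<comment> \<open>The inverse of the factor that the sampling produces at k = m.\<close>
    define K where "K = 4 ^ N / (real M * real (2 * N choose N))"
    have cos_nz: "cos (t j) \<noteq> 0" for j
    proof
      assume "cos (t j) = 0"
      then obtain i where i: "odd i" "t j = of_int i * (pi / 2)" by (auto simp: cos_zero_iff_int)
      hence "pi * real_of_int (4 * int j) = pi * real_of_int (i * int M)"
        by (simp add: t_def M_def field_simps)
      hence "real_of_int (4 * int j) = real_of_int (i * int M)"
        by (simp only: mult_cancel_left pi_neq_zero simp_thms)
      hence "4 * int j = i * int M" by (simp only: of_int_eq_iff)
      hence "even (i * int M)" by (metis dvd_triv_left even_mult_iff even_numeral)
      thus False using i(1) by (simp add: M_def)
    qed
    let ?q = "\<lambda>j d x. K * cos (t j) ^ (2 * N + 2 * m) * tan (t j) ^ d * (1 + tan (t j) * x) ^ (2 * N)"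
    have quad: "(\<Sum>j<M. ?q j d x) =
          (1 + x^2) ^ (N - m) * (\<Sum>e\<le>2 * m. \<beta> N d e * x ^ e)" if d: "d \<le> 2 * m" for d x
    proof -
      have "cos (t j) ^ (2 * N + 2 * m) * tan (t j) ^ d * (1 + tan (t j) * x) ^ (2 * N) =
          cos (t j) ^ (2 * m - d) * sin (t j) ^ d * (cos (t j) + x * sin (t j)) ^ (2 * N)" for j
      proof -
        have "cos (t j) + x * sin (t j) = cos (t j) * (1 + tan (t j) * x)"
          using cos_nz[of j] by (simp add: tan_def field_simps)
        moreover have "sin (t j) = cos (t j) * tan (t j)" using cos_nz[of j] by (simp add: tan_def)
        moreover have "cos (t j) ^ (2 * N + 2 * m) = cos (t j) ^ (2 * m - d) * cos (t j) ^ d * cos (t j) ^ (2 * N)"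
          using d by (simp add: power_add[symmetric] add.commute)
        ultimately show ?thesis by (simp add: power_mult_distrib)
      qed
      hence "complex_of_real (\<Sum>j<M. ?q j d x) =
        K * complex_of_real (\<Sum>j<M. cos (t j) ^ (2 * m - d) * sin (t j) ^ d * (cos (t j) + x * sin (t j)) ^ (2 * N))"
        by (simp add: sum_distrib_left mult.assoc)
      also have "... = K * (of_nat M / 4 ^ N * (1 + x^2) ^ (N - m) *
          (\<Sum>k\<le>2 * m. \<gamma> d k * of_nat (2 * N choose (N + m - k)) * ?k (1 + \<i> * x) (1 - \<i> * x) k))"
        using trigonometric_quadrature[OF N \<gamma>[OF d], of x] unfolding t_def M_def by simp
      also have "... = of_real ((1 + x^2) ^ (N - m)) *
          (\<Sum>k\<le>2 * m. \<gamma> d k * \<rho> N k * ?k (1 + \<i> * x) (1 - \<i> * x) k)"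
      proof -
        have "real M \<noteq> 0" by (simp add: M_def)
        thus ?thesis by (simp add: K_def \<rho>_def sum_distrib_left mult_ac)
      qed
      also have "(\<Sum>k\<le>2 * m. \<gamma> d k * \<rho> N k * ?k (1 + \<i> * x) (1 - \<i> * x) k) =
          (\<Sum>k\<le>2 * m. \<Sum>e\<le>2 * m. ?g N d k e * of_real (x ^ e))"
        by (intro sum.cong refl) (simp only: polyB atMost_iff sum_distrib_left mult.assoc)
      also have "... = (\<Sum>e\<le>2 * m. (\<Sum>k\<le>2 * m. ?g N d k e) * of_real (x ^ e))"
        by (subst sum.swap) (simp only: sum_distrib_right)
      finally have eq: "complex_of_real (\<Sum>j<M. ?q j d x) =
          of_real ((1 + x^2) ^ (N - m)) * (\<Sum>e\<le>2 * m. (\<Sum>k\<le>2 * m. ?g N d k e) * of_real (x ^ e))" .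
      have Re_of_real_mult: "Re (of_real a * z) = a * Re z" "Re (z * of_real a) = Re z * a" for a z by simp_all
      show ?thesis using arg_cong[OF eq, of Re]
        by (simp only: Re_of_real_mult Re_complex_of_real Re_sum[of "\<lambda>e. _ e * of_real (x ^ e)"] \<beta>_def)
    qed
    have nn: "0 \<le> K * cos (t j) ^ (2 * N + 2 * m)" for j
    proof (rule mult_nonneg_nonneg)
      show "0 \<le> cos (t j) ^ (2 * N + 2 * m)" by (rule zero_le_even_power) simp
    qed (simp add: K_def)
    show ?thesis
      by (rule exI[of _ M], rule exI[of _ "\<lambda>j. K * cos (t j) ^ (2 * N + 2 * m)"], rule exI[of _ "\<lambda>j. tan (t j)"])
        (intro conjI allI impI nn quad)
  qed
  ultimately show ?thesis by (intro exI[of _ \<beta>]) blast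
qed

section \<open>Transfer to the algebra and the one-variable positivity theorem\<close>

definition poly_in :: "'a::{comm_ring_1, real_algebra_1} \<Rightarrow> real poly \<Rightarrow> 'a" where
  "poly_in x p = poly (map_poly of_real p) x"

lemma poly_in_simps [simp]:
  "poly_in x 0 = 0" "poly_in x 1 = 1" "poly_in x (pCons c p) = of_real c + x * poly_in x p"
  by (simp_all add: poly_in_def map_poly_pCons)

lemma poly_in_add [simp]: "poly_in x (p + q) = poly_in x p + poly_in x q"
  by (induction p q rule: poly_induct2) (simp_all add: algebra_simps)

lemma poly_in_smult [simp]: "poly_in x (smult c p) = of_real c * poly_in x p"
  by (induction p) (simp_all add: algebra_simps)

lemma poly_in_mult [simp]: "poly_in x (p * q) = poly_in x p * poly_in x q"
  by (induction p) (simp_all add: algebra_simps)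

lemma poly_in_power [simp]: "poly_in x (p ^ n) = poly_in x p ^ n" by (induction n) simp_all

lemma poly_in_monom [simp]: "poly_in x (monom c n) = of_real c * x ^ n"
  by (induction n) (simp_all add: monom_0 monom_Suc mult.left_commute)

lemma poly_in_sum [simp]: "poly_in x (sum f A) = (\<Sum>i\<in>A. poly_in x (f i))"
  by (induction A rule: infinite_finite_induct) simp_all

text \<open>Both sides are real polynomials agreeing at all reals, hence equal, and
  \<open>poly_in\<close> carries the equality to the algebra.\<close>

lemma quadrature_in_algebra:
  fixes x :: "'a::{comm_ring_1, real_algebra_1}"
  assumes "\<And>x. (\<Sum>j<n. c j * \<xi> j ^ d * (1 + \<xi> j * x) ^ (2 * N)) =
          (1 + x^2) ^ (N - m) * (\<Sum>e\<le>2 * m. \<beta> e * x ^ e)"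
  shows "(\<Sum>j<n. of_real (c j * \<xi> j ^ d) * (1 + of_real (\<xi> j) * x) ^ (2 * N)) =
          (1 + x^2) ^ (N - m) * (\<Sum>e\<le>2 * m. of_real (\<beta> e) * x ^ e)"
proof -
  have "poly (\<Sum>j<n. smult (c j * \<xi> j ^ d) ([:1, \<xi> j:] ^ (2 * N))) =
      poly ([:1, 0, 1:] ^ (N - m) * (\<Sum>e\<le>2 * m. monom (\<beta> e) e))"
    using assms by (simp add: fun_eq_iff poly_sum poly_power poly_monom power2_eq_square mult.commute)
  hence "poly_in x (\<Sum>j<n. smult (c j * \<xi> j ^ d) ([:1, \<xi> j:] ^ (2 * N))) =
      poly_in x ([:1, 0, 1:] ^ (N - m) * (\<Sum>e\<le>2 * m. monom (\<beta> e) e))"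
    by (simp only: poly_eq_poly_eq_iff)
  thus ?thesis by (simp add: power2_eq_square mult.commute)
qed

lemma square_positive_add:
  "linear L \<Longrightarrow> square_positive L a \<Longrightarrow> square_positive L b \<Longrightarrow> square_positive L (a + b)"
  by (simp add: square_positive_def distrib_right linear_add)

lemma square_positive_mult_square:
  "square_positive L a \<Longrightarrow> square_positive L (a * g^2)"
  unfolding square_positive_def by (metis mult.assoc power_mult_distrib)

lemma square_positive_scale:
  fixes L :: "'a::{comm_ring_1, real_algebra_1} \<Rightarrow> real"
  shows "linear L \<Longrightarrow> square_positive L a \<Longrightarrow> 0 \<le> c \<Longrightarrow> square_positive L (of_real c * a)"
  by (simp add: square_positive_def mult.assoc linear_scale_of_real)

lemma square_positive_sum:
  "linear L \<Longrightarrow> (\<And>i. i \<in> I \<Longrightarrow> square_positive L (f i)) \<Longrightarrow> square_positive L (sum f I)"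
proof (induction I rule: infinite_finite_induct)
  case (insert i I)
  thus ?case by (simp add: square_positive_add)
qed (simp_all add: square_positive_def linear_0)

lemma square_positiveI_square:
  "(\<And>a. 0 \<le> L (a^2)) \<Longrightarrow> square_positive L (a^2)" by (metis power_mult_distrib square_positive_def)

text \<open>With E = (1 - \<alpha>)^2 + \<beta>^2, the difference b (\<alpha>^2 + \<beta>^2) - b
  equals b E + 2 b (\<alpha> - 1). The first term is bounded because 2 (1 + b^2) \<plusminus> 2 b =
  1 + b^2 + (1 \<plusminus> b)^2, the second by Cauchy-Schwarz. So smallness in the weight 1 + b^2
  is what the approximate unit has to provide.\<close>

lemma perturbation_bound:
  fixes L :: "'a::{comm_ring_1, real_algebra_1} \<Rightarrow> real"
  assumes L: "linear L" and pos: "\<And>a. 0 \<le> L (a^2)"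
  shows "\<bar>L (b * (\<alpha>^2 + \<beta>^2)) - L b\<bar> \<le>
    L ((1 + b^2) * ((1 - \<alpha>)^2 + \<beta>^2)) + 2 * sqrt (L (b^2) * L ((1 + b^2) * ((1 - \<alpha>)^2 + \<beta>^2)))"
proof -
  define E where "E = (1 - \<alpha>)^2 + \<beta>^2"
  have half: "of_real (1 / 2) + of_real (1 / 2) = (1::'a)"
    unfolding of_real_add[symmetric] by simp
  have sp: "square_positive L 1" using pos by (simp add: square_positive_def)
  have sq: "square_positive L (a^2)" for a using pos by (rule square_positiveI_square)
  have LE: "0 \<le> L (a * E)" if "square_positive L a" for a
    using that by (simp add: E_def distrib_left linear_add[OF L] square_positive_def)
  have "2 * (1 + b^2) + 2 * b = 1 + 1 + b^2 + (1 + b)^2 - 1" "2 * (1 + b^2) - 2 * b = 1 + 1 + b^2 + (1 - b)^2 - 1"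
    by (simp_all add: power2_eq_square algebra_simps)
  hence "2 * (1 + b^2) + 2 * b = 1 + b^2 + (1 + b)^2" "2 * (1 + b^2) - 2 * b = 1 + b^2 + (1 - b)^2"
    by simp_all
  hence sp2: "square_positive L (2 * (1 + b^2) + 2 * b)" "square_positive L (2 * (1 + b^2) - 2 * b)"
    using sq sp square_positive_add[OF L] by metis+
  have "\<bar>L (b * E)\<bar> \<le> L ((1 + b^2) * E)"
  proof -
    have "(2 * (1 + b^2) + 2 * b) * E = ((1 + b^2) * E + (1 + b^2) * E) + (b * E + b * E)"
      "(2 * (1 + b^2) - 2 * b) * E = ((1 + b^2) * E + (1 + b^2) * E) - (b * E + b * E)"
      by (simp_all add: algebra_simps)
    thus ?thesis
      using LE[OF sp2(1)] LE[OF sp2(2)] by (simp only: linear_add[OF L] linear_diff[OF L])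
  qed
  moreover have "\<bar>L (b * (\<alpha> - 1))\<bar> \<le> sqrt (L (b^2) * L ((1 + b^2) * E))"
  proof -
    have "(1 + b^2) * E = (\<alpha> - 1)^2 + (\<beta>^2 + b^2 * E)"
      by (simp add: E_def power2_eq_square algebra_simps)
    hence "L ((\<alpha> - 1)^2) \<le> L ((1 + b^2) * E)"
      using LE[OF sq, of b] pos[of \<beta>] by (simp add: linear_add[OF L])
    hence "(L (b * (\<alpha> - 1)))^2 \<le> L (b^2) * L ((1 + b^2) * E)"
      using square_positive_Cauchy_Schwarz[OF L sp, of b "\<alpha> - 1"] pos[of b]
      by (smt (verit) mult.left_neutral mult_left_mono)
    hence "sqrt ((L (b * (\<alpha> - 1)))^2) \<le> sqrt (L (b^2) * L ((1 + b^2) * E))"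
      by (rule real_sqrt_le_mono)
    thus ?thesis by simp
  qed
  moreover have "L (b * (\<alpha>^2 + \<beta>^2)) - L b = L (b * E) + 2 * L (b * (\<alpha> - 1))"
  proof -
    have "b * (\<alpha>^2 + \<beta>^2) - b = b * E + (b * (\<alpha> - 1) + b * (\<alpha> - 1))"
      by (simp add: E_def power2_eq_square algebra_simps)
    from arg_cong[OF this, of L] show ?thesis by (simp only: linear_add[OF L] linear_diff[OF L])
  qed
  ultimately show ?thesis unfolding E_def by linarith
qed

lemma square_positive_poly:
  fixes L :: "'a::{comm_ring_1, real_algebra_1} \<Rightarrow> real"
  assumes L: "linear L" and pos: "\<And>a. 0 \<le> L (a^2)" and Carleman: "carleman_condition L x"
    and P: "\<And>r. square_positive L (poly P (of_real r))"
  shows "square_positive L (poly P x)"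
proof -
  have key: "0 \<le> L (poly P x)" if P: "\<And>r. square_positive L (poly P (of_real r))" for P :: "'a poly"
  proof -
    define m where "m = degree P"
    define a where "a d = coeff P d" for d
    have polyP: "poly P y = (\<Sum>d\<le>2 * m. a d * y ^ d)" for y
      unfolding a_def by (rule poly_eq_sum) (simp add: m_def)
    \<comment> \<open>One weight for all products \<open>a d * x ^ e\<close>: it exceeds each 1 +
      \<open>(a d * x ^ e)^2\<close> by a sum of squares, so smallness with respect to
      \<open>W\<close> yields all the limits simultaneously.\<close>
    define W where "W = 1 + (\<Sum>d\<le>2 * m. \<Sum>e\<le>2 * m. (a d * x ^ e)^2)"
    have sp1: "square_positive L 1" using pos by (simp add: square_positive_def)
    have sq: "square_positive L (a^2)" for a using pos by (rule square_positiveI_square)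
    have Wpos: "square_positive L W"
      unfolding W_def by (intro square_positive_add square_positive_sum L sp1 sq)
    obtain \<beta> where \<beta>: "\<And>d e. d \<le> 2 * m \<Longrightarrow> e \<le> 2 * m \<Longrightarrow> (\<lambda>N. \<beta> N d e) \<longlonglongrightarrow> (if d = e then 1 else 0 :: real)"
      and quad: "\<And>N. m \<le> N \<Longrightarrow> \<exists>(n::nat) c \<xi>. (\<forall>j<n. 0 \<le> c j) \<and>
       (\<forall>d\<le>2 * m. \<forall>x. (\<Sum>j<n. c j * \<xi> j ^ d * (1 + \<xi> j * x) ^ (2 * N)) =
          (1 + x^2) ^ (N - m) * (\<Sum>e\<le>2 * m. \<beta> N d e * x ^ e))"
      using polynomial_quadrature[of m] by blast
    have "\<exists>\<alpha> \<alpha>' u v. \<alpha>^2 + \<alpha>'^2 = (1 + x^2) ^ (N - m) * (u^2 + v^2) \<and>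
        L (W * ((1 - \<alpha>)^2 + \<alpha>'^2)) < inverse (real (Suc N))" for N
      by (rule approximate_unit[OF L pos Wpos Carleman]) simp
    then obtain \<alpha> \<alpha>' u v where unit: "\<And>N. (\<alpha> N)^2 + (\<alpha>' N)^2 = (1 + x^2) ^ (N - m) * ((u N)^2 + (v N)^2)"
      and small: "\<And>N. L (W * ((1 - \<alpha> N)^2 + (\<alpha>' N)^2)) < inverse (real (Suc N))" by metis
    define Y where "Y N = (\<alpha> N)^2 + (\<alpha>' N)^2" for N
    have lim: "(\<lambda>N. L (a d * x ^ e * Y N)) \<longlonglongrightarrow> L (a d * x ^ e)" if "d \<le> 2 * m" "e \<le> 2 * m" for d e
    proof -
      let ?b = "a d * x ^ e" and ?V = "W - (1 + (a d * x ^ e)^2)" and ?E = "\<lambda>N. (1 - \<alpha> N)^2 + (\<alpha>' N)^2"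
      have W_split: "square_positive L (W - (1 + ?b^2))"
      proof -
        let ?S = "\<Sum>p\<in>{..2*m} \<times> {..2*m} - {(d, e)}. (a (fst p) * x ^ snd p)^2"
        have "(\<Sum>d\<le>2 * m. \<Sum>e\<le>2 * m. (a d * x ^ e)^2) = (\<Sum>p\<in>{..2*m} \<times> {..2*m}. (a (fst p) * x ^ snd p)^2)"
          by (simp add: sum.cartesian_product case_prod_beta)
        also have "... = ?b^2 + ?S" using that by (subst sum.remove[of _ "(d, e)"]) auto
        finally have "W - (1 + ?b^2) = ?S" by (simp add: W_def)
        thus ?thesis by (simp only:) (intro square_positive_sum L sq)
      qed
      have E: "L ((1 + ?b^2) * ?E N) \<le> inverse (real (Suc N))" for N
      proof -
        have "W * ?E N = (1 + ?b^2) * ?E N + (?V * (1 - \<alpha> N)^2 + ?V * (\<alpha>' N)^2)"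
          by (simp only: distrib_left[symmetric] distrib_right[symmetric]) simp
        hence "L ((1 + ?b^2) * ?E N) \<le> L (W * ?E N)"
          using square_positiveD[OF W_split, of "1 - \<alpha> N"] square_positiveD[OF W_split, of "\<alpha>' N"]
          by (simp only: linear_add[OF L])
        thus ?thesis using small[of N] by linarith
      qed
      let ?r = "\<lambda>N. inverse (real (Suc N)) + 2 * sqrt (L (?b^2) * inverse (real (Suc N)))"
      have bound: "\<bar>L (?b * Y N) - L ?b\<bar> \<le> ?r N" for N
      proof -
        have "\<bar>L (?b * Y N) - L ?b\<bar> \<le> L ((1 + ?b^2) * ?E N) + 2 * sqrt (L (?b^2) * L ((1 + ?b^2) * ?E N))"
          unfolding Y_def by (rule perturbation_bound[OF L pos])
        also have "... \<le> ?r N" by (intro add_mono mult_left_mono real_sqrt_le_mono E pos) simp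
        finally show ?thesis .
      qed
      have "(\<lambda>N. ?r N) \<longlonglongrightarrow> 0 + 2 * sqrt (L (?b^2) * 0)"
        by (intro tendsto_intros LIMSEQ_inverse_real_of_nat)
      hence lim0: "(\<lambda>N. ?r N) \<longlonglongrightarrow> 0" by (simp only: mult_zero_right real_sqrt_zero add_0_right)
      have "(\<lambda>N. L (?b * Y N) - L ?b) \<longlonglongrightarrow> 0"
        by (rule Lim_null_comparison[OF _ lim0]) (simp only: real_norm_def bound eventually_True)
      thus ?thesis by (rule LIM_zero_cancel)
    qed
    \<comment> \<open>\<open>Y N\<close> contains the factor (1 + x^2)^(N-m), so the quadrature
      turns this double sum into L of a combination, with nonnegative coefficients, of the values
      P(\<xi> j) times the squares of (1 + \<xi> j x)^N u and (1 + \<xi> j x)^N v.\<close>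
    have nonneg: "0 \<le> (\<Sum>d\<le>2 * m. \<Sum>e\<le>2 * m. \<beta> N d e * L (a d * x ^ e * Y N))" if N: "m \<le> N" for N
    proof -
      obtain n :: nat and c \<xi> where "\<forall>j<n. 0 \<le> c j" and "\<forall>d\<le>2 * m. \<forall>x.
          (\<Sum>j<n. c j * \<xi> j ^ d * (1 + \<xi> j * x) ^ (2 * N)) = (1 + x^2) ^ (N - m) * (\<Sum>e\<le>2 * m. \<beta> N d e * x ^ e)"
        using quad[OF N] by blast
      hence c: "\<And>j. j < n \<Longrightarrow> 0 \<le> c j" and q: "\<And>d x. d \<le> 2 * m \<Longrightarrow>
          (\<Sum>j<n. c j * \<xi> j ^ d * (1 + \<xi> j * x) ^ (2 * N)) = (1 + x^2) ^ (N - m) * (\<Sum>e\<le>2 * m. \<beta> N d e * x ^ e)"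
        by simp_all
      let ?P = "\<lambda>j. poly P (of_real (\<xi> j))" and ?k = "\<lambda>j. (1 + of_real (\<xi> j) * x) ^ (2 * N)" and ?h = "(u N)^2 + (v N)^2"
      have "(\<Sum>j<n. of_real (c j) * (?P j * (?k j * ?h))) =
          (\<Sum>j<n. \<Sum>d\<le>2 * m. a d * (of_real (c j * \<xi> j ^ d) * ?k j) * ?h)"
        unfolding polyP by (simp add: sum_distrib_left sum_distrib_right mult_ac)
      also have "... = (\<Sum>d\<le>2 * m. a d * (\<Sum>j<n. of_real (c j * \<xi> j ^ d) * ?k j) * ?h)"
        by (subst sum.swap) (simp only: sum_distrib_left sum_distrib_right)
      also have "... = (\<Sum>d\<le>2 * m. a d * ((1 + x^2) ^ (N - m) * (\<Sum>e\<le>2 * m. of_real (\<beta> N d e) * x ^ e)) * ?h)"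
        by (intro sum.cong refl) (simp only: atMost_iff quadrature_in_algebra[OF q])
      also have "... = (\<Sum>d\<le>2 * m. \<Sum>e\<le>2 * m. of_real (\<beta> N d e) * (a d * x ^ e * Y N))"
        unfolding Y_def unit by (simp add: sum_distrib_left sum_distrib_right mult_ac)
      finally have "(\<Sum>d\<le>2 * m. \<Sum>e\<le>2 * m. \<beta> N d e * L (a d * x ^ e * Y N)) =
          L (\<Sum>j<n. of_real (c j) * (?P j * (?k j * ?h)))"
        by (simp add: linear_sum[OF L] linear_scale_of_real[OF L])
      also have "... = (\<Sum>j<n. c j * L (?P j * (?k j * ?h)))"
        by (simp add: linear_sum[OF L] linear_scale_of_real[OF L])
      also have "0 \<le> ..."
      proof (intro sum_nonneg mult_nonneg_nonneg c)
        fix j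
        have "?P j * (?k j * ?h) = ?P j * ((1 + of_real (\<xi> j) * x) ^ N * u N)^2 +
            ?P j * ((1 + of_real (\<xi> j) * x) ^ N * v N)^2"
          by (simp add: power_mult_distrib power_mult[symmetric] mult.commute[of N] distrib_left)
        thus "0 \<le> L (?P j * (?k j * ?h))"
          using square_positiveD[OF P] by (simp add: linear_add[OF L])
      qed simp
      finally show ?thesis .
    qed
    have "(\<lambda>N. \<Sum>d\<le>2 * m. \<Sum>e\<le>2 * m. \<beta> N d e * L (a d * x ^ e * Y N)) \<longlonglongrightarrow>
        (\<Sum>d\<le>2 * m. \<Sum>e\<le>2 * m. (if d = e then 1 else 0) * L (a d * x ^ e))"
      by (intro tendsto_sum tendsto_mult \<beta> lim) auto
    also have "(\<Sum>d\<le>2 * m. \<Sum>e\<le>2 * m. (if d = e then 1 else 0) * L (a d * x ^ e)) = L (poly P x)"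
      by (simp add: polyP linear_sum[OF L] if_distrib[of "\<lambda>c. c * _"] cong: if_cong)
    finally show ?thesis
      by (rule tendsto_lowerbound) (use nonneg in \<open>auto simp: eventually_sequentially\<close>)
  qed
  show ?thesis
  proof (unfold square_positive_def, rule allI)
    fix f
    \<comment> \<open>The test square is moved into the coefficients of the polynomial.\<close>
    have "0 \<le> L (poly (smult (f^2) P) x)"
      by (rule key) (use square_positive_mult_square[OF P] in \<open>simp add: mult.commute\<close>)
    thus "0 \<le> L (poly P x * f^2)" by (simp add: mult.commute)
  qed
qed

section \<open>Positivity of polynomials in several variables\<close>

text \<open>Real polynomials over an arbitrary set of variables, kept as syntax trees that are
  evaluated alike in the reals and in the algebra. Trees need no normal form: that \<open>L\<close>
  depends only on the induced real function will follow from positivity.\<close>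

datatype (pvars: 'v) pexp =
  PConst real | PVar 'v | PAdd "'v pexp" "'v pexp" | PMul "'v pexp" "'v pexp"

primrec peval :: "('v \<Rightarrow> 'b::{comm_ring_1, real_algebra_1}) \<Rightarrow> 'v pexp \<Rightarrow> 'b" where
  "peval \<rho> (PConst c) = of_real c"
| "peval \<rho> (PVar v) = \<rho> v"
| "peval \<rho> (PAdd e f) = peval \<rho> e + peval \<rho> f"
| "peval \<rho> (PMul e f) = peval \<rho> e * peval \<rho> f"

lemma peval_cong: "(\<And>v. v \<in> pvars e \<Longrightarrow> \<rho> v = \<sigma> v) \<Longrightarrow> peval \<rho> e = peval \<sigma> e" by (induction e) auto

lemma peval_of_real: "peval (\<lambda>v. of_real (z v)) e = of_real (peval z e)" by (induction e) simp_all

lemma peval_poly: "\<exists>P. \<forall>y. peval (\<rho>(v := y)) e = poly P y"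
proof (induction e)
  case (PConst c)
  show ?case by (rule exI[of _ "[:of_real c:]"]) simp
next
  case (PVar w)
  show ?case by (rule exI[of _ "if w = v then [:0, 1:] else [:\<rho> w:]"]) simp
next
  case (PAdd e f)
  thus ?case by (metis peval.simps(3) poly_add)
next
  case (PMul e f)
  thus ?case by (metis peval.simps(4) poly_mult)
qed

lemma finite_pvars [simp]: "finite (pvars e)" by (induction e) auto

lemma Carleman_positive:
  fixes L :: "'a::{comm_ring_1, real_algebra_1} \<Rightarrow> real"
  assumes L: "linear L" and pos: "\<And>a. 0 \<le> L (a^2)"
    and Carleman: "\<And>t. t \<in> S \<Longrightarrow> carleman_condition L t"
    and e: "pvars e \<subseteq> S" "\<And>z :: 'a \<Rightarrow> real. 0 \<le> peval z e"
  shows "0 \<le> L (peval id e)"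
proof -
  \<comment> \<open>The variables in U already hold elements of the algebra, the others arbitrary
    reals. Generality in z provides the hypothesis of the one-variable theorem at every real value r
    of the next variable.\<close>
  have "square_positive L (peval (\<lambda>v. if v \<in> U then v else of_real (z v)) e)"
    if "finite U" "U \<subseteq> S" for U and z :: "'a \<Rightarrow> real" using that
  proof (induction U arbitrary: z rule: finite_induct)
    case empty
    have "square_positive L (of_real (peval z e) * 1)"
      by (rule square_positive_scale[OF L]) (use pos e in \<open>simp_all add: square_positive_def\<close>)
    thus ?case by (simp add: peval_of_real)
  next
    case (insert s U)
    let ?\<rho> = "\<lambda>z v. if v \<in> U then v else of_real (z v)"
    obtain P where P: "\<And>y. peval ((?\<rho> z)(s := y)) e = poly P y" using peval_poly by metis
    have "square_positive L (poly P s)"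
    proof (rule square_positive_poly[OF L pos])
      show "carleman_condition L s" using insert.prems Carleman by simp
      fix r
      have "(?\<rho> z)(s := of_real r) = ?\<rho> (z(s := r))" using insert.hyps by auto
      thus "square_positive L (poly P (of_real r))"
        using insert.IH[of "z(s := r)"] insert.prems P[of "of_real r"] by simp
    qed
    moreover have "(?\<rho> z)(s := s) = (\<lambda>v. if v \<in> insert s U then v else of_real (z v))" by auto
    ultimately show ?case using P[of s] by simp
  qed
  from this[of "pvars e" "\<lambda>_. 0"] e have "square_positive L (peval id e)"
    using peval_cong[of e id "\<lambda>v. if v \<in> pvars e then v else of_real 0"] by simp
  from square_positiveD[OF this, of 1] show ?thesis by simp
qed

lemma peval_character:
  assumes "\<phi> \<in> characters"
  shows "\<phi> (peval \<rho> e) = peval (\<lambda>v. \<phi> (\<rho> v)) e"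
proof -
  have \<phi>: "linear \<phi>" "\<And>x y. \<phi> (x * y) = \<phi> x * \<phi> y" "\<phi> 1 = 1"
    using assms by (auto simp: characters_def)
  show ?thesis using linear_scale_of_real(1)[OF \<phi>(1), of _ 1] \<phi>(2,3)
    by (induction e) (simp_all add: linear_add[OF \<phi>(1)])
qed

lemma character_positive:
  fixes L :: "'a::{comm_ring_1, real_algebra_1} \<Rightarrow> real"
  assumes "\<forall>a\<in>nonneg_on_characters. 0 \<le> L a" and "\<And>z :: 'a \<Rightarrow> real. 0 \<le> peval z e"
  shows "0 \<le> L (peval id e)"
proof -
  have "peval id e \<in> nonneg_on_characters"
    using assms(2) by (simp add: nonneg_on_characters_def peval_character)
  thus ?thesis using assms(1) by blast
qed

section \<open>Riesz extension\<close>

text \<open>A partial functional as a relation, so that extension is inclusion and unions of chains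
  are again of this kind. Single-valuedness follows from positivity, by comparing a function with
  itself in \<open>positive_graph_mono\<close>.\<close>

definition positive_graph :: "(('b \<Rightarrow> real) \<times> real) set \<Rightarrow> bool" where
  "positive_graph g \<longleftrightarrow> ((\<lambda>_. 0), 0) \<in> g \<and>
     (\<forall>f r h s c. (f, r) \<in> g \<longrightarrow> (h, s) \<in> g \<longrightarrow> ((\<lambda>x. f x + c * h x), r + c * s) \<in> g) \<and>
     (\<forall>f r. (f, r) \<in> g \<longrightarrow> (\<forall>x. 0 \<le> f x) \<longrightarrow> 0 \<le> r)"

lemma positive_graphD:
  assumes "positive_graph g"
  shows "((\<lambda>_. 0), 0) \<in> g"
    and "(f, r) \<in> g \<Longrightarrow> (h, s) \<in> g \<Longrightarrow> ((\<lambda>x. f x + c * h x), r + c * s) \<in> g"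
    and "(f, r) \<in> g \<Longrightarrow> (\<And>x. 0 \<le> f x) \<Longrightarrow> 0 \<le> r" using assms unfolding positive_graph_def by blast+

lemma positive_graph_scale:
  assumes "positive_graph g" "(f, r) \<in> g"
  shows "((\<lambda>x. c * f x), c * r) \<in> g"
  using positive_graphD(2)[OF assms(1) positive_graphD(1)[OF assms(1)] assms(2), of c] by simp

lemma positive_graph_mono:
  assumes "positive_graph g" "(f, r) \<in> g" "(h, s) \<in> g" "\<And>x. f x \<le> h x"
  shows "r \<le> s"
  using positive_graphD(3)[OF assms(1) positive_graphD(2)[OF assms(1,3,2), of "-1"]] assms(4) by simp

text \<open>As F lies between two functions of the domain, the values at functions below F have a
  supremum, bounded by every value at a function above F. It is an admissible value at F: for h + k
  F >= 0 divide by k and use one of the two bounds according to its sign.\<close>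

lemma positive_graph_extend:
  assumes g: "positive_graph g" and lo: "(l, a) \<in> g" "\<And>x. l x \<le> F x" and hi: "(u, b) \<in> g" "\<And>x. F x \<le> u x"
  shows "\<exists>g' r. positive_graph g' \<and> g \<subseteq> g' \<and> (F, r) \<in> g'"
proof -
  define R where "R = {r. \<exists>h. (h, r) \<in> g \<and> (\<forall>x. h x \<le> F x)}"
  define c where "c = Sup R"
  have ub: "r \<le> s" if "r \<in> R" "(h, s) \<in> g" "\<And>x. F x \<le> h x" for r s h
  proof -
    obtain k where "(k, r) \<in> g" "\<And>x. k x \<le> F x" using \<open>r \<in> R\<close> by (auto simp: R_def)
    thus ?thesis using positive_graph_mono[OF g _ that(2)] order_trans[OF _ that(3)] by blast
  qed
  have "bdd_above R" using ub[OF _ hi] by (rule bdd_aboveI)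
  hence c_lower: "r \<le> c" if "(h, r) \<in> g" "\<And>x. h x \<le> F x" for h r
    unfolding c_def using that by (intro cSup_upper) (auto simp: R_def)
  have "R \<noteq> {}" using lo by (auto simp: R_def)
  hence c_upper: "c \<le> s" if "(h, s) \<in> g" "\<And>x. F x \<le> h x" for h s
    unfolding c_def using ub that by (intro cSup_least) auto
  define g' where "g' = {((\<lambda>x. h x + k * F x), r + k * c) | h r k. (h, r) \<in> g}"
  have g'I: "((\<lambda>x. h x + k * F x), r + k * c) \<in> g'" if "(h, r) \<in> g" for h r k
    unfolding g'_def using that by blast
  have "positive_graph g'" unfolding positive_graph_def
  proof (intro conjI allI impI)
    show "((\<lambda>_. 0), 0) \<in> g'" using g'I[OF positive_graphD(1)[OF g], of 0] by simp
  next
    fix f r h s k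
    assume "(f, r) \<in> g'" "(h, s) \<in> g'"
    then obtain f0 r0 k0 h0 s0 k1 where
      "f = (\<lambda>x. f0 x + k0 * F x)" "r = r0 + k0 * c" "(f0, r0) \<in> g"
      "h = (\<lambda>x. h0 x + k1 * F x)" "s = s0 + k1 * c" "(h0, s0) \<in> g" unfolding g'_def by blast
    thus "((\<lambda>x. f x + k * h x), r + k * s) \<in> g'"
      using g'I[OF positive_graphD(2)[OF g, of f0 r0 h0 s0 k], of "k0 + k * k1"]
      by (simp add: algebra_simps)
  next
    fix f r assume "(f, r) \<in> g'" and nn: "\<forall>x. 0 \<le> f x"
    then obtain h r0 k where f: "f = (\<lambda>x. h x + k * F x)" "r = r0 + k * c" and h: "(h, r0) \<in> g"
      unfolding g'_def by blast
    have sc: "((\<lambda>x. (- 1 / k) * h x), (- 1 / k) * r0) \<in> g" by (rule positive_graph_scale[OF g h])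
    consider "k = 0" | "0 < k" | "k < 0" by linarith
    thus "0 \<le> r"
    proof cases
      case 1
      thus ?thesis using positive_graphD(3)[OF g h] nn f by simp
    next
      case 2
      have "(- 1 / k) * r0 \<le> c"
      proof (rule c_lower[OF sc])
        fix x
        have "- h x \<le> k * F x" using nn[rule_format, of x] by (simp add: f)
        thus "(- 1 / k) * h x \<le> F x" using 2 by (simp add: divide_simps mult.commute)
      qed
      thus ?thesis using 2 f by (simp add: field_simps)
    next
      case 3
      have "c \<le> (- 1 / k) * r0"
      proof (rule c_upper[OF sc])
        fix x
        have "- h x \<le> k * F x" using nn[rule_format, of x] by (simp add: f)
        thus "F x \<le> (- 1 / k) * h x" using 3 by (simp add: divide_simps mult.commute)
      qed
      thus ?thesis using 3 f by (simp add: field_simps)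
    qed
  qed
  moreover have "g \<subseteq> g'"
  proof safe
    fix h r assume "(h, r) \<in> g"
    thus "(h, r) \<in> g'" using g'I[of h r 0] by simp
  qed
  moreover have "(F, c) \<in> g'" using g'I[OF positive_graphD(1)[OF g], of 1] by simp
  ultimately show ?thesis by blast
qed

text \<open>A maximal graph contains every f with -p <= f <= p for some p in the domain of g, since
  it could otherwise be extended. Outside its domain \<Lambda> has unspecified values, hence the
  domination hypotheses in the conclusions.\<close>

theorem Riesz_extension:
  assumes g: "positive_graph g"
  shows "\<exists>\<Lambda>. (\<forall>f r. (f, r) \<in> g \<longrightarrow> \<Lambda> f = r) \<and>
    (\<forall>f h c p s q t. (p, s) \<in> g \<longrightarrow> (q, t) \<in> g \<longrightarrow> (\<forall>x. \<bar>f x\<bar> \<le> p x) \<longrightarrow> (\<forall>x. \<bar>h x\<bar> \<le> q x) \<longrightarrow>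
       \<Lambda> (\<lambda>x. f x + c * h x) = \<Lambda> f + c * \<Lambda> h) \<and>
    (\<forall>f p s. (p, s) \<in> g \<longrightarrow> (\<forall>x. f x \<le> p x) \<longrightarrow> (\<forall>x. 0 \<le> f x) \<longrightarrow> 0 \<le> \<Lambda> f)"
proof -
  define A where "A = {g'. positive_graph g' \<and> g \<subseteq> g'}"
  have "\<exists>M\<in>A. \<forall>X\<in>A. M \<subseteq> X \<longrightarrow> X = M"
  proof (rule subset_Zorn_nonempty)
    show "A \<noteq> {}" using g by (auto simp: A_def)
    fix C assume C: "C \<noteq> {}" "subset.chain A C"
    hence CA: "\<And>g'. g' \<in> C \<Longrightarrow> positive_graph g' \<and> g \<subseteq> g'" by (auto simp: subset_chain_def A_def)
    have "positive_graph (\<Union>C)" unfolding positive_graph_def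
    proof (intro conjI allI impI)
      show "((\<lambda>_. 0), 0) \<in> \<Union>C" using C CA positive_graphD(1) by blast
    next
      fix f r h s k assume "(f, r) \<in> \<Union>C" "(h, s) \<in> \<Union>C"
      then obtain g1 g2 where g12: "g1 \<in> C" "g2 \<in> C" "(f, r) \<in> g1" "(h, s) \<in> g2" by blast
      then obtain g3 where "g3 \<in> C" "(f, r) \<in> g3" "(h, s) \<in> g3"
        using C unfolding subset_chain_def by (metis subsetD)
      thus "((\<lambda>x. f x + k * h x), r + k * s) \<in> \<Union>C" using CA positive_graphD(2) by blast
    next
      fix f r assume "(f, r) \<in> \<Union>C" "\<forall>x. 0 \<le> f x"
      thus "0 \<le> r" using CA positive_graphD(3) by blast
    qed
    thus "\<Union>C \<in> A" using C CA by (auto simp: A_def)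
  qed
  then obtain M where "M \<in> A" and maxA: "\<And>X. X \<in> A \<Longrightarrow> M \<subseteq> X \<Longrightarrow> X = M" by blast
  hence M: "positive_graph M" "g \<subseteq> M" by (simp_all add: A_def)
  have max: "X = M" if "positive_graph X" "M \<subseteq> X" for X
    using that M by (intro maxA) (auto simp: A_def)
  define \<Lambda> where "\<Lambda> f = (THE r. (f, r) \<in> M)" for f
  have \<Lambda>I: "\<Lambda> f = r" if "(f, r) \<in> M" for f r
    unfolding \<Lambda>_def using that positive_graph_mono[OF M(1) that, of f] positive_graph_mono[OF M(1) _ that, of f]
    by (intro the_equality) (auto intro: order.antisym)
  have dom: "\<exists>r. (f, r) \<in> M" if "(p, s) \<in> g" "\<And>x. \<bar>f x\<bar> \<le> p x" for f p s
  proof -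
    have p: "(p, s) \<in> M" using that M by blast
    have bds: "(- 1) * p x \<le> f x" "f x \<le> p x" for x using that(2)[of x] by auto
    from positive_graph_extend[OF M(1) positive_graph_scale[OF M(1) p, of "- 1"] bds(1) p bds(2)]
    show ?thesis using max by blast
  qed
  show ?thesis
  proof (rule exI[of _ \<Lambda>], intro conjI allI impI)
    show "\<Lambda> f = r" if "(f, r) \<in> g" for f r using that M \<Lambda>I by blast
    show "\<Lambda> (\<lambda>x. f x + c * h x) = \<Lambda> f + c * \<Lambda> h"
      if "(p, s) \<in> g" "(q, t) \<in> g" "\<forall>x. \<bar>f x\<bar> \<le> p x" "\<forall>x. \<bar>h x\<bar> \<le> q x" for f h c p s q t
    proof -
      have "\<exists>r. (f, r) \<in> M" "\<exists>r. (h, r) \<in> M" using dom[of p s f] dom[of q t h] that by blast+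
      then obtain r1 r2 where r: "(f, r1) \<in> M" "(h, r2) \<in> M" by blast
      show ?thesis using \<Lambda>I[OF r(1)] \<Lambda>I[OF r(2)] \<Lambda>I[OF positive_graphD(2)[OF M(1) r]] by simp
    qed
    show "0 \<le> \<Lambda> f" if "(p, s) \<in> g" "\<forall>x. f x \<le> p x" "\<forall>x. 0 \<le> f x" for f p s
    proof -
      have "\<bar>f x\<bar> \<le> p x" for x using that(2)[rule_format, of x] that(3)[rule_format, of x] by linarith
      from dom[OF that(1) this] obtain r where r: "(f, r) \<in> M" by blast
      show ?thesis using \<Lambda>I[OF r] positive_graphD(3)[OF M(1) r] that by simp
    qed
  qed
qed

section \<open>Finitely additive measures on the Stone space\<close>

text \<open>
  The points of the Stone space of the algebra of all subsets are the Boolean homomorphisms, that is,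
  the ultrafilters. By compactness every finitely additive measure on all subsets becomes countably
  additive there.
\<close>
definition boolean_homs :: "('b set \<Rightarrow> bool) set" where
  "boolean_homs = {w. (\<forall>C D. w (C \<inter> D) \<longleftrightarrow> w C \<and> w D) \<and> (\<forall>C. w (- C) \<longleftrightarrow> \<not> w C)}"

lemma boolean_homsD:
  assumes "w \<in> boolean_homs"
  shows "w (C \<inter> D) \<longleftrightarrow> w C \<and> w D" "w (- C) \<longleftrightarrow> \<not> w C" "\<not> w {}" "w UNIV"
    "C \<subseteq> D \<Longrightarrow> w C \<Longrightarrow> w D" "w (C \<union> D) \<longleftrightarrow> w C \<or> w D"
proof -
  have i: "w (C \<inter> D) \<longleftrightarrow> w C \<and> w D" and c: "w (- C) \<longleftrightarrow> \<not> w C" for C D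
    using assms by (auto simp: boolean_homs_def)
  show "w (C \<inter> D) \<longleftrightarrow> w C \<and> w D" "w (- C) \<longleftrightarrow> \<not> w C" by (fact i c)+
  show e: "\<not> w {}" using i[of C "- C"] c[of C] by auto
  show "w UNIV" using c[of "{}"] e by simp
  show "C \<subseteq> D \<Longrightarrow> w C \<Longrightarrow> w D" using i[of C D] by (simp add: Int_absorb2)
  show "w (C \<union> D) \<longleftrightarrow> w C \<or> w D" using i[of "- C" "- D"] c[of "C \<union> D"] c[of C] c[of D] by (auto simp: Compl_Un)
qed

text \<open>Each condition on w involves finitely many coordinates, so it is closed in the compact
  product of two-point spaces. Any finitely many of them are met by the principal ultrafilter at a
  point of a sufficiently late A N.\<close>

lemma compact_boolean_homs_Collect:
  fixes A :: "nat \<Rightarrow> 'b set"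
  assumes dec: "decseq A" and ne: "\<And>n. A n \<noteq> {}"
  shows "\<exists>w\<in>boolean_homs. \<forall>n. w (A n)"
proof -
  define X where "X = product_topology (\<lambda>_ :: 'b set. discrete_topology (UNIV :: bool set)) UNIV"
  have comp: "compact_space X"
    unfolding X_def by (simp add: compact_space_product_topology compact_space_discrete_topology)
  have top: "topspace X = UNIV" by (simp add: X_def)
  have proj: "continuous_map X (discrete_topology UNIV) (\<lambda>w. w C)" for C
    unfolding X_def by (rule continuous_map_product_projection) simp
  have clop: "closedin X {w. w C = b}" for C b
    using closedin_continuous_map_preimage[OF proj, of "{b}" C] by (simp add: top)
  define H where "H C D = {w. (w (C \<inter> D) \<longleftrightarrow> w C \<and> w D) \<and> (w (- C) \<longleftrightarrow> \<not> w C)}" for C D :: "'b set"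
  have hom_closed: "closedin X (H C D)" for C D
  proof -
    have "H C D = (({w. w (C \<inter> D) = False} \<union> ({w. w C = True} \<inter> {w. w D = True})) \<inter>
       ({w. w (C \<inter> D) = True} \<union> ({w. w C = False} \<union> {w. w D = False}))) \<inter>
      (({w. w (- C) = False} \<union> {w. w C = False}) \<inter> ({w. w (- C) = True} \<union> {w. w C = True}))"
      unfolding H_def by auto
    also have "closedin X ..." by (intro closedin_Int closedin_Un clop)
    finally show ?thesis .
  qed
  define \<U> where "\<U> = (\<Union>C. range (H C)) \<union> range (\<lambda>n. {w. w (A n) = True})"
  have "\<Inter>\<U> \<noteq> {}"
  proof (rule comp[unfolded compact_space_fip, rule_format], intro conjI ballI allI impI)
    show "closedin X C" if "C \<in> \<U>" for C
      using that unfolding \<U>_def by (elim UnE UN_E rangeE) (simp_all only: hom_closed clop)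
    fix \<F> assume \<F>: "finite \<F> \<and> \<F> \<subseteq> \<U>"
    let ?P = "\<lambda>N F. \<forall>b\<in>A N. (\<lambda>C. b \<in> C) \<in> F"
    have "\<exists>N. \<forall>F\<in>\<F>. ?P N F"
    proof (rule finite_subset_induct[of \<F> \<U>])
      show "finite \<F>" "\<F> \<subseteq> \<U>" using \<F> by auto
    next
      fix F \<F>' assume "F \<in> \<U>" and "\<exists>N. \<forall>F\<in>\<F>'. ?P N F"
      then obtain N where N: "\<forall>F\<in>\<F>'. ?P N F" by blast
      have "\<exists>n. ?P n F" using \<open>F \<in> \<U>\<close> unfolding \<U>_def by (elim UnE UN_E rangeE) (auto simp: H_def)
      then obtain n where n: "?P n F" by blast
      have "A (max n N) \<subseteq> A n" "A (max n N) \<subseteq> A N" using dec by (simp_all add: decseq_def)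
      thus "\<exists>N. \<forall>F\<in>insert F \<F>'. ?P N F" using n N by (intro exI[of _ "max n N"]) blast
    qed simp
    then obtain N where "\<forall>F\<in>\<F>. ?P N F" by blast
    moreover obtain b where "b \<in> A N" using ne by blast
    ultimately have "(\<lambda>C. b \<in> C) \<in> \<Inter>\<F>" by blast
    thus "\<Inter>\<F> \<noteq> {}" by blast
  qed
  then obtain w where "w \<in> \<Inter>\<U>" by blast
  hence "w \<in> H C D" "w (A n)" for C D n
    unfolding \<U>_def by auto
  thus ?thesis by (intro bexI[of _ w]) (simp_all add: H_def boolean_homs_def)
qed

definition stone_set :: "'b set \<Rightarrow> ('b set \<Rightarrow> bool) set" where
  "stone_set C = {w \<in> boolean_homs. w C}"

lemma principal_boolean_hom: "(\<lambda>C. b \<in> C) \<in> boolean_homs" by (simp add: boolean_homs_def)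

text \<open>Principal ultrafilters separate distinct sets, so a set function can be read off the
  sets \<open>stone_set C\<close>.\<close>

lemma stone_set_inject: "stone_set C = stone_set D \<longleftrightarrow> C = D"
proof
  assume eq: "stone_set C = stone_set D"
  show "C = D"
  proof (rule set_eqI)
    fix b
    have "(\<lambda>C. b \<in> C) \<in> stone_set C \<longleftrightarrow> (\<lambda>C. b \<in> C) \<in> stone_set D" using eq by simp
    thus "b \<in> C \<longleftrightarrow> b \<in> D" by (simp add: stone_set_def principal_boolean_hom)
  qed
qed simp

lemma stone_set_simps:
  "stone_set {} = {}" "stone_set UNIV = boolean_homs"
  "stone_set (C \<inter> D) = stone_set C \<inter> stone_set D" "stone_set (C \<union> D) = stone_set C \<union> stone_set D"
  "stone_set (- C) = boolean_homs - stone_set C" by (auto simp: stone_set_def boolean_homsD)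

lemma stone_measure:
  fixes m :: "'b set \<Rightarrow> real"
  assumes m0: "\<And>C. 0 \<le> m C" and add: "\<And>C D. C \<inter> D = {} \<Longrightarrow> m (C \<union> D) = m C + m D"
  shows "\<exists>N. space N = boolean_homs \<and> (\<forall>C. stone_set C \<in> sets N \<and> emeasure N (stone_set C) = ennreal (m C))"
proof -
  define M where "M = range (stone_set :: 'b set \<Rightarrow> _)"
  define f where "f A = ennreal (m (inv stone_set A))" for A
  have inj: "inj (stone_set :: 'b set \<Rightarrow> _)" by (rule injI) (simp add: stone_set_inject)
  have f: "f (stone_set C) = ennreal (m C)" for C by (simp add: f_def inv_f_f[OF inj])
  have "algebra boolean_homs M" unfolding algebra_iff_Un
  proof (intro conjI ballI)
    show "M \<subseteq> Pow boolean_homs" by (auto simp: M_def stone_set_def)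
    show "{} \<in> M" unfolding M_def using stone_set_simps(1) by (metis rangeI)
    show "boolean_homs - a \<in> M" if "a \<in> M" for a
      using that unfolding M_def by (auto simp flip: stone_set_simps(5))
    show "a \<union> b \<in> M" if "a \<in> M" "b \<in> M" for a b
      using that unfolding M_def by (auto simp flip: stone_set_simps(4))
  qed
  then interpret algebra boolean_homs M .
  have empty: "m {} = 0" using add[of "{}" "{}"] by simp
  have "\<exists>\<mu>. (\<forall>s\<in>M. \<mu> s = f s) \<and> measure_space boolean_homs (sigma_sets boolean_homs M) \<mu>"
  proof (rule caratheodory_empty_continuous)
    show "positive M f" using f[of "{}"] empty by (simp add: positive_def stone_set_simps)
    show "additive M f" unfolding additive_def
    proof (intro ballI impI)
      fix x y assume "x \<in> M" "y \<in> M" and disj: "x \<inter> y = {}"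
      then obtain C D where CD: "x = stone_set C" "y = stone_set D" by (auto simp: M_def)
      hence "stone_set (C \<inter> D) = stone_set {}" using disj by (simp add: stone_set_simps)
      hence "C \<inter> D = {}" by (simp only: stone_set_inject)
      thus "f (x \<union> y) = f x + f y"
        using CD add m0 by (simp add: f stone_set_simps(4)[symmetric] ennreal_plus)
    qed
    show "f A \<noteq> \<infinity>" for A by (simp add: f_def)
    fix A :: "nat \<Rightarrow> _" assume A: "range A \<subseteq> M" "decseq A" "(\<Inter>i. A i) = {}"
    hence "\<exists>C. A n = stone_set C" for n unfolding M_def by blast
    then obtain C where C: "\<And>n. A n = stone_set (C n)" by metis
    have "decseq C" unfolding decseq_def
    proof (intro allI impI)
      fix k n :: nat assume "k \<le> n"
      hence "stone_set (C n) \<subseteq> stone_set (C k)" using A(2) by (simp add: decseq_def C)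
      hence "stone_set (C n \<inter> C k) = stone_set (C n)" by (simp add: stone_set_simps Int_absorb2)
      thus "C n \<subseteq> C k" by (simp add: stone_set_inject Int_absorb2 inf.absorb_iff1)
    qed
    \<comment> \<open>By compactness, decreasing clopen sets with empty intersection are eventually
      empty, so continuity at the empty set reduces to \<open>m {} = 0\<close>.\<close>
    have "\<exists>n. C n = {}"
    proof (rule ccontr)
      assume "\<nexists>n. C n = {}"
      then obtain w where "w \<in> boolean_homs" "\<forall>n. w (C n)"
        using compact_boolean_homs_Collect[OF \<open>decseq C\<close>] by blast
      hence "w \<in> (\<Inter>i. A i)" by (simp add: C stone_set_def)
      thus False using A(3) by simp
    qed
    then obtain n where n: "C n = {}" by blast
    have "f (A k) = 0" if "n \<le> k" for k
    proof -
      have "C k = {}" using \<open>decseq C\<close> n that unfolding decseq_def by blast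
      thus ?thesis by (simp add: C f empty)
    qed
    thus "(\<lambda>i. f (A i)) \<longlonglongrightarrow> 0" by (intro tendsto_eventually) (auto simp: eventually_sequentially)
  qed
  then obtain \<mu> where \<mu>: "\<And>s. s \<in> M \<Longrightarrow> \<mu> s = f s" "measure_space boolean_homs (sigma_sets boolean_homs M) \<mu>"
    by blast
  have MPow: "M \<subseteq> Pow boolean_homs" by (rule space_closed)
  let ?N = "measure_of boolean_homs M \<mu>"
  show ?thesis
  proof (intro exI[of _ ?N] conjI allI)
    show "space ?N = boolean_homs" using MPow by (simp add: space_measure_of)
    fix C
    have CM: "stone_set C \<in> M" by (simp add: M_def)
    thus "stone_set C \<in> sets ?N" using MPow by (simp add: sets_measure_of)
    have "emeasure ?N (stone_set C) = \<mu> (stone_set C)"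
      using \<mu>(2) MPow CM unfolding measure_space_def
      by (intro emeasure_measure_of[OF refl MPow]) (auto simp: sets_measure_of)
    thus "emeasure ?N (stone_set C) = ennreal (m C)" using \<mu>(1)[OF CM] by (simp add: f)
  qed
qed

definition ultrafilter_of :: "('b set \<Rightarrow> bool) \<Rightarrow> 'b filter" where
  "ultrafilter_of w = Abs_filter (\<lambda>P. w {b. P b})"

lemma eventually_ultrafilter_of:
  assumes "w \<in> boolean_homs"
  shows "eventually P (ultrafilter_of w) \<longleftrightarrow> w {b. P b}" unfolding ultrafilter_of_def
proof (rule eventually_Abs_filter, rule is_filter.intro)
  show "w {b. True}" using boolean_homsD(4)[OF assms] by simp
  show "w {b. P b \<and> Q b}" if "w {b. P b}" "w {b. Q b}" for P Q
    using boolean_homsD(1)[OF assms, of "Collect P" "Collect Q"] that by (simp add: Collect_conj_eq)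
  show "w {b. Q b}" if "\<forall>b. P b \<longrightarrow> Q b" "w {b. P b}" for P Q
    using boolean_homsD(5)[OF assms, of "Collect P" "Collect Q"] that by auto
qed

lemma ultrafilter_of_neq_bot: "w \<in> boolean_homs \<Longrightarrow> ultrafilter_of w \<noteq> bot"
  using eventually_ultrafilter_of[of w "\<lambda>_. False"] boolean_homsD(3)[of w]
  by (auto simp: trivial_limit_def)

text \<open>Compactness of the interval gives a cluster point, and along an ultrafilter a cluster
  point is a limit.\<close>

lemma bounded_tendsto_ultrafilter:
  fixes F :: "'b \<Rightarrow> real"
  assumes w: "w \<in> boolean_homs" and bd: "w {b. \<bar>F b\<bar> \<le> K}"
  shows "\<exists>r. (F \<longlongrightarrow> r) (ultrafilter_of w)"
proof -
  let ?U = "filtermap F (ultrafilter_of w)"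
  have "eventually (\<lambda>y. y \<in> {- K..K}) ?U"
    using bd by (simp add: eventually_filtermap eventually_ultrafilter_of[OF w] abs_le_iff minus_le_iff conj_commute)
  moreover have "?U \<noteq> bot" using ultrafilter_of_neq_bot[OF w] by (simp add: filtermap_bot_iff)
  ultimately obtain r where r: "inf (nhds r) ?U \<noteq> bot"
    using compact_Icc[of "- K" K] unfolding compact_filter by blast
  have "(F \<longlongrightarrow> r) (ultrafilter_of w)"
  proof (rule topological_tendstoI)
    fix S assume S: "open S" "r \<in> S"
    show "eventually (\<lambda>b. F b \<in> S) (ultrafilter_of w)"
    proof (rule ccontr)
      assume "\<not> ?thesis"
      hence "eventually (\<lambda>b. F b \<notin> S) (ultrafilter_of w)"
        using boolean_homsD(2)[OF w, of "{b. F b \<in> S}"]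
        by (simp add: eventually_ultrafilter_of[OF w] Collect_neg_eq)
      hence "eventually (\<lambda>y. y \<notin> S) ?U" by (simp add: eventually_filtermap)
      moreover have "eventually (\<lambda>y. y \<in> S) (nhds r)" using S by (auto simp: eventually_nhds)
      ultimately have "eventually (\<lambda>_. False) (inf (nhds r) ?U)" unfolding eventually_inf by blast
      thus False using r by (simp add: trivial_limit_def)
    qed
  qed
  thus ?thesis ..
qed

lemma boolean_homs_Union:
  assumes "w \<in> boolean_homs" "finite I"
  shows "w (\<Union>i\<in>I. A i) \<longleftrightarrow> (\<exists>i\<in>I. w (A i))"
  using assms(2) by induction (simp_all add: boolean_homsD[OF assms(1)])

text \<open>The fibres of G form a finite partition, of which an ultrafilter contains exactly one
  cell.\<close>

lemma boolean_homs_finite_range: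
  fixes G :: "'b \<Rightarrow> 'c"
  assumes w: "w \<in> boolean_homs" and fin: "finite (range G)"
  obtains v where "v \<in> range G" "w {b. G b = v}" "\<And>v'. w {b. G b = v'} \<longleftrightarrow> v' = v"
proof -
  have "(\<Union>v\<in>range G. {b. G b = v}) = UNIV" by auto
  hence "\<exists>v\<in>range G. w {b. G b = v}"
    using boolean_homs_Union[OF w fin, of "\<lambda>v. {b. G b = v}"] boolean_homsD(4)[OF w] by simp
  then obtain v where v: "v \<in> range G" "w {b. G b = v}" by blast
  have "v' = v" if "w {b. G b = v'}" for v'
  proof (rule ccontr)
    assume "v' \<noteq> v"
    hence "{b. G b = v'} \<inter> {b. G b = v} = {}" by auto
    thus False using boolean_homsD(1,3)[OF w] that v by metis
  qed
  with v show ?thesis using that by blast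
qed

section \<open>Positive functionals as integrals over the Stone space\<close>

text \<open>In the application E consists of the functions bounded by a polynomial. Closure under
  domination puts all bounded functions into E, in particular all indicators, so \<Lambda> yields a
  finitely additive measure on all sets.\<close>

locale expectation =
  fixes E :: "('b \<Rightarrow> real) set" and \<Lambda> :: "('b \<Rightarrow> real) \<Rightarrow> real"
  assumes lin: "f \<in> E \<Longrightarrow> h \<in> E \<Longrightarrow> (\<lambda>x. f x + c * h x) \<in> E"
    and dominated: "f \<in> E \<Longrightarrow> (\<And>x. \<bar>h x\<bar> \<le> \<bar>f x\<bar>) \<Longrightarrow> h \<in> E"
    and const_1: "(\<lambda>_. 1) \<in> E"
    and additive: "f \<in> E \<Longrightarrow> h \<in> E \<Longrightarrow> \<Lambda> (\<lambda>x. f x + c * h x) = \<Lambda> f + c * \<Lambda> h"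
    and nonneg: "f \<in> E \<Longrightarrow> (\<And>x. 0 \<le> f x) \<Longrightarrow> 0 \<le> \<Lambda> f"
begin

lemma zero: "(\<lambda>_. 0) \<in> E" "\<Lambda> (\<lambda>_. 0) = 0"
proof -
  show z: "(\<lambda>_. 0) \<in> E" by (rule dominated[OF const_1]) simp
  show "\<Lambda> (\<lambda>_. 0) = 0" using additive[OF z z, of 1] by simp
qed

lemma scale: "f \<in> E \<Longrightarrow> (\<lambda>x. c * f x) \<in> E" "f \<in> E \<Longrightarrow> \<Lambda> (\<lambda>x. c * f x) = c * \<Lambda> f"
  using lin[OF zero(1), of f c] additive[OF zero(1), of f c] zero(2) by simp_all

lemma add: "f \<in> E \<Longrightarrow> h \<in> E \<Longrightarrow> (\<lambda>x. f x + h x) \<in> E"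
    "f \<in> E \<Longrightarrow> h \<in> E \<Longrightarrow> \<Lambda> (\<lambda>x. f x + h x) = \<Lambda> f + \<Lambda> h"
  using lin[of f h 1] additive[of f h 1] by simp_all

lemma diff: "f \<in> E \<Longrightarrow> h \<in> E \<Longrightarrow> (\<lambda>x. f x - h x) \<in> E"
    "f \<in> E \<Longrightarrow> h \<in> E \<Longrightarrow> \<Lambda> (\<lambda>x. f x - h x) = \<Lambda> f - \<Lambda> h"
  using lin[of f h "- 1"] additive[of f h "- 1"] by simp_all

lemma mono: "f \<in> E \<Longrightarrow> h \<in> E \<Longrightarrow> (\<And>x. f x \<le> h x) \<Longrightarrow> \<Lambda> f \<le> \<Lambda> h"
  using nonneg[OF diff(1), of h f] diff(2)[of h f] by simp

lemma bounded_mem: "(\<And>x. \<bar>h x\<bar> \<le> K) \<Longrightarrow> h \<in> E"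
  by (rule dominated[OF scale(1)[OF const_1, of K]]) (metis abs_ge_self mult.right_neutral order_trans)

lemma sum_mem:
  assumes "finite I" "\<And>i. i \<in> I \<Longrightarrow> f i \<in> E"
  shows "(\<lambda>x. \<Sum>i\<in>I. f i x) \<in> E" "\<Lambda> (\<lambda>x. \<Sum>i\<in>I. f i x) = (\<Sum>i\<in>I. \<Lambda> (f i))"
proof -
  have "(\<lambda>x. \<Sum>i\<in>I. f i x) \<in> E \<and> \<Lambda> (\<lambda>x. \<Sum>i\<in>I. f i x) = (\<Sum>i\<in>I. \<Lambda> (f i))"
    using assms by (induction rule: finite_induct) (auto simp: zero add)
  thus "(\<lambda>x. \<Sum>i\<in>I. f i x) \<in> E" "\<Lambda> (\<lambda>x. \<Sum>i\<in>I. f i x) = (\<Sum>i\<in>I. \<Lambda> (f i))" by auto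
qed

lemma indicator_mem: "indicator C \<in> E" by (rule bounded_mem[of _ 1]) (simp add: indicator_def)

lemma stone_measure_exists:
  "\<exists>N. space N = boolean_homs \<and>
    (\<forall>C. stone_set C \<in> sets N \<and> emeasure N (stone_set C) = ennreal (\<Lambda> (indicator C)))"
proof (rule stone_measure)
  show "0 \<le> \<Lambda> (indicator C)" for C by (rule nonneg[OF indicator_mem]) simp
  show "\<Lambda> (indicator (C \<union> D)) = \<Lambda> (indicator C) + \<Lambda> (indicator D)" if "C \<inter> D = {}" for C D
  proof -
    have "indicator (C \<union> D) = (\<lambda>b. indicator C b + indicator D b :: real)"
      using that by (auto simp: indicator_def fun_eq_iff)
    thus ?thesis using add(2)[OF indicator_mem indicator_mem, of C D] by simp
  qed
qed

context
  fixes N :: "('b set \<Rightarrow> bool) measure"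
  assumes space_N: "space N = boolean_homs"
    and sets_N: "\<And>C. stone_set C \<in> sets N"
    and emeasure_N: "\<And>C. emeasure N (stone_set C) = ennreal (\<Lambda> (indicator C))"
begin

lemma finite_measure_N: "finite_measure N"
  by (rule finite_measureI) (metis emeasure_N ennreal_neq_top infinity_ennreal_def space_N stone_set_simps(2))

lemma measure_N: "measure N (stone_set C) = \<Lambda> (indicator C)"
  using emeasure_N[of C] nonneg[OF indicator_mem, of C] by (simp add: measure_def)

lemma finite_range_integral:
  fixes G :: "'b \<Rightarrow> real" and \<phi> :: "real \<Rightarrow> real"
  assumes fin: "finite (range G)"
  defines "h \<equiv> \<lambda>w. \<Sum>v\<in>range G. \<phi> v * indicator (stone_set {b. G b = v}) w"
  shows "integrable N h" "integral\<^sup>L N h = \<Lambda> (\<lambda>b. \<phi> (G b))"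
    "\<And>w v. w \<in> boolean_homs \<Longrightarrow> w {b. G b = v} \<Longrightarrow> h w = \<phi> v"
proof -
  interpret finite_measure N by (rule finite_measure_N)
  have ind: "integrable N (\<lambda>w. \<phi> v * indicator (stone_set C) w)" for v C
    using sets_N emeasure_N by (intro integrable_mult_right) (auto simp: integrable_indicator_iff)
  thus "integrable N h" unfolding h_def by (intro Bochner_Integration.integrable_sum)
  let ?s = "\<lambda>b. \<Sum>v\<in>range G. \<phi> v * indicator {b. G b = v} b"
  have "integral\<^sup>L N h = (\<Sum>v\<in>range G. \<phi> v * measure N (stone_set {b. G b = v}))"
    unfolding h_def using ind sets_N by (subst Bochner_Integration.integral_sum) simp_all
  also have "... = (\<Sum>v\<in>range G. \<Lambda> (\<lambda>b. \<phi> v * indicator {b. G b = v} b))"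
    by (simp add: measure_N scale(2)[OF indicator_mem])
  also have "... = \<Lambda> (\<lambda>b. ?s b)"
    by (rule sum_mem(2)[symmetric, OF fin scale(1)[OF indicator_mem]])
  also have "(\<lambda>b. ?s b) = (\<lambda>b. \<phi> (G b))"
  proof
    fix b
    have "(?s b) = (\<Sum>v\<in>range G. if G b = v then \<phi> v else 0)"
      by (intro sum.cong) (auto simp: indicator_def)
    thus "(?s b) = \<phi> (G b)" using fin by simp
  qed
  finally show "integral\<^sup>L N h = \<Lambda> (\<lambda>b. \<phi> (G b))" .
  fix w v assume w: "w \<in> boolean_homs" "w {b. G b = v}"
  obtain v' where v': "v' \<in> range G" "\<And>u. w {b. G b = u} \<longleftrightarrow> u = v'"
    using boolean_homs_finite_range[OF w(1) fin] by metis
  have "h w = (\<Sum>u\<in>range G. if u = v' then \<phi> u else 0)"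
    unfolding h_def by (intro sum.cong refl) (simp add: stone_set_def w v')
  thus "h w = \<phi> v" using fin v' w by simp
qed

text \<open>For unbounded F a finitely additive \<Lambda> could lose mass at infinity. Membership of
  F^2 in E excludes this: F is bounded along almost every ultrafilter, and the errors of truncation
  tend to 0 under \<Lambda>.\<close>

lemma ultrafilter_limit_integral:
  fixes F :: "'b \<Rightarrow> real"
  assumes F2: "(\<lambda>b. (F b)^2) \<in> E"
  shows "\<exists>h. integrable N h \<and> integral\<^sup>L N h = \<Lambda> F \<and> (AE w in N. (F \<longlongrightarrow> h w) (ultrafilter_of w))"
proof -
  interpret finite_measure N by (rule finite_measure_N)
  have oneF2: "(\<lambda>b. 1 + (F b)^2) \<in> E" by (rule add(1)[OF const_1 F2])
  have abs_le: "\<bar>y\<bar> \<le> 1 + y^2" for y :: real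
    using zero_le_power2[of "\<bar>y\<bar> - 1"] by (simp add: power2_diff)
  have FE: "F \<in> E" by (rule dominated[OF oneF2]) (use abs_le in \<open>smt (verit) zero_le_power2\<close>)
  have absFE: "(\<lambda>b. \<bar>F b\<bar> + 1) \<in> E" by (rule add(1)[OF dominated[OF FE] const_1]) simp
  \<comment> \<open>Rounding down to multiples of 1 / (k + 1) and cutting off beyond k + 1 leaves
    finitely many values. The cut-off error |y| is at most y^2 / (k + 1), as |y| exceeds k + 1
    there.\<close>
  define D where "D k y = (if \<bar>y\<bar> \<le> real k + 1 then of_int \<lfloor>(real k + 1) * y\<rfloor> / (real k + 1) else 0)" for k y
  have D_err: "\<bar>D k y - y\<bar> \<le> (1 + y^2) / (real k + 1)" for k y
  proof (cases "\<bar>y\<bar> \<le> real k + 1")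
    case True
    have "\<bar>of_int \<lfloor>(real k + 1) * y\<rfloor> - (real k + 1) * y\<bar> \<le> 1" by linarith
    moreover have "D k y - y = (of_int \<lfloor>(real k + 1) * y\<rfloor> - (real k + 1) * y) / (real k + 1)"
      using True by (simp add: D_def field_simps)
    ultimately have "\<bar>D k y - y\<bar> \<le> 1 / (real k + 1)" by (simp add: abs_divide divide_right_mono)
    also have "... \<le> (1 + y^2) / (real k + 1)" by (intro divide_right_mono) simp_all
    finally show ?thesis .
  next
    case False
    hence "\<bar>y\<bar> * (real k + 1) \<le> \<bar>y\<bar> * \<bar>y\<bar>" by (intro mult_left_mono) auto
    hence "\<bar>y\<bar> \<le> (1 + y^2) / (real k + 1)" by (simp add: pos_le_divide_eq power2_eq_square)
    thus ?thesis using False by (simp add: D_def)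
  qed
  have D_abs: "\<bar>D k y\<bar> \<le> \<bar>y\<bar> + 1" for k y
  proof -
    have "\<bar>of_int \<lfloor>(real k + 1) * y\<rfloor>\<bar> \<le> (real k + 1) * (\<bar>y\<bar> + 1)"
    proof -
      have "\<bar>of_int \<lfloor>z\<rfloor>\<bar> \<le> \<bar>z\<bar> + 1" for z :: real by linarith
      from this[of "(real k + 1) * y"]
      have "\<bar>of_int \<lfloor>(real k + 1) * y\<rfloor>\<bar> \<le> (real k + 1) * \<bar>y\<bar> + 1" by (simp only: abs_mult)
      thus ?thesis by (simp add: distrib_left)
    qed
    thus ?thesis by (simp add: D_def abs_divide divide_le_eq mult.commute)
  qed
  define G where "G k b = D k (F b)" for k b
  have fin: "finite (range (G k))" for k
  proof (rule finite_subset)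
    let ?I = "{- int ((k + 1) * (k + 1)) .. int ((k + 1) * (k + 1))}" and ?d = "\<lambda>i. of_int i / (real k + 1)"
    show "range (G k) \<subseteq> insert 0 (?d ` ?I)"
    proof
      fix v assume "v \<in> range (G k)"
      then obtain b where v: "v = D k (F b)" by (auto simp: G_def)
      show "v \<in> insert 0 (?d ` ?I)"
      proof (cases "\<bar>F b\<bar> \<le> real k + 1")
        case True
        hence "\<bar>(real k + 1) * F b\<bar> \<le> (real k + 1) * (real k + 1)" by (simp add: abs_mult mult_left_mono)
        hence "\<lfloor>(real k + 1) * F b\<rfloor> \<in> ?I"
          by (simp add: abs_le_iff le_floor_iff floor_le_iff algebra_simps)
        thus ?thesis using True v by (auto simp: D_def)
      qed (simp add: v D_def)
    qed
  qed simp
  define g where "g k w = (\<Sum>v\<in>range (G k). v * indicator (stone_set {b. G k b = v}) w)" for k w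
  note g = finite_range_integral[OF fin, where \<phi> = "\<lambda>v. v", folded g_def]
  have GE: "G k \<in> E" for k
    by (rule dominated[OF absFE]) (use D_abs[of k] in \<open>simp add: G_def\<close>)
  have g_val: "\<exists>v. g k w = v \<and> w {b. G k b = v}" if "w \<in> boolean_homs" for k w
    using boolean_homs_finite_range[OF that fin, of k] g(3)[OF that] by metis
  have meet: "\<exists>b. P b \<and> G k b = g k w" if w: "w \<in> boolean_homs" and P: "eventually P (ultrafilter_of w)" for w k P
  proof -
    have "w ({b. P b} \<inter> {b. G k b = g k w})"
      using g_val[OF w, of k] P boolean_homsD(1)[OF w] by (auto simp: eventually_ultrafilter_of[OF w])
    hence "{b. P b} \<inter> {b. G k b = g k w} \<noteq> {}" using boolean_homsD(3)[OF w] by metis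
    thus ?thesis by blast
  qed
  define h where "h w = lim (\<lambda>k. g k w)" for w
  have lim: "(\<lambda>k. g k w) \<longlonglongrightarrow> r" and bound: "\<bar>g k w\<bar> \<le> \<bar>r\<bar> + 2"
    if w: "w \<in> boolean_homs" and r: "(F \<longlongrightarrow> r) (ultrafilter_of w)" for w r k
  proof -
    have near: "eventually (\<lambda>b. \<bar>F b - r\<bar> < d) (ultrafilter_of w)" if "0 < d" for d
      using tendstoD[OF r that] by (simp add: dist_real_def)
    let ?e = "\<lambda>k. (2 + (\<bar>r\<bar> + 1)^2) / (real k + 1)"
    have err: "\<bar>g k w - r\<bar> \<le> ?e k" for k
    proof -
      obtain b where b: "\<bar>F b - r\<bar> < 1 / (real k + 1)" "G k b = g k w"
        using meet[OF w near, of "1 / (real k + 1)" k] by auto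
      have "1 / (real k + 1) \<le> 1" by simp
      hence "\<bar>F b\<bar> \<le> \<bar>r\<bar> + 1" using b(1) by linarith
      hence sq: "(F b)^2 \<le> (\<bar>r\<bar> + 1)^2" by (metis abs_ge_zero power2_abs power_mono)
      have "\<bar>g k w - r\<bar> \<le> (1 + (F b)^2) / (real k + 1) + 1 / (real k + 1)"
        using D_err[of k "F b"] b by (simp add: G_def)
      also have "... = (2 + (F b)^2) / (real k + 1)" by (simp add: add_divide_distrib[symmetric])
      also have "... \<le> ?e k" using sq by (intro divide_right_mono) simp_all
      finally show ?thesis .
    qed
    have "(\<lambda>k. ?e k) \<longlonglongrightarrow> 0" by real_asymp
    hence "(\<lambda>k. g k w - r) \<longlonglongrightarrow> 0" by (rule Lim_null_comparison[rotated]) (simp add: err)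
    thus "(\<lambda>k. g k w) \<longlonglongrightarrow> r" by (rule LIM_zero_cancel)
    obtain b where b: "\<bar>F b - r\<bar> < 1" "G k b = g k w" using meet[OF w near, of 1 k] by auto
    thus "\<bar>g k w\<bar> \<le> \<bar>r\<bar> + 2" using D_abs[of k "F b"] by (simp add: G_def)
  qed
  have hmeas[measurable]: "h \<in> borel_measurable N"
    unfolding h_def using g(1) by (intro borel_measurable_lim_metric) (simp add: borel_measurable_integrable)
  \<comment> \<open>A Chebyshev estimate: the set where |F| exceeds n + 1 has measure at most
    \<Lambda> (F^2) / (n + 1).\<close>
  have AE_bounded: "AE w in N. \<exists>n. w {b. \<bar>F b\<bar> \<le> real n}"
  proof -
    let ?i = "\<lambda>n. inverse (real (Suc n))" and ?m = "\<lambda>n. \<Lambda> (\<lambda>b. (F b)^2) * inverse (real (Suc n))"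
    define B where "B n = stone_set {b. \<not> \<bar>F b\<bar> \<le> real (Suc n)}" for n
    have Bset: "B n \<in> sets N" for n by (simp add: B_def sets_N)
    have Bm: "measure N (B n) \<le> ?m n" for n
    proof -
      have "\<Lambda> (indicator {b. \<not> \<bar>F b\<bar> \<le> real (Suc n)}) \<le> \<Lambda> (\<lambda>b. ?i n * (F b)^2)"
      proof (rule mono[OF indicator_mem scale(1)[OF F2]])
        fix b
        show "indicator {b. \<not> \<bar>F b\<bar> \<le> real (Suc n)} b \<le> ?i n * (F b)^2"
        proof (cases "\<bar>F b\<bar> \<le> real (Suc n)")
          case False
          hence "real (Suc n) * 1 \<le> \<bar>F b\<bar> * \<bar>F b\<bar>" by (intro mult_mono) auto
          hence "1 \<le> ?i n * (F b)^2" by (simp add: power2_eq_square field_simps)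
          thus ?thesis by (simp add: indicator_def)
        qed simp
      qed
      thus ?thesis using scale(2)[OF F2] by (simp add: B_def measure_N mult.commute)
    qed
    have "measure N (\<Inter>n. B n) \<le> ?m n" for n
      using Bset by (intro order_trans[OF finite_measure_mono Bm]) auto
    moreover have "(\<lambda>n. ?m n) \<longlonglongrightarrow> \<Lambda> (\<lambda>b. (F b)^2) * 0"
      by (intro tendsto_intros LIMSEQ_inverse_real_of_nat)
    ultimately have "measure N (\<Inter>n. B n) \<le> 0" by (intro LIMSEQ_le_const[of _ 0]) auto
    hence "emeasure N (\<Inter>n. B n) = 0"
      by (simp add: emeasure_eq_measure measure_nonneg order.antisym)
    moreover have "{w \<in> space N. \<not> (\<exists>n. w {b. \<bar>F b\<bar> \<le> real n})} \<subseteq> (\<Inter>n. B n)"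
    proof safe
      fix w n assume "w \<in> space N" "\<nexists>n. w {b. \<bar>F b\<bar> \<le> real n}"
      hence "w \<in> boolean_homs" "\<not> w {b. \<bar>F b\<bar> \<le> real (Suc n)}" by (simp_all add: space_N del: of_nat_Suc)
      thus "w \<in> B n" using boolean_homsD(2)[of w "{b. \<bar>F b\<bar> \<le> real (Suc n)}"]
        by (simp add: B_def stone_set_def Collect_neg_eq del: of_nat_Suc)
    qed
    moreover have "(\<Inter>n. B n) \<in> sets N" using Bset by blast
    ultimately show ?thesis by (intro AE_I[where N = "\<Inter>n. B n"]) auto
  qed
  have AE_lim: "AE w in N. (F \<longlongrightarrow> h w) (ultrafilter_of w) \<and> (\<lambda>k. g k w) \<longlonglongrightarrow> h w \<and> (\<forall>k. \<bar>g k w\<bar> \<le> \<bar>h w\<bar> + 2)"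
    using AE_bounded AE_space
  proof eventually_elim
    case (elim w)
    hence w: "w \<in> boolean_homs" by (simp add: space_N)
    then obtain r where r: "(F \<longlongrightarrow> r) (ultrafilter_of w)" using bounded_tendsto_ultrafilter elim by blast
    hence "h w = r" unfolding h_def using lim[OF w] by (intro limI)
    thus ?case using r lim[OF w r] bound[OF w r] by simp
  qed
  let ?A = "ennreal (\<Lambda> (\<lambda>b. \<bar>F b\<bar> + 1))"
  have int_abs: "(\<integral>\<^sup>+w. ennreal \<bar>g k w\<bar> \<partial>N) \<le> ?A" for k
  proof -
    define a where "a w = (\<Sum>v\<in>range (G k). \<bar>v\<bar> * indicator (stone_set {b. G k b = v}) w)" for w
    have a: "integrable N a" "integral\<^sup>L N a = \<Lambda> (\<lambda>b. \<bar>G k b\<bar>)"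
      using finite_range_integral[OF fin, where \<phi> = abs and k1 = k] unfolding a_def by simp_all
    have le: "\<bar>g k w\<bar> \<le> a w" for w
      unfolding g_def a_def by (rule order_trans[OF sum_abs]) (simp add: abs_mult)
    have "(\<integral>\<^sup>+w. ennreal \<bar>g k w\<bar> \<partial>N) \<le> (\<integral>\<^sup>+w. ennreal (a w) \<partial>N)"
      by (intro nn_integral_mono ennreal_leI le)
    also have "... = ennreal (integral\<^sup>L N a)"
      by (rule nn_integral_eq_integral[OF a(1)]) (use le in \<open>auto intro!: AE_I2 order_trans[OF abs_ge_zero]\<close>)
    also have "... \<le> ?A" unfolding a(2)
      by (intro ennreal_leI mono absFE dominated[OF GE[of k]]) (simp_all add: G_def D_abs)
    finally show ?thesis .
  qed
  have h_int: "integrable N h"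
  proof (rule integrableI_bounded[OF hmeas])
    have "(\<integral>\<^sup>+w. ennreal (norm (h w)) \<partial>N) = (\<integral>\<^sup>+w. liminf (\<lambda>k. ennreal \<bar>g k w\<bar>) \<partial>N)"
    proof (rule nn_integral_cong_AE)
      show "AE w in N. ennreal (norm (h w)) = liminf (\<lambda>k. ennreal \<bar>g k w\<bar>)" using AE_lim
      proof eventually_elim
        case (elim w)
        hence "(\<lambda>k. ennreal \<bar>g k w\<bar>) \<longlonglongrightarrow> ennreal \<bar>h w\<bar>"
          by (intro tendsto_ennrealI tendsto_rabs) simp
        from lim_imp_Liminf[OF _ this] show ?case by simp
      qed
    qed
    also have "... \<le> liminf (\<lambda>k. \<integral>\<^sup>+w. ennreal \<bar>g k w\<bar> \<partial>N)"
      using g(1) by (intro nn_integral_liminf) (simp add: borel_measurable_integrable)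
    also have "... \<le> liminf (\<lambda>_ :: nat. ?A)" by (intro Liminf_mono always_eventually allI int_abs)
    also have "... = ?A" by (simp add: Liminf_const)
    also have "... < \<infinity>" by simp
    finally show "(\<integral>\<^sup>+w. ennreal (norm (h w)) \<partial>N) < \<infinity>" .
  qed
  \<comment> \<open>Fatou's lemma has made h integrable, so |h| + 2 can serve as the dominating
    function.\<close>
  have "(\<lambda>k. integral\<^sup>L N (g k)) \<longlonglongrightarrow> integral\<^sup>L N h"
  proof (rule integral_dominated_convergence[where w = "\<lambda>w. \<bar>h w\<bar> + 2"])
    show "AE w in N. (\<lambda>k. g k w) \<longlonglongrightarrow> h w" using AE_lim by eventually_elim simp
    show "AE w in N. norm (g k w) \<le> \<bar>h w\<bar> + 2" for k using AE_lim by eventually_elim simp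
  qed (use h_int g(1) in \<open>auto simp: borel_measurable_integrable\<close>)
  moreover have "(\<lambda>k. integral\<^sup>L N (g k)) \<longlonglongrightarrow> \<Lambda> F"
  proof -
    let ?r = "\<lambda>k. inverse (real (Suc k))" and ?e = "\<lambda>k. \<Lambda> (\<lambda>b. 1 + (F b)^2) * inverse (real (Suc k))"
    have bd: "\<bar>\<Lambda> (G k) - \<Lambda> F\<bar> \<le> ?e k" for k
    proof -
      have "\<Lambda> (\<lambda>b. G k b - F b) \<le> \<Lambda> (\<lambda>b. ?r k * (1 + (F b)^2))"
        "\<Lambda> (\<lambda>b. F b - G k b) \<le> \<Lambda> (\<lambda>b. ?r k * (1 + (F b)^2))"
        by (intro mono diff(1) scale(1) GE FE oneF2;
            use D_err[of k] in \<open>simp add: G_def abs_le_iff divide_inverse mult.commute add.commute\<close>)+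
      thus ?thesis using diff(2)[OF GE FE, of k] diff(2)[OF FE GE, of k] scale(2)[OF oneF2]
        by (simp add: abs_le_iff mult.commute)
    qed
    have "(\<lambda>k. ?e k) \<longlonglongrightarrow> \<Lambda> (\<lambda>b. 1 + (F b)^2) * 0"
      by (intro tendsto_intros LIMSEQ_inverse_real_of_nat)
    hence lim0: "(\<lambda>k. ?e k) \<longlonglongrightarrow> 0" by (simp only: mult_zero_right)
    have "(\<lambda>k. \<Lambda> (G k) - \<Lambda> F) \<longlonglongrightarrow> 0"
      by (rule Lim_null_comparison[OF _ lim0]) (simp only: real_norm_def bd eventually_True)
    thus ?thesis unfolding g(2) by (rule LIM_zero_cancel)
  qed
  ultimately have "integral\<^sup>L N h = \<Lambda> F" by (rule LIMSEQ_unique)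
  thus ?thesis using h_int AE_lim by (intro exI[of _ h]) (auto elim: eventually_mono)
qed

end

end

section \<open>The moment problem in arbitrarily many variables\<close>

lemma tendsto_peval:
  fixes c :: "'v \<Rightarrow> real"
  assumes "\<And>v. v \<in> pvars e \<Longrightarrow> ((\<lambda>z. z v) \<longlongrightarrow> c v) F"
  shows "((\<lambda>z. peval z e) \<longlongrightarrow> peval c e) F"
  using assms by (induction e) (auto intro: tendsto_intros)

lemma borel_measurable_peval:
  fixes Z :: "'v \<Rightarrow> 'w \<Rightarrow> real"
  assumes "\<And>v. v \<in> pvars e \<Longrightarrow> Z v \<in> borel_measurable N"
  shows "(\<lambda>w. peval (\<lambda>v. Z v w) e) \<in> borel_measurable N" using assms by (induction e) auto

theorem Haviland:
  fixes L :: "'a::{comm_ring_1, real_algebra_1} \<Rightarrow> real"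
  assumes L: "linear L"
    and pos: "\<And>e. pvars e \<subseteq> S \<Longrightarrow> (\<And>z :: 'a \<Rightarrow> real. 0 \<le> peval z e) \<Longrightarrow> 0 \<le> L (peval id e)"
  shows "\<exists>(N :: (('a \<Rightarrow> real) set \<Rightarrow> bool) measure) Z. finite_measure N \<and>
    (\<forall>e. pvars e \<subseteq> S \<longrightarrow> integrable N (\<lambda>w. peval (\<lambda>s. Z s w) e) \<and>
       (\<integral>w. peval (\<lambda>s. Z s w) e \<partial>N) = L (peval id e))"
proof -
  define g where "g = {((\<lambda>z :: 'a \<Rightarrow> real. peval z e), L (peval id e)) | e. pvars e \<subseteq> S}"
  have gI: "((\<lambda>z. peval z e), L (peval id e)) \<in> g" if "pvars e \<subseteq> S" for e
    using that unfolding g_def by blast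
  have g: "positive_graph g" unfolding positive_graph_def
  proof (intro conjI allI impI)
    show "((\<lambda>_. 0), 0) \<in> g" using gI[of "PConst 0"] by (simp add: linear_0[OF L])
    fix f r h s c assume "(f, r) \<in> g" "(h, s) \<in> g"
    then obtain e e' where "pvars e \<subseteq> S" "f = (\<lambda>z. peval z e)" "r = L (peval id e)"
      "pvars e' \<subseteq> S" "h = (\<lambda>z. peval z e')" "s = L (peval id e')" unfolding g_def by blast
    thus "((\<lambda>x. f x + c * h x), r + c * s) \<in> g" using gI[of "PAdd e (PMul (PConst c) e')"]
      by (simp add: linear_add[OF L] linear_scale_of_real[OF L])
  next
    fix f r assume "(f, r) \<in> g" "\<forall>x. 0 \<le> f x"
    thus "0 \<le> r" unfolding g_def using pos by auto
  qed
  obtain \<Lambda> where \<Lambda>: "\<And>f r. (f, r) \<in> g \<Longrightarrow> \<Lambda> f = r"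
    and \<Lambda>_add: "\<And>f h c p s q t. (p, s) \<in> g \<Longrightarrow> (q, t) \<in> g \<Longrightarrow> (\<And>x. \<bar>f x\<bar> \<le> p x) \<Longrightarrow> (\<And>x. \<bar>h x\<bar> \<le> q x) \<Longrightarrow>
       \<Lambda> (\<lambda>x. f x + c * h x) = \<Lambda> f + c * \<Lambda> h"
    and \<Lambda>_nonneg: "\<And>f p s. (p, s) \<in> g \<Longrightarrow> (\<And>x. f x \<le> p x) \<Longrightarrow> (\<And>x. 0 \<le> f x) \<Longrightarrow> 0 \<le> \<Lambda> f"
    using Riesz_extension[OF g] by blast
  define E where "E = {f. \<exists>p s. (p, s) \<in> g \<and> (\<forall>x. \<bar>f x\<bar> \<le> p x)}"
  interpret expectation E \<Lambda>
  proof
    fix f h c assume "f \<in> E" "h \<in> E"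
    then obtain p s q t where pq: "(p, s) \<in> g" "(q, t) \<in> g" "\<And>x. \<bar>f x\<bar> \<le> p x" "\<And>x. \<bar>h x\<bar> \<le> q x"
      by (auto simp: E_def)
    thus "\<Lambda> (\<lambda>x. f x + c * h x) = \<Lambda> f + c * \<Lambda> h" by (rule \<Lambda>_add)
    have "\<bar>f x + c * h x\<bar> \<le> p x + \<bar>c\<bar> * q x" for x
    proof -
      have "\<bar>c * h x\<bar> \<le> \<bar>c\<bar> * q x" using pq(4)[of x] by (simp add: abs_mult mult_left_mono)
      thus ?thesis using pq(3)[of x] by linarith
    qed
    thus "(\<lambda>x. f x + c * h x) \<in> E"
      using positive_graphD(2)[OF g pq(1,2), of "\<bar>c\<bar>"] unfolding E_def by blast
  next
    fix f h :: "('a \<Rightarrow> real) \<Rightarrow> real" assume "f \<in> E" "\<And>x. \<bar>h x\<bar> \<le> \<bar>f x\<bar>"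
    thus "h \<in> E" unfolding E_def using order_trans by blast
  next
    have "((\<lambda>_. 1), L 1) \<in> g" using gI[of "PConst 1"] by simp
    thus "(\<lambda>_. 1) \<in> E" unfolding E_def by fastforce
  next
    fix f assume "f \<in> E" and nn: "\<And>x. 0 \<le> f x"
    then obtain p s where p: "(p, s) \<in> g" "\<And>x. \<bar>f x\<bar> \<le> p x" by (auto simp: E_def)
    have "f x \<le> p x" for x using p(2)[of x] by linarith
    thus "0 \<le> \<Lambda> f" using \<Lambda>_nonneg[OF p(1)] nn by blast
  qed
  obtain N where N: "space N = boolean_homs" "\<And>C. stone_set C \<in> sets N"
      "\<And>C. emeasure N (stone_set C) = ennreal (\<Lambda> (indicator C))"
    using stone_measure_exists by blast
  let ?P = "\<lambda>h e. integrable N h \<and> integral\<^sup>L N h = L (peval id e) \<and>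
      (AE w in N. ((\<lambda>z. peval z e) \<longlongrightarrow> h w) (ultrafilter_of w))"
  have "(\<lambda>z. (peval z e)^2) \<in> E" if "pvars e \<subseteq> S" for e
    using gI[of "PMul e e"] that unfolding E_def by (auto simp: power2_eq_square)
  hence ex: "\<exists>h. ?P h e" if "pvars e \<subseteq> S" for e
    using ultrafilter_limit_integral[OF N, of "\<lambda>z. peval z e"] that \<Lambda>[OF gI[OF that]] by simp
  define Z where "Z s = (SOME h. ?P h (PVar s))" for s
  have "?P (Z s) (PVar s)" if "s \<in> S" for s
    unfolding Z_def by (rule someI_ex[OF ex]) (use that in simp)
  hence Zm: "Z s \<in> borel_measurable N" and Zlim: "AE w in N. ((\<lambda>z. z s) \<longlongrightarrow> Z s w) (ultrafilter_of w)"
    if "s \<in> S" for s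
    using that by (auto simp: borel_measurable_integrable)
  show ?thesis
  proof (rule exI[of _ N], rule exI[of _ Z], intro conjI allI impI)
    show "finite_measure N" by (rule finite_measure_N[OF N])
    fix e :: "'a pexp" assume e: "pvars e \<subseteq> S"
    then obtain h where h: "integrable N h" "integral\<^sup>L N h = L (peval id e)"
      "AE w in N. ((\<lambda>z. peval z e) \<longlongrightarrow> h w) (ultrafilter_of w)" using ex by blast
    \<comment> \<open>Each Z v is a limit only up to a null set, but an expression has finitely many
      variables, so limits and \<open>peval\<close> commute almost everywhere even for uncountable
      S.\<close>
    have "AE w in N. \<forall>v\<in>pvars e. ((\<lambda>z. z v) \<longlongrightarrow> Z v w) (ultrafilter_of w)"
      using Zlim e by (intro AE_finite_allI) auto
    hence eq: "AE w in N. h w = peval (\<lambda>s. Z s w) e" using h(3) AE_space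
    proof eventually_elim
      case (elim w)
      hence "((\<lambda>z. peval z e) \<longlongrightarrow> peval (\<lambda>s. Z s w) e) (ultrafilter_of w)"
        by (intro tendsto_peval) blast
      thus ?case using elim ultrafilter_of_neq_bot[of w] N(1) by (metis tendsto_unique)
    qed
    have m: "(\<lambda>w. peval (\<lambda>s. Z s w) e) \<in> borel_measurable N"
      by (rule borel_measurable_peval) (use Zm e in auto)
    show "integrable N (\<lambda>w. peval (\<lambda>s. Z s w) e)"
      using h(1) eq m by (subst integrable_cong_AE[symmetric, OF _ m eq]) auto
    show "(\<integral>w. peval (\<lambda>s. Z s w) e \<partial>N) = L (peval id e)"
      using h(2) integral_cong_AE[OF _ m eq] h(1) by simp
  qed
qed

lemma linear_expression:
  fixes t :: "'a::{comm_ring_1, real_algebra_1}"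
  assumes "t \<in> span S"
  shows "\<exists>e. pvars e \<subseteq> S \<and> peval id e = t \<and> (\<forall>f :: 'a \<Rightarrow> real. linear f \<longrightarrow> peval f e = f t)"
  using assms
proof (induction rule: span_induct_alt)
  case base
  show ?case by (rule exI[of _ "PConst 0"]) (simp add: linear_0)
next
  case (step c s t)
  then obtain e where "pvars e \<subseteq> S" "peval id e = t" "\<forall>f :: 'a \<Rightarrow> real. linear f \<longrightarrow> peval f e = f t" by blast
  thus ?case using step(1) by (intro exI[of _ "PAdd (PMul (PConst c) (PVar s)) e"])
      (simp add: scaleR_conv_of_real[symmetric] linear_add linear_cmul id_def)
qed

text \<open>Moments are available for variables in \<open>S\<close>. Under linear assignments, an
  expression over the span takes the same values as a suitable one over \<open>S\<close>.\<close>

lemma expression_over_basis: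
  fixes e :: "'a::{comm_ring_1, real_algebra_1} pexp"
  assumes "pvars e \<subseteq> span S"
  shows "\<exists>e'. pvars e' \<subseteq> S \<and> peval id e' = peval id e \<and> (\<forall>f :: 'a \<Rightarrow> real. linear f \<longrightarrow> peval f e' = peval f e)"
  using assms
proof (induction e)
  case (PConst c)
  show ?case by (rule exI[of _ "PConst c"]) simp
next
  case (PVar t)
  thus ?case using linear_expression[of t S] by (simp add: id_def)
next
  case (PAdd e1 e2)
  then obtain e1' e2' where "pvars e1' \<subseteq> S \<and> peval id e1' = peval id e1 \<and> (\<forall>f :: 'a \<Rightarrow> real. linear f \<longrightarrow> peval f e1' = peval f e1)"
    "pvars e2' \<subseteq> S \<and> peval id e2' = peval id e2 \<and> (\<forall>f :: 'a \<Rightarrow> real. linear f \<longrightarrow> peval f e2' = peval f e2)" by (auto simp: id_def)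
  thus ?case by (intro exI[of _ "PAdd e1' e2'"]) (simp add: id_def)
next
  case (PMul e1 e2)
  then obtain e1' e2' where "pvars e1' \<subseteq> S \<and> peval id e1' = peval id e1 \<and> (\<forall>f :: 'a \<Rightarrow> real. linear f \<longrightarrow> peval f e1' = peval f e1)"
    "pvars e2' \<subseteq> S \<and> peval id e2' = peval id e2 \<and> (\<forall>f :: 'a \<Rightarrow> real. linear f \<longrightarrow> peval f e2' = peval f e2)" by (auto simp: id_def)
  thus ?case by (intro exI[of _ "PMul e1' e2'"]) (simp add: id_def)
qed

theorem random_linear_functional:
  fixes L :: "'a::{comm_ring_1, real_algebra_1} \<Rightarrow> real"
  assumes L: "linear L" and S: "independent S"
    and pos: "\<And>e. pvars e \<subseteq> S \<Longrightarrow> (\<And>z :: 'a \<Rightarrow> real. 0 \<le> peval z e) \<Longrightarrow> 0 \<le> L (peval id e)"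
  shows "\<exists>(N :: (('a \<Rightarrow> real) set \<Rightarrow> bool) measure) W. finite_measure N \<and> (\<forall>w. linear (\<lambda>t. W t w)) \<and>
    (\<forall>e. pvars e \<subseteq> span S \<longrightarrow> integrable N (\<lambda>w. peval (\<lambda>t. W t w) e) \<and>
       (\<integral>w. peval (\<lambda>t. W t w) e \<partial>N) = L (peval id e))"
proof -
  have "\<exists>(N :: (('a \<Rightarrow> real) set \<Rightarrow> bool) measure) Z. finite_measure N \<and>
    (\<forall>e. pvars e \<subseteq> S \<longrightarrow> integrable N (\<lambda>w. peval (\<lambda>s. Z s w) e) \<and>
       (\<integral>w. peval (\<lambda>s. Z s w) e \<partial>N) = L (peval id e))" by (rule Haviland[OF L]) (rule pos)
  then obtain N :: "(('a \<Rightarrow> real) set \<Rightarrow> bool) measure" and Z where N: "finite_measure N"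
    and Z: "\<forall>e. pvars e \<subseteq> S \<longrightarrow> integrable N (\<lambda>w. peval (\<lambda>s. Z s w) e) \<and>
       (\<integral>w. peval (\<lambda>s. Z s w) e \<partial>N) = L (peval id e)" by blast
  \<comment> \<open>Extension from the basis makes \<open>W\<close> linear at every w, without
    exceptional null sets.\<close>
  define W where "W t w = construct S (\<lambda>s. Z s w) t" for t w
  have lin: "linear (\<lambda>t. W t w)" for w
    unfolding W_def by (rule linear_construct[OF S])
  have "integrable N (\<lambda>w. peval (\<lambda>t. W t w) e) \<and> (\<integral>w. peval (\<lambda>t. W t w) e \<partial>N) = L (peval id e)"
    if e: "pvars e \<subseteq> span S" for e
  proof -
    obtain e' where e': "pvars e' \<subseteq> S" "peval id e' = peval id e"
      "\<And>f :: 'a \<Rightarrow> real. linear f \<Longrightarrow> peval f e' = peval f e"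
      using expression_over_basis[OF e] by blast
    have "peval (\<lambda>s. Z s w) e' = peval (\<lambda>t. W t w) e" for w
    proof -
      have "peval (\<lambda>s. Z s w) e' = peval (\<lambda>t. W t w) e'"
        by (rule peval_cong) (simp add: W_def construct_basis[OF S] subsetD[OF e'(1)])
      thus ?thesis using e'(3)[OF lin] by simp
    qed
    thus ?thesis using Z[rule_format, OF e'(1)] unfolding e'(2) by simp
  qed
  thus ?thesis using N lin by blast
qed

section \<open>Nuclear expansions and continuous versions\<close>

lemma seminorm_onD:
  assumes "seminorm_on T q"
  shows "x \<in> T \<Longrightarrow> 0 \<le> q x" "x \<in> T \<Longrightarrow> y \<in> T \<Longrightarrow> q (x + y) \<le> q x + q y"
    "x \<in> T \<Longrightarrow> q (c *\<^sub>R x) = \<bar>c\<bar> * q x" using assms by (auto simp: seminorm_on_def)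

lemma seminorm_on_diff:
  assumes "seminorm_on T q" "subspace T" "x \<in> T" "y \<in> T"
  shows "q (x - y) \<le> q x + q y"
  using seminorm_onD(2)[OF assms(1), of x "(- 1) *\<^sub>R y"] seminorm_onD(3)[OF assms(1), of y "- 1"] assms
  by (simp add: subspace_neg)

lemma seminorm_on_sum:
  assumes q: "seminorm_on T q" and T: "subspace T" and x: "\<And>i. i \<in> I \<Longrightarrow> x i \<in> T"
  shows "q (\<Sum>i\<in>I. x i) \<le> (\<Sum>i\<in>I. q (x i))" using x
proof (induction I rule: infinite_finite_induct)
  case (insert i I)
  hence "q (x i + (\<Sum>i\<in>I. x i)) \<le> q (x i) + q (\<Sum>i\<in>I. x i)"
    by (intro seminorm_onD(2)[OF q] subspace_sum[OF T]) auto
  thus ?case using insert by simp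
qed (use seminorm_onD(3)[OF q subspace_0[OF T], of 0] in simp_all)

lemma seminorm_Cauchy_convergent:
  assumes q: "seminorm_on T q" and T: "subspace T" and y: "\<And>k. y k \<in> T" "seminorm_Cauchy q y"
  shows "convergent (\<lambda>k. q (y k))"
proof -
  have "\<bar>q (y m) - q (y n)\<bar> \<le> q (y m - y n)" for m n
  proof -
    have "q (y m) \<le> q (y m - y n) + q (y n)" 
      using seminorm_onD(2)[OF q, of "y m - y n" "y n"] y T by (simp add: subspace_diff)
    moreover have "q (y n) \<le> q (y m - y n) + q (y m)"
      using seminorm_on_diff[OF q T, of "y m" "y m - y n"] y T by (simp add: subspace_diff)
    ultimately show ?thesis by linarith
  qed
  hence "Cauchy (\<lambda>k. q (y k))"
    using y(2) unfolding seminorm_Cauchy_def Cauchy_def dist_real_def by (meson le_less_trans)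
  thus ?thesis by (simp add: Cauchy_convergent_iff)
qed

text \<open>
  The vectors of the completion in a nuclear expansion are replaced by vectors of \<open>T\<close> itself, writing
  each of them as a telescoping series along a rapidly Cauchy subsequence.
\<close>
lemma nuclear_expansion:
  fixes T :: "'a::real_vector set"
  assumes T: "subspace T" and q: "seminorm_on T q" and q': "seminorm_on T q'"
    and nuc: "nuclear_canonical_map T q' q"
  shows "\<exists>(c :: nat \<Rightarrow> real) g y. (\<forall>i. 0 \<le> c i \<and> linear_functional_on T (g i) \<and> (\<forall>x\<in>T. \<bar>g i x\<bar> \<le> c i * q' x) \<and> y i \<in> T) \<and>
    summable (\<lambda>i. c i * q (y i)) \<and>
    (\<forall>x\<in>T. \<forall>\<epsilon>>0. \<forall>K. \<exists>F. finite F \<and> {..<K} \<subseteq> F \<and> q (x - (\<Sum>i\<in>F. g i x *\<^sub>R y i)) < \<epsilon>)"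
proof -
  obtain c :: "nat \<Rightarrow> real" and g :: "nat \<Rightarrow> 'a \<Rightarrow> real" and y :: "nat \<Rightarrow> nat \<Rightarrow> 'a" where
    g: "\<And>n. 0 \<le> c n" "\<And>n. linear_functional_on T (g n)" "\<And>n x. x \<in> T \<Longrightarrow> \<bar>g n x\<bar> \<le> c n * q' x"
    and y: "\<And>n k. y n k \<in> T" "\<And>n. seminorm_Cauchy q (y n)"
    and summ: "summable (\<lambda>n. c n * lim (\<lambda>k. q (y n k)))"
    and expand: "\<And>x. x \<in> T \<Longrightarrow> (\<lambda>N. lim (\<lambda>k. q (x - (\<Sum>n<N. g n x *\<^sub>R y n k)))) \<longlonglongrightarrow> 0"
    using nuc unfolding nuclear_canonical_map_def by blast
  \<comment> \<open>Chosen so that c n * \<delta> n j is at most 2^(-n-j); the summand 1 covers c n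
    = 0.\<close>
  define \<delta> where "\<delta> n j = (1/2) ^ n * (1/2) ^ j / (1 + c n)" for n j :: nat
  have \<delta>: "0 < \<delta> n j" for n j using g(1)[of n] by (simp add: \<delta>_def add_pos_nonneg)
  have c\<delta>: "c n * \<delta> n j \<le> (1/2) ^ n * (1/2) ^ j" for n j
  proof -
    have "c n * \<delta> n j = (c n / (1 + c n)) * ((1/2) ^ n * (1/2) ^ j)" by (simp add: \<delta>_def)
    also have "... \<le> 1 * ((1/2) ^ n * (1/2) ^ j)"
      using g(1)[of n] by (intro mult_right_mono) (simp_all add: divide_le_eq)
    finally show ?thesis by simp
  qed
  have "\<exists>K. \<forall>k\<ge>K. \<forall>l\<ge>K. q (y n k - y n l) < \<delta> n j" for n j
    using y(2)[of n] \<delta>[of n j] unfolding seminorm_Cauchy_def by blast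
  then obtain K where K: "\<And>n j k l. K n j \<le> k \<Longrightarrow> K n j \<le> l \<Longrightarrow> q (y n k - y n l) < \<delta> n j" by metis
  \<comment> \<open>The partial sum is an index beyond all K n i with i \<le> j.\<close>
  define \<kappa> where "\<kappa> n j = (\<Sum>i\<le>j. K n i)" for n j
  have \<kappa>: "K n j \<le> \<kappa> n i" if "j \<le> i" for n i j
    unfolding \<kappa>_def by (rule member_le_sum) (use that in auto)
  define z where "z n j = (case j of 0 \<Rightarrow> y n (\<kappa> n 0) | Suc i \<Rightarrow> y n (\<kappa> n (Suc i)) - y n (\<kappa> n i))" for n j
  have zT: "z n j \<in> T" for n j by (simp add: z_def y subspace_diff[OF T] split: nat.split)
  have tele: "(\<Sum>j\<le>J. z n j) = y n (\<kappa> n J)" for n J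
    by (induction J) (simp_all add: z_def)
  define \<tau> where "\<tau> n = lim (\<lambda>k. q (y n k))" for n
  have \<tau>: "(\<lambda>k. q (y n k)) \<longlonglongrightarrow> \<tau> n" for n
    unfolding \<tau>_def using seminorm_Cauchy_convergent[OF q T y] by (simp add: convergent_LIMSEQ_iff)
  have q0: "0 \<le> q x" if "x \<in> T" for x using seminorm_onD(1)[OF q that] .
  have \<tau>0: "0 \<le> \<tau> n" for n by (rule LIMSEQ_le_const[OF \<tau>]) (use q0 y in auto)
  have z_first: "q (z n 0) \<le> \<tau> n + \<delta> n 0" for n
  proof -
    have "q (z n 0) \<le> q (y n k) + \<delta> n 0" if "\<kappa> n 0 \<le> k" for k
      using K[of n 0 "\<kappa> n 0" k] \<kappa>[of 0 0 n] that
        seminorm_onD(2)[OF q, of "y n (\<kappa> n 0) - y n k" "y n k"] y(1) T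
      by (simp add: z_def subspace_diff)
    moreover have "(\<lambda>k. q (y n k) + \<delta> n 0) \<longlonglongrightarrow> \<tau> n + \<delta> n 0" by (intro tendsto_intros \<tau>)
    ultimately show ?thesis by (intro LIMSEQ_le_const) auto
  qed
  have z_Suc: "q (z n (Suc j)) \<le> \<delta> n j" for n j
    using K[of n j "\<kappa> n (Suc j)" "\<kappa> n j"] \<kappa>[of j j n] \<kappa>[of j "Suc j" n] by (simp add: z_def)
  \<comment> \<open>The constant 3 consists of 1 from the error in \<open>z_first\<close> and 2 from
    the geometric series over the later terms.\<close>
  have row: "(\<Sum>j<J. c n * q (z n j)) \<le> c n * \<tau> n + 3 * (1/2) ^ n" for n J
  proof -
    have "(\<Sum>j<J. c n * q (z n j)) \<le> (\<Sum>j<Suc J. c n * q (z n j))"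
      using g(1) q0[OF zT] by (simp add: mult_nonneg_nonneg)
    also have "... = c n * q (z n 0) + (\<Sum>j<J. c n * q (z n (Suc j)))"
      by (simp only: sum.lessThan_Suc_shift)
    also have "... \<le> c n * (\<tau> n + \<delta> n 0) + (\<Sum>j<J. c n * \<delta> n j)"
      by (intro add_mono sum_mono mult_left_mono z_first z_Suc g(1))
    also have "... \<le> (c n * \<tau> n + (1/2) ^ n) + (\<Sum>j<J. (1/2) ^ n * (1/2) ^ j)"
      using c\<delta>[of n 0] by (intro add_mono sum_mono c\<delta>) (simp add: distrib_left)
    also have "(\<Sum>j<J. (1/2) ^ n * (1/2::real) ^ j) \<le> (1/2) ^ n * 2"
    proof -
      have "(\<Sum>j<J. (1/2::real) ^ j) \<le> 2" by (simp add: sum_gp_strict)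
      thus ?thesis by (simp only: sum_distrib_left[symmetric] mult_left_mono zero_le_power zero_le_divide_1_iff zero_le_numeral)
    qed
    finally show ?thesis by simp
  qed
  let ?b = "\<lambda>n. c n * \<tau> n + 3 * (1/2) ^ n"
  have rows_summable: "summable ?b"
    using summ unfolding \<tau>_def by (intro summable_add summable_mult summable_geometric) simp_all
  define ix where "ix = (prod_decode :: nat \<Rightarrow> nat \<times> nat)"
  define c' where "c' i = c (fst (ix i))" for i
  define g' where "g' i = g (fst (ix i))" for i
  define y' where "y' i = z (fst (ix i)) (snd (ix i))" for i
  have inj: "inj ix" by (simp add: ix_def inj_prod_decode)
  have box: "\<exists>m. ix ` {..<K} \<subseteq> {..<m} \<times> {..<m}" for K
  proof -
    define m where "m = Suc (\<Sum>i<K. fst (ix i) + snd (ix i))"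
    have lt: "fst (ix i) + snd (ix i) < m" if "i < K" for i
      unfolding m_def by (rule le_imp_less_Suc, rule member_le_sum) (use that in auto)
    have "ix ` {..<K} \<subseteq> {..<m} \<times> {..<m}"
    proof
      fix p assume "p \<in> ix ` {..<K}"
      then obtain i where "i < K" "p = ix i" by blast
      thus "p \<in> {..<m} \<times> {..<m}" using lt[of i] by (simp add: mem_Times_iff)
    qed
    thus ?thesis ..
  qed
  have summ': "summable (\<lambda>i. c' i * q (y' i))"
  proof (rule summableI_nonneg_bounded)
    show "0 \<le> c' i * q (y' i)" for i
      using g(1) q0[OF zT] by (simp add: c'_def y'_def)
    fix K
    obtain m where m: "ix ` {..<K} \<subseteq> {..<m} \<times> {..<m}" using box by blast
    have "(\<Sum>i<K. c' i * q (y' i)) = (\<Sum>p\<in>ix ` {..<K}. c (fst p) * q (z (fst p) (snd p)))"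
      by (subst sum.reindex) (simp_all add: c'_def y'_def inj_on_subset[OF inj])
    also have "... \<le> (\<Sum>p\<in>{..<m} \<times> {..<m}. c (fst p) * q (z (fst p) (snd p)))"
      by (rule sum_mono2) (use m g(1) q0[OF zT] in auto)
    also have "... = (\<Sum>n<m. \<Sum>j<m. c n * q (z n j))"
      by (simp add: sum.cartesian_product case_prod_beta)
    also have "... \<le> (\<Sum>n<m. c n * \<tau> n + 3 * (1/2) ^ n)" by (intro sum_mono row)
    also have "... \<le> suminf ?b"
      by (rule sum_le_suminf[OF rows_summable]) (use g(1) \<tau>0 in \<open>auto intro!: add_nonneg_nonneg\<close>)
    finally show "(\<Sum>i<K. c' i * q (y' i)) \<le> suminf ?b" .
  qed
  let ?s = "\<lambda>x F. \<Sum>i\<in>F. g' i x *\<^sub>R y' i"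
  \<comment> \<open>The finite sets are rectangles of index pairs, so that each row telescopes to
    the single vector \<open>y n (\<kappa> n J)\<close>; an initial segment of the enumeration would
    cut the rows at different places.\<close>
  have approx: "\<exists>F. finite F \<and> {..<K0} \<subseteq> F \<and> q (x - ?s x F) < \<epsilon>"
    if x: "x \<in> T" and \<epsilon>: "0 < \<epsilon>" for x \<epsilon> K0
  proof -
    obtain m where m: "ix ` {..<K0} \<subseteq> {..<m} \<times> {..<m}" using box by blast
    define r where "r N k = x - (\<Sum>n<N. g n x *\<^sub>R y n k)" for N k
    have rT: "r N k \<in> T" for N k
      unfolding r_def using x y(1) by (intro subspace_diff[OF T] subspace_sum[OF T] subspace_scale[OF T])
    have Cauchy_r: "seminorm_Cauchy q (r N)" for N
      unfolding seminorm_Cauchy_def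
    proof (intro allI impI)
      fix e :: real assume "0 < e"
      define d where "d = e / (1 + (\<Sum>n<N. \<bar>g n x\<bar>))"
      have den: "0 < 1 + (\<Sum>n<N. \<bar>g n x\<bar>)" by (simp add: add_pos_nonneg sum_nonneg)
      hence "0 < d" using \<open>0 < e\<close> by (simp add: d_def)
      hence "\<forall>n. \<exists>M. \<forall>k\<ge>M. \<forall>l\<ge>M. q (y n k - y n l) < d"
        using y(2) unfolding seminorm_Cauchy_def by blast
      then obtain M where M: "\<And>n k l. M n \<le> k \<Longrightarrow> M n \<le> l \<Longrightarrow> q (y n k - y n l) < d" by metis
      show "\<exists>M. \<forall>k\<ge>M. \<forall>l\<ge>M. q (r N k - r N l) < e"
      proof (intro exI[of _ "\<Sum>n<N. M n"] allI impI)
        fix k l assume kl: "(\<Sum>n<N. M n) \<le> k" "(\<Sum>n<N. M n) \<le> l"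
        have "r N k - r N l = (\<Sum>n<N. g n x *\<^sub>R (y n l - y n k))"
          by (simp add: r_def scaleR_diff_right sum_subtractf)
        hence "q (r N k - r N l) \<le> (\<Sum>n<N. q (g n x *\<^sub>R (y n l - y n k)))"
          using seminorm_on_sum[OF q T, of "{..<N}" "\<lambda>n. g n x *\<^sub>R (y n l - y n k)"] y(1)
          by (simp add: subspace_scale[OF T] subspace_diff[OF T])
        also have "... = (\<Sum>n<N. \<bar>g n x\<bar> * q (y n l - y n k))"
          using y(1) by (simp add: seminorm_onD(3)[OF q] subspace_diff[OF T])
        also have "... \<le> (\<Sum>n<N. \<bar>g n x\<bar> * d)"
        proof (intro sum_mono mult_left_mono)
          fix n assume "n \<in> {..<N}"
          hence "M n \<le> (\<Sum>n<N. M n)" by (intro member_le_sum) auto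
          thus "q (y n l - y n k) \<le> d" using M[of n l k] kl by simp
        qed simp
        also have "... < (1 + (\<Sum>n<N. \<bar>g n x\<bar>)) * d"
          using \<open>0 < d\<close> by (simp add: sum_distrib_right distrib_right)
        also have "... = e" using den by (simp add: d_def)
        finally show "q (r N k - r N l) < e" .
      qed
    qed
    have "eventually (\<lambda>N. lim (\<lambda>k. q (r N k)) < \<epsilon> / 2) sequentially"
      using expand[OF x] \<epsilon> unfolding r_def by (intro order_tendstoD(2)) auto
    then obtain N0 where N0: "\<And>N. N0 \<le> N \<Longrightarrow> lim (\<lambda>k. q (r N k)) < \<epsilon> / 2"
      by (auto simp: eventually_sequentially)
    define N where "N = max N0 m"
    have "(\<lambda>k. q (r N k)) \<longlonglongrightarrow> lim (\<lambda>k. q (r N k))"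
      using seminorm_Cauchy_convergent[OF q T rT Cauchy_r] by (simp add: convergent_LIMSEQ_iff)
    hence "eventually (\<lambda>k. q (r N k) < \<epsilon> / 2) sequentially"
      by (rule order_tendstoD(2)) (use N0[of N] in \<open>simp add: N_def\<close>)
    then obtain k0 where k0: "\<And>k. k0 \<le> k \<Longrightarrow> q (r N k) < \<epsilon> / 2"
      by (auto simp: eventually_sequentially)
    have "(\<lambda>J. \<Sum>n<N. \<bar>g n x\<bar> * \<delta> n J) \<longlonglongrightarrow> (\<Sum>n<N. \<bar>g n x\<bar> * ((1/2) ^ n * 0 / (1 + c n)))"
      unfolding \<delta>_def using g(1) by (intro tendsto_intros LIMSEQ_power_zero) (auto simp: add_nonneg_eq_0_iff)
    hence "eventually (\<lambda>J. (\<Sum>n<N. \<bar>g n x\<bar> * \<delta> n J) < \<epsilon> / 2) sequentially"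
      by (rule order_tendstoD(2)) (use \<epsilon> in simp)
    then obtain J0 where J0: "\<And>J. J0 \<le> J \<Longrightarrow> (\<Sum>n<N. \<bar>g n x\<bar> * \<delta> n J) < \<epsilon> / 2"
      by (auto simp: eventually_sequentially)
    define J where "J = max J0 m"
    define F where "F = prod_encode ` ({..<N} \<times> {..J})"
    have inj': "inj_on prod_encode ({..<N} \<times> {..J})" by (rule inj_prod_encode)
    have "?s x F = (\<Sum>p\<in>{..<N} \<times> {..J}. g (fst p) x *\<^sub>R z (fst p) (snd p))"
      unfolding F_def by (subst sum.reindex) (simp_all add: g'_def y'_def ix_def inj')
    also have "... = (\<Sum>n<N. \<Sum>j\<le>J. g n x *\<^sub>R z n j)"
      by (simp add: sum.cartesian_product case_prod_beta)
    also have "... = (\<Sum>n<N. g n x *\<^sub>R y n (\<kappa> n J))"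
      by (simp only: scaleR_sum_right[symmetric] tele)
    finally have F_sum: "?s x F = (\<Sum>n<N. g n x *\<^sub>R y n (\<kappa> n J))" .
    define k where "k = k0 + (\<Sum>n<N. \<kappa> n J)"
    \<comment> \<open>The error splits into the remainder of the given expansion at a late index k
      and the differences y n k - \<open>y n (\<kappa> n J)\<close>, bounded by \<delta> n J because
      k lies beyond every \<kappa> n J with n < N.\<close>
    have "x - ?s x F = r N k + (\<Sum>n<N. g n x *\<^sub>R (y n k - y n (\<kappa> n J)))"
      by (simp add: F_sum r_def scaleR_diff_right sum_subtractf)
    also have "q ... \<le> q (r N k) + q (\<Sum>n<N. g n x *\<^sub>R (y n k - y n (\<kappa> n J)))"
      using y(1) by (intro seminorm_onD(2)[OF q] rT subspace_sum[OF T] subspace_scale[OF T] subspace_diff[OF T])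
    also have "q (\<Sum>n<N. g n x *\<^sub>R (y n k - y n (\<kappa> n J))) \<le> (\<Sum>n<N. q (g n x *\<^sub>R (y n k - y n (\<kappa> n J))))"
      using y(1) by (intro seminorm_on_sum[OF q T] subspace_scale[OF T] subspace_diff[OF T])
    also have "... = (\<Sum>n<N. \<bar>g n x\<bar> * q (y n k - y n (\<kappa> n J)))"
      using y(1) by (simp add: seminorm_onD(3)[OF q] subspace_diff[OF T])
    also have "... \<le> (\<Sum>n<N. \<bar>g n x\<bar> * \<delta> n J)"
    proof (intro sum_mono mult_left_mono)
      fix n assume "n \<in> {..<N}"
      hence "\<kappa> n J \<le> (\<Sum>n<N. \<kappa> n J)" by (intro member_le_sum) auto
      thus "q (y n k - y n (\<kappa> n J)) \<le> \<delta> n J"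
        using K[of n J k "\<kappa> n J"] \<kappa>[of J J n] by (simp add: k_def)
    qed simp
    finally have "q (x - ?s x F) < \<epsilon>" using k0[of k] J0[of J] by (simp add: k_def J_def)
    moreover have "{..<K0} \<subseteq> F"
    proof
      fix i assume "i \<in> {..<K0}"
      hence "ix i \<in> {..<m} \<times> {..<m}" using m by blast
      hence "ix i \<in> {..<N} \<times> {..J}" by (auto simp: mem_Times_iff N_def J_def)
      hence "prod_encode (ix i) \<in> F" unfolding F_def by (rule imageI)
      thus "i \<in> F" by (simp add: ix_def)
    qed
    ultimately show ?thesis by (intro exI[of _ F]) (simp add: F_def)
  qed
  have "0 \<le> c' i \<and> linear_functional_on T (g' i) \<and> (\<forall>x\<in>T. \<bar>g' i x\<bar> \<le> c' i * q' x) \<and> y' i \<in> T" for i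
    using g zT by (simp add: c'_def g'_def y'_def)
  with summ' approx show ?thesis by (intro exI[of _ c'] exI[of _ g'] exI[of _ y']) blast
qed

lemma linear_functional_onD:
  assumes "linear_functional_on T l"
  shows "x \<in> T \<Longrightarrow> y \<in> T \<Longrightarrow> l (x + y) = l x + l y" "x \<in> T \<Longrightarrow> l (c *\<^sub>R x) = c * l x"
  using assms by (auto simp: linear_functional_on_def)

lemma linear_functional_on_sum:
  assumes l: "linear_functional_on T l" and T: "subspace T" and x: "\<And>i. i \<in> I \<Longrightarrow> x i \<in> T"
  shows "l (\<Sum>i\<in>I. a i *\<^sub>R x i) = (\<Sum>i\<in>I. a i * l (x i))" using x
proof (induction I rule: infinite_finite_induct)
  case (insert i I)
  hence "l (a i *\<^sub>R x i + (\<Sum>i\<in>I. a i *\<^sub>R x i)) = l (a i *\<^sub>R x i) + l (\<Sum>i\<in>I. a i *\<^sub>R x i)"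
    by (intro linear_functional_onD(1)[OF l] subspace_sum[OF T] subspace_scale[OF T]) auto
  thus ?case using insert by (simp add: linear_functional_onD(2)[OF l])
qed (use linear_functional_onD(2)[OF l subspace_0[OF T], of 0] in simp_all)

section \<open>Continuous versions of a random linear functional\<close>

text \<open>Every term missed by F has index at least K. This suits finite sets that contain an
  initial segment without being one.\<close>

lemma suminf_minus_finite_bound:
  fixes a :: "nat \<Rightarrow> real"
  assumes a: "summable (\<lambda>i. \<bar>a i\<bar>)" and F: "finite F" "{..<K} \<subseteq> F"
  shows "\<bar>suminf a - sum a F\<bar> \<le> suminf (\<lambda>i. \<bar>a (i + K)\<bar>)"
proof -
  define b where "b i = (if i \<in> F then 0 else a i)" for i
  have "(\<lambda>i. a i - (if i \<in> F then a i else 0)) sums (suminf a - sum a F)"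
    by (intro sums_diff summable_sums summable_rabs_cancel[OF a] sums_If_finite_set F)
  also have "(\<lambda>i. a i - (if i \<in> F then a i else 0)) = b" by (auto simp: b_def)
  finally have b: "b sums (suminf a - sum a F)" .
  have bs: "summable (\<lambda>i. \<bar>b i\<bar>)" by (rule summable_comparison_test'[OF a]) (simp add: b_def)
  have "\<bar>suminf b\<bar> \<le> suminf (\<lambda>i. \<bar>b i\<bar>)" by (rule summable_rabs[OF bs])
  also have "... = suminf (\<lambda>i. \<bar>b (i + K)\<bar>)"
    using suminf_split_initial_segment[OF bs, of K] F(2) by (simp add: b_def subset_eq)
  also have "... \<le> suminf (\<lambda>i. \<bar>a (i + K)\<bar>)"
    using a bs by (intro suminf_le) (simp_all add: b_def summable_iff_shift[of "\<lambda>i. \<bar>a i\<bar>"] summable_iff_shift[of "\<lambda>i. \<bar>b i\<bar>", unfolded b_def])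
  finally show ?thesis using sums_unique[OF b] by simp
qed

lemma regular_version:
  fixes W :: "'a::real_vector \<Rightarrow> 'w \<Rightarrow> real"
  assumes T: "subspace T" and q: "seminorm_on T q" and q': "seminorm_on T q'"
    and nuc: "nuclear_canonical_map T q' q"
    and lin: "\<And>w. linear_functional_on T (\<lambda>t. W t w)"
    and meas: "\<And>t. t \<in> T \<Longrightarrow> W t \<in> borel_measurable N"
    and bound: "\<And>t. t \<in> T \<Longrightarrow> (\<integral>\<^sup>+w. ennreal \<bar>W t w\<bar> \<partial>N) \<le> ennreal (K * q t)" and K: "0 \<le> K"
  shows "\<exists>\<Psi>. (\<forall>w. \<Psi> w \<in> extensional T \<and> linear_functional_on T (\<Psi> w) \<and> (\<exists>C. \<forall>x\<in>T. \<bar>\<Psi> w x\<bar> \<le> C * q' x)) \<and>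
    (\<forall>x\<in>T. (\<lambda>w. \<Psi> w x) \<in> borel_measurable N \<and> (AE w in N. \<Psi> w x = W x w))"
proof -
  obtain c :: "nat \<Rightarrow> real" and g y where
    cgy: "\<forall>i. 0 \<le> c i \<and> linear_functional_on T (g i) \<and> (\<forall>x\<in>T. \<bar>g i x\<bar> \<le> c i * q' x) \<and> y i \<in> T"
    and summ: "summable (\<lambda>i. c i * q (y i))"
    and approx: "\<forall>x\<in>T. \<forall>\<epsilon>>0. \<forall>n. \<exists>F. finite F \<and> {..<n} \<subseteq> F \<and> q (x - (\<Sum>i\<in>F. g i x *\<^sub>R y i)) < \<epsilon>"
    using nuclear_expansion[OF T q q' nuc] by (elim exE conjE)
  have c: "0 \<le> c i" and g: "linear_functional_on T (g i)" "x \<in> T \<Longrightarrow> \<bar>g i x\<bar> \<le> c i * q' x"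
    and y: "y i \<in> T" for i x
    using cgy by simp_all
  have Wm[measurable]: "W (y i) \<in> borel_measurable N" for i by (rule meas[OF y])
  have q0: "0 \<le> q (y i)" for i using seminorm_onD(1)[OF q y] .
  have q'0: "0 \<le> q' x" if "x \<in> T" for x using seminorm_onD(1)[OF q' that] .
  let ?R = "\<lambda>i n w. c (i + n) * \<bar>W (y (i + n)) w\<bar>" and ?Q = "\<lambda>i n. c (i + n) * q (y (i + n))"
  \<comment> \<open>\<open>R 0\<close> is a random constant bounding the new functional uniformly in
    x; \<open>R n\<close> controls what a finite sum containing the first n terms misses.\<close>
  define R where "R n w = suminf (\<lambda>i. ennreal (?R i n w))" for n w
  have Rm[measurable]: "R n \<in> borel_measurable N" for n unfolding R_def by measurable
  have summ_n: "summable (\<lambda>i. ?Q i n)" for n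
    using summ by (simp add: summable_iff_shift[of "\<lambda>i. c i * q (y i)"])
  have R_int: "(\<integral>\<^sup>+w. R n w \<partial>N) \<le> ennreal (K * suminf (\<lambda>i. ?Q i n))" for n
  proof -
    have "(\<integral>\<^sup>+w. R n w \<partial>N) = suminf (\<lambda>i. \<integral>\<^sup>+w. ennreal (?R i n w) \<partial>N)"
      unfolding R_def by (rule nn_integral_suminf) measurable
    also have "... \<le> suminf (\<lambda>i. ennreal (K * (?Q i n)))"
    proof (intro suminf_le summableI)
      fix i
      have "(\<integral>\<^sup>+w. ennreal (?R i n w) \<partial>N) =
          ennreal (c (i + n)) * (\<integral>\<^sup>+w. ennreal \<bar>W (y (i + n)) w\<bar> \<partial>N)"
        using c by (simp add: ennreal_mult nn_integral_cmult)
      also have "... \<le> ennreal (c (i + n)) * ennreal (K * q (y (i + n)))"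
        by (intro mult_left_mono bound y) simp
      also have "... = ennreal (K * (?Q i n))"
        using c K q0 by (simp add: ennreal_mult[symmetric] mult.left_commute)
      finally show "(\<integral>\<^sup>+w. ennreal (?R i n w) \<partial>N) \<le> ennreal (K * (?Q i n))" .
    qed
    also have "... = ennreal (suminf (\<lambda>i. K * (?Q i n)))"
      using c K q0 summ_n by (intro suminf_ennreal2 summable_mult) auto
    also have "... = ennreal (K * suminf (\<lambda>i. ?Q i n))" by (simp add: suminf_mult[OF summ_n])
    finally show ?thesis .
  qed
  let ?S = "\<lambda>w x. suminf (\<lambda>i. g i x * W (y i) w)" and ?c = "\<lambda>w i. c i * \<bar>W (y i) w\<bar>"
  have good: "summable (?c w)" if "R 0 w \<noteq> \<infinity>" for w
    using that c unfolding R_def by (intro summable_suminf_not_top) auto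
  have term_le: "\<bar>g i x * W (y i) w\<bar> \<le> q' x * (?c w i)" if "x \<in> T" for i x w
    using mult_right_mono[OF g(2)[OF that, of i], of "\<bar>W (y i) w\<bar>"] by (simp add: abs_mult mult_ac)
  have abs_sum: "summable (\<lambda>i. \<bar>g i x * W (y i) w\<bar>)" if "R 0 w \<noteq> \<infinity>" "x \<in> T" for w x
    by (rule summable_comparison_test'[OF summable_mult[OF good[OF that(1)], of "q' x"]])
      (use term_le[OF that(2)] in simp)
  \<comment> \<open>The zero functional on the exceptional null set makes linearity and the bound by
    q' hold for every w.\<close>
  define \<Psi> where "\<Psi> w = (\<lambda>x\<in>T. if R 0 w \<noteq> \<infinity> then ?S w x else 0)" for w
  have \<Psi>_eq: "\<Psi> w x = (if R 0 w \<noteq> \<infinity> then ?S w x else 0)" if "x \<in> T" for w x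
    using that by (simp add: \<Psi>_def)
  have 1: "\<Psi> w \<in> extensional T" for w by (simp add: \<Psi>_def)
  have 2: "linear_functional_on T (\<Psi> w)" for w
    unfolding linear_functional_on_def
  proof (intro conjI ballI allI)
    fix x z assume xz: "x \<in> T" "z \<in> T"
    hence "x + z \<in> T" by (rule subspace_add[OF T])
    thus "\<Psi> w (x + z) = \<Psi> w x + \<Psi> w z"
      using xz suminf_add[OF summable_rabs_cancel[OF abs_sum[OF _ xz(1)]] summable_rabs_cancel[OF abs_sum[OF _ xz(2)]], of w]
      by (simp add: \<Psi>_eq linear_functional_onD(1)[OF g(1)] distrib_right)
  next
    fix r x assume x: "x \<in> T"
    hence "r *\<^sub>R x \<in> T" by (rule subspace_scale[OF T])
    thus "\<Psi> w (r *\<^sub>R x) = r * \<Psi> w x"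
      using x suminf_mult[OF summable_rabs_cancel[OF abs_sum[OF _ x]], of w r]
      by (simp add: \<Psi>_eq linear_functional_onD(2)[OF g(1)] mult.assoc)
  qed
  have 3: "\<exists>C. \<forall>x\<in>T. \<bar>\<Psi> w x\<bar> \<le> C * q' x" for w
  proof (cases "R 0 w = \<infinity>")
    case True
    thus ?thesis by (intro exI[of _ 0]) (simp add: \<Psi>_eq)
  next
    case False
    have "\<bar>\<Psi> w x\<bar> \<le> suminf (?c w) * q' x" if x: "x \<in> T" for x
    proof -
      have "\<bar>\<Psi> w x\<bar> \<le> suminf (\<lambda>i. \<bar>g i x * W (y i) w\<bar>)"
        using False summable_rabs[OF abs_sum[OF False x]] by (simp add: \<Psi>_eq[OF x])
      also have "... \<le> suminf (\<lambda>i. q' x * (?c w i))"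
        by (intro suminf_le term_le x abs_sum False summable_mult good)
      also have "... = suminf (?c w) * q' x"
        by (simp add: suminf_mult[OF good[OF False]] mult.commute)
      finally show ?thesis .
    qed
    thus ?thesis by blast
  qed
  have 4: "(\<lambda>w. \<Psi> w x) \<in> borel_measurable N" if "x \<in> T" for x
    unfolding \<Psi>_eq[OF that] by measurable
  have 5: "AE w in N. \<Psi> w x = W x w" if x: "x \<in> T" for x
  proof -
    have [measurable]: "W x \<in> borel_measurable N" "(\<lambda>w. \<Psi> w x) \<in> borel_measurable N"
      using meas 4 x by auto
    have "(\<integral>\<^sup>+w. R 0 w \<partial>N) \<noteq> \<infinity>" using R_int[of 0] by (auto simp: top_unique)
    hence AE_good: "AE w in N. R 0 w \<noteq> \<infinity>" by (intro nn_integral_PInf_AE) auto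
    let ?d = "\<lambda>w. ennreal \<bar>\<Psi> w x - W x w\<bar>"
    \<comment> \<open>The difference of the two versions at x is bounded by |W z| for the residual
      z, where q z < \<epsilon>, plus q' x times the tail R n. Both have small expectation.\<close>
    have small: "(\<integral>\<^sup>+w. ?d w \<partial>N) \<le> ennreal ((K + q' x * K) * \<epsilon>)" if \<epsilon>: "0 < \<epsilon>" for \<epsilon>
    proof -
      obtain n where n: "\<bar>suminf (\<lambda>i. ?Q i n)\<bar> < \<epsilon>" using suminf_exist_split[OF \<epsilon> summ] by auto
      obtain F where F: "finite F" "{..<n} \<subseteq> F" "q (x - (\<Sum>i\<in>F. g i x *\<^sub>R y i)) < \<epsilon>"
        using approx x \<epsilon> by blast
      define z where "z = x - (\<Sum>i\<in>F. g i x *\<^sub>R y i)"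
      have sT: "(\<Sum>i\<in>F. g i x *\<^sub>R y i) \<in> T" by (intro subspace_sum[OF T] subspace_scale[OF T] y)
      hence zT: "z \<in> T" using x by (simp add: z_def subspace_diff[OF T])
      have [measurable]: "W z \<in> borel_measurable N" using meas zT by auto
      have Wz: "W z w = W x w - (\<Sum>i\<in>F. g i x * W (y i) w)" for w
      proof -
        have "W x w = W z w + W (\<Sum>i\<in>F. g i x *\<^sub>R y i) w"
          using linear_functional_onD(1)[OF lin[of w] zT sT] by (simp add: z_def)
        thus ?thesis using linear_functional_on_sum[OF lin[of w] T, of F y "\<lambda>i. g i x"] y by simp
      qed
      have "(\<integral>\<^sup>+w. ?d w \<partial>N) \<le> (\<integral>\<^sup>+w. ennreal \<bar>W z w\<bar> + ennreal (q' x) * R n w \<partial>N)"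
      proof (rule nn_integral_mono_AE)
        show "AE w in N. ?d w \<le> ennreal \<bar>W z w\<bar> + ennreal (q' x) * R n w" using AE_good
        proof eventually_elim
          case (elim w)
          let ?a = "\<lambda>i. g i x * W (y i) w"
          have gs: "summable (\<lambda>i. ?R i n w)"
            using good[OF elim] by (simp add: summable_iff_shift[of "\<lambda>i. ?c w i"])
          have "\<bar>\<Psi> w x - sum ?a F\<bar> \<le> suminf (\<lambda>i. \<bar>?a (i + n)\<bar>)"
            using suminf_minus_finite_bound[OF abs_sum[OF elim x] F(1,2)] elim by (simp add: \<Psi>_eq[OF x])
          also have "... \<le> suminf (\<lambda>i. q' x * (?R i n w))" using abs_sum[OF elim x]
            by (intro suminf_le term_le x summable_mult gs) (simp add: summable_iff_shift[of "\<lambda>i. \<bar>?a i\<bar>"])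
          also have "... = q' x * suminf (\<lambda>i. ?R i n w)" by (rule suminf_mult[OF gs])
          finally have "\<bar>\<Psi> w x - W x w\<bar> \<le> \<bar>W z w\<bar> + q' x * suminf (\<lambda>i. ?R i n w)"
            unfolding Wz by linarith
          moreover have "R n w = ennreal (suminf (\<lambda>i. ?R i n w))"
            unfolding R_def using c gs by (intro suminf_ennreal2) auto
          moreover have "0 \<le> suminf (\<lambda>i. ?R i n w)" using c by (intro suminf_nonneg gs) simp
          ultimately show ?case
            using q'0[OF x] by (simp add: ennreal_mult[symmetric] ennreal_plus[symmetric] ennreal_leI del: ennreal_plus)
        qed
      qed
      also have "... = (\<integral>\<^sup>+w. ennreal \<bar>W z w\<bar> \<partial>N) + ennreal (q' x) * (\<integral>\<^sup>+w. R n w \<partial>N)"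
        by (simp add: nn_integral_add nn_integral_cmult)
      also have "... \<le> ennreal (K * q z) + ennreal (q' x) * ennreal (K * suminf (\<lambda>i. ?Q i n))"
        by (intro add_mono mult_left_mono bound zT R_int) simp
      also have "... \<le> ennreal (K * \<epsilon>) + ennreal (q' x) * ennreal (K * \<epsilon>)"
        using F(3) n K by (intro add_mono mult_left_mono ennreal_leI) (simp_all add: z_def)
      also have "... = ennreal ((K + q' x * K) * \<epsilon>)"
        using K q'0[OF x] \<epsilon> by (simp add: ennreal_mult[symmetric] ennreal_plus[symmetric] algebra_simps del: ennreal_plus)
      finally show ?thesis .
    qed
    have "(\<lambda>n. ennreal ((K + q' x * K) * inverse (real (Suc n)))) \<longlonglongrightarrow> ennreal ((K + q' x * K) * 0)"
      by (intro tendsto_ennrealI tendsto_intros LIMSEQ_inverse_real_of_nat)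
    hence "(\<integral>\<^sup>+w. ?d w \<partial>N) \<le> ennreal ((K + q' x * K) * 0)"
      by (rule LIMSEQ_le_const) (intro exI[of _ 0] allI impI small, simp)
    hence "(\<integral>\<^sup>+w. ?d w \<partial>N) = 0" by simp
    hence "AE w in N. ?d w = 0" by (subst (asm) nn_integral_0_iff_AE) auto
    thus ?thesis by eventually_elim simp
  qed
  show ?thesis using 1 2 3 4 5 by blast
qed

lemma continuous_map_bounded_functional:
  assumes X: "locally_convex_space X" and l: "linear_functional_on (topspace X) l"
    and p: "continuous_seminorm X p" and le: "\<And>x. x \<in> topspace X \<Longrightarrow> \<bar>l x\<bar> \<le> C * p x"
  shows "continuous_map X euclideanreal l" unfolding continuous_map_def
proof (intro conjI allI impI)
  show "l \<in> topspace X \<rightarrow> topspace euclideanreal" by simp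
  fix U :: "real set" assume "openin euclideanreal U"
  hence U: "open U" by simp
  have T: "subspace (topspace X)" and add: "continuous_map (prod_topology X X) X (\<lambda>(x, y). x + y)"
    using X by (auto simp: locally_convex_space_def)
  show "openin X {x \<in> topspace X. l x \<in> U}"
  proof (subst openin_subopen, intro ballI)
    fix x0 assume "x0 \<in> {x \<in> topspace X. l x \<in> U}"
    hence x0: "x0 \<in> topspace X" "l x0 \<in> U" by auto
    obtain e where e: "0 < e" "ball (l x0) e \<subseteq> U" using U x0(2) open_contains_ball by blast
    \<comment> \<open>The denominator is positive for every real C.\<close>
    define V where "V = {x \<in> topspace X. p (x + (- x0)) \<in> {..< e / (\<bar>C\<bar> + 1)}}"
    have "- x0 \<in> topspace X" using x0 T by (simp add: subspace_neg)
    hence "continuous_map X (prod_topology X X) (\<lambda>x. (x, - x0))"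
      by (intro continuous_map_pairedI) simp_all
    hence "continuous_map X X ((\<lambda>(x, y). x + y) \<circ> (\<lambda>x. (x, - x0)))"
      by (rule continuous_map_compose[OF _ add])
    hence "continuous_map X euclideanreal (p \<circ> ((\<lambda>(x, y). x + y) \<circ> (\<lambda>x. (x, - x0))))"
      by (rule continuous_map_compose) (use p in \<open>simp add: continuous_seminorm_def\<close>)
    from openin_continuous_map_preimage[OF this, of "{..< e / (\<bar>C\<bar> + 1)}"]
    have "openin X V" by (simp add: V_def)
    moreover have "x0 \<in> V"
      using x0 e(1) p seminorm_onD(3)[of "topspace X" p x0 0] by (simp add: V_def continuous_seminorm_def)
    moreover have "V \<subseteq> {x \<in> topspace X. l x \<in> U}"
    proof
      fix x assume "x \<in> V"
      hence x: "x \<in> topspace X" "p (x - x0) < e / (\<bar>C\<bar> + 1)" by (simp_all add: V_def)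
      have d: "x - x0 \<in> topspace X" using x x0 T by (simp add: subspace_diff)
      have p0: "0 \<le> p (x - x0)" using p d by (simp add: continuous_seminorm_def seminorm_on_def)
      have "l x = l x0 + l (x - x0)" using linear_functional_onD(1)[OF l x0(1) d] by simp
      hence "\<bar>l x - l x0\<bar> \<le> C * p (x - x0)" using le[OF d] by simp
      also have "... \<le> (\<bar>C\<bar> + 1) * p (x - x0)" using p0 by (intro mult_right_mono) auto
      also have "... < e" using x(2) by (simp add: field_simps add_pos_nonneg)
      finally have "l x \<in> ball (l x0) e" by (simp add: dist_real_def abs_minus_commute)
      thus "x \<in> {x \<in> topspace X. l x \<in> U}" using x e by blast
    qed
    ultimately show "\<exists>V. openin X V \<and> x0 \<in> V \<and> V \<subseteq> {x \<in> topspace X. l x \<in> U}" by blast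
  qed
qed

section \<open>Cylinder sets\<close>

lemma zero_in_continuous_dual:
  assumes "locally_convex_space X"
  shows "(\<lambda>x\<in>topspace X. 0) \<in> continuous_dual X"
proof -
  have T: "subspace (topspace X)" using assms by (simp add: locally_convex_space_def)
  have "continuous_map X euclideanreal (\<lambda>x\<in>topspace X. 0)"
    by (rule continuous_map_eq[of _ _ "\<lambda>_. 0"]) simp_all
  thus ?thesis
    by (simp add: continuous_dual_def linear_functional_on_def subspace_add[OF T] subspace_scale[OF T])
qed

text \<open>The annihilator contains 0, so cosets are nonempty, and \<open>the_elem\<close> in the
  quotient topology returns the common value on the coset.\<close>

lemma dual_coset_eval:
  assumes "locally_convex_space X" "f \<in> F" "F \<subseteq> topspace X"
  shows "(\<lambda>m. m f) ` dual_coset X F l = {l f}"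
proof -
  have "(\<lambda>x\<in>topspace X. 0) \<in> annihilator X F"
    using zero_in_continuous_dual[OF assms(1)] assms(3) by (auto simp: annihilator_def)
  hence "annihilator X F \<noteq> {}" by blast
  moreover have "(restrict (\<lambda>t. l t + m t) (topspace X)) f = l f" if "m \<in> annihilator X F" for m
    using that assms by (auto simp: annihilator_def)
  ultimately show ?thesis
    unfolding dual_coset_def image_image by (simp cong: image_cong_simp) auto
qed

lemma cylinder_sets_Pow: "cylinder_sets X \<subseteq> Pow (continuous_dual X)"
  by (auto simp: cylinder_sets_def)

lemma space_cylinder_algebra: "space (cylinder_algebra X) = continuous_dual X"
  by (simp add: cylinder_algebra_def space_measure_of[OF cylinder_sets_Pow])

lemma sets_cylinder_algebra: "sets (cylinder_algebra X) = sigma_sets (continuous_dual X) (cylinder_sets X)"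
  by (simp add: cylinder_algebra_def sets_measure_of[OF cylinder_sets_Pow])

text \<open>Evaluation at t is read off the quotient by the annihilator of \<open>span {t}\<close>,
  so preimages of open sets are themselves cylinder sets.\<close>

lemma measurable_evaluation:
  assumes X: "locally_convex_space X" and t: "t \<in> topspace X"
  shows "(\<lambda>\<phi>. \<phi> t) \<in> borel_measurable (cylinder_algebra X)"
proof (rule borel_measurableI)
  fix U :: "real set" assume U: "open U"
  have T: "subspace (topspace X)" using X by (simp add: locally_convex_space_def)
  define F where "F = span {t}"
  have tF: "t \<in> F" by (simp add: F_def span_base)
  have FT: "F \<subseteq> topspace X" unfolding F_def using t by (intro span_minimal T) simp
  define V where "V = {h \<in> topspace (product_topology (\<lambda>_. euclideanreal) F). h t \<in> U}"
  define M where "M = (\<lambda>C. \<lambda>f\<in>F. the_elem ((\<lambda>l. l f) ` C)) -` V \<inter> dual_quotient X F"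
  have "openin (product_topology (\<lambda>_. euclideanreal) F) V" unfolding V_def using U tF
    by (intro openin_continuous_map_preimage[OF continuous_map_product_projection]) auto
  hence "openin (dual_quotient_topology X F) M"
    unfolding dual_quotient_topology_def openin_pullback_topology M_def by blast
  hence "M \<in> dual_quotient_borel X F"
    unfolding dual_quotient_borel_def by (intro sigma_sets.Basic) simp
  hence "{l \<in> continuous_dual X. dual_coset X F l \<in> M} \<in> cylinder_sets X"
    unfolding cylinder_sets_def using FT
    by (intro CollectI exI[of _ F] exI[of _ M]) (auto simp: F_def intro: exI[of _ "{t}"])
  moreover have "dual_coset X F l \<in> M \<longleftrightarrow> l t \<in> U" if "l \<in> continuous_dual X" for l
  proof -
    have "dual_coset X F l \<in> dual_quotient X F" using that by (simp add: dual_quotient_def)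
    thus ?thesis using tF dual_coset_eval[OF X tF FT, of l] by (simp add: M_def V_def)
  qed
  ultimately have "{l \<in> continuous_dual X. l t \<in> U} \<in> cylinder_sets X"
    by (metis (mono_tags, lifting) Collect_cong)
  moreover have "(\<lambda>\<phi>. \<phi> t) -` U \<inter> space (cylinder_algebra X) = {l \<in> continuous_dual X. l t \<in> U}"
    by (auto simp: space_cylinder_algebra)
  ultimately show "(\<lambda>\<phi>. \<phi> t) -` U \<inter> space (cylinder_algebra X) \<in> sets (cylinder_algebra X)"
    by (simp add: sets_cylinder_algebra sigma_sets.Basic)
qed

text \<open>
  A functional restricted to a finite-dimensional space \<open>F\<close> is a continuous function of its values on a
  finite spanning set, which keeps the open sets of the uncountable product over \<open>F\<close> measurable.
\<close>
lemma measurable_dual_coset: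
  assumes X: "locally_convex_space X" and \<Psi>: "\<And>w. w \<in> space N \<Longrightarrow> \<Psi> w \<in> continuous_dual X"
    and meas: "\<And>t. t \<in> topspace X \<Longrightarrow> (\<lambda>w. \<Psi> w t) \<in> borel_measurable N"
    and F: "F \<subseteq> topspace X" and B: "finite B" "span B = F"
  shows "(\<lambda>w. dual_coset X F (\<Psi> w)) \<in>
    measurable N (sigma (dual_quotient X F) {U. openin (dual_quotient_topology X F) U})"
  (is "?\<kappa> \<in> _")
proof (rule measurable_measure_of)
  show "{U. openin (dual_quotient_topology X F) U} \<subseteq> Pow (dual_quotient X F)"
    by (auto simp: dual_quotient_topology_def openin_pullback_topology)
  show "?\<kappa> \<in> space N \<rightarrow> dual_quotient X F" using \<Psi> by (auto simp: dual_quotient_def)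
  fix U assume "U \<in> {U. openin (dual_quotient_topology X F) U}"
  then obtain V where V: "openin (product_topology (\<lambda>_. euclideanreal) F) V"
    and U: "U = (\<lambda>C. \<lambda>f\<in>F. the_elem ((\<lambda>l. l f) ` C)) -` V \<inter> dual_quotient X F"
    by (auto simp: dual_quotient_topology_def openin_pullback_topology)
  have T: "subspace (topspace X)" using X by (simp add: locally_convex_space_def)
  have BF: "b \<in> topspace X" if "b \<in> B" for b using that F B span_base by blast
  obtain e n where e: "bij_betw e {..<n::nat} B"
    using ex_bij_betw_nat_finite[OF B(1)] by (auto simp: atLeast0LessThan)
  have "\<exists>u. f = (\<Sum>b\<in>B. u b *\<^sub>R b)" if "f \<in> F" for f
    using that B(2) span_finite[OF B(1)] by auto
  then obtain a where a: "\<And>f. f \<in> F \<Longrightarrow> f = (\<Sum>b\<in>B. a f b *\<^sub>R b)" by metis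
  define h where "h u = (\<lambda>f\<in>F. \<Sum>i<n. a f (e i) * u i)" for u :: "nat \<Rightarrow> real"
  have "continuous_map euclidean (product_topology (\<lambda>_. euclideanreal) F) h"
    unfolding continuous_map_componentwise
  proof (intro conjI ballI)
    show "h ` topspace euclidean \<subseteq> extensional F" by (auto simp: h_def)
    fix f assume "f \<in> F"
    hence "(\<lambda>u. h u f) = (\<lambda>u. \<Sum>i<n. a f (e i) * u i)" by (simp add: h_def)
    thus "continuous_map euclidean euclideanreal (\<lambda>u. h u f)" by (simp add: continuous_intros)
  qed
  from openin_continuous_map_preimage[OF this V] have hV: "open {u. h u \<in> V}" by simp
  \<comment> \<open>Padding with zeros yields sequences, for which coordinatewise measurability
    gives Borel measurability.\<close>
  define Y where "Y w i = (if i < n then \<Psi> w (e i) else 0)" for w i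
  have "(\<lambda>w. Y w i) \<in> borel_measurable N" for i
    unfolding Y_def using meas BF bij_betwE[OF e] by (cases "i < n") auto
  hence Y: "Y \<in> borel_measurable N" by (rule measurable_coordinatewise_then_product)
  have "?\<kappa> -` U \<inter> space N = Y -` {u. h u \<in> V} \<inter> space N"
  proof -
    have "dual_coset X F (\<Psi> w) \<in> U \<longleftrightarrow> h (Y w) \<in> V" if w: "w \<in> space N" for w
    proof -
      have l: "linear_functional_on (topspace X) (\<Psi> w)" using \<Psi>[OF w] by (simp add: continuous_dual_def)
      have "h (Y w) f = \<Psi> w f" if f: "f \<in> F" for f
      proof -
        have "\<Psi> w f = (\<Sum>b\<in>B. a f b * \<Psi> w b)"
          using linear_functional_on_sum[OF l T, of B "\<lambda>b. b" "a f"] BF a[OF f] by simp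
        also have "... = (\<Sum>i<n. a f (e i) * \<Psi> w (e i))"
          by (rule sum.reindex_bij_betw[OF e, symmetric])
        finally show ?thesis using f by (simp add: h_def Y_def)
      qed
      hence "(\<lambda>f\<in>F. the_elem ((\<lambda>l. l f) ` dual_coset X F (\<Psi> w))) = h (Y w)"
        using dual_coset_eval[OF X _ F, of _ "\<Psi> w"] by (auto simp: fun_eq_iff h_def)
      moreover have "dual_coset X F (\<Psi> w) \<in> dual_quotient X F" using \<Psi>[OF w] by (simp add: dual_quotient_def)
      ultimately show ?thesis by (simp add: U)
    qed
    thus ?thesis by auto
  qed
  also have "... \<in> sets N" using Y hV by (intro measurable_sets[OF Y]) auto
  finally show "?\<kappa> -` U \<inter> space N \<in> sets N" .
qed

lemma measurable_cylinder_algebra: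
  assumes X: "locally_convex_space X" and \<Psi>: "\<And>w. w \<in> space N \<Longrightarrow> \<Psi> w \<in> continuous_dual X"
    and meas: "\<And>t. t \<in> topspace X \<Longrightarrow> (\<lambda>w. \<Psi> w t) \<in> borel_measurable N"
  shows "\<Psi> \<in> measurable N (cylinder_algebra X)" unfolding cylinder_algebra_def
proof (rule measurable_measure_of[OF cylinder_sets_Pow])
  show "\<Psi> \<in> space N \<rightarrow> continuous_dual X" using \<Psi> by blast
  fix C assume "C \<in> cylinder_sets X"
  then obtain F B M where C: "C = {l \<in> continuous_dual X. dual_coset X F l \<in> M}"
    and F: "F \<subseteq> topspace X" "finite B" "span B = F" and M: "M \<in> dual_quotient_borel X F"
    unfolding cylinder_sets_def by blast
  have "{U. openin (dual_quotient_topology X F) U} \<subseteq> Pow (dual_quotient X F)"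
    by (auto simp: dual_quotient_topology_def openin_pullback_topology)
  hence "M \<in> sets (sigma (dual_quotient X F) {U. openin (dual_quotient_topology X F) U})"
    using M by (simp add: dual_quotient_borel_def sets_measure_of)
  from measurable_sets[OF measurable_dual_coset[OF X \<Psi> meas F] this]
  have "(\<lambda>w. dual_coset X F (\<Psi> w)) -` M \<inter> space N \<in> sets N" by simp
  also have "(\<lambda>w. dual_coset X F (\<Psi> w)) -` M \<inter> space N = \<Psi> -` C \<inter> space N"
    using \<Psi> by (auto simp: C)
  finally show "\<Psi> -` C \<inter> space N \<in> sets N" .
qed

section \<open>Polynomials in elements of T, and the representing measure\<close>

text \<open>Couples an element of the algebra with a polynomial function through one common
  expression; the closure rules below then spare the explicit construction of expressions.\<close>

definition expressible :: "'a::{comm_ring_1, real_algebra_1} set \<Rightarrow> 'a \<Rightarrow> (('a \<Rightarrow> real) \<Rightarrow> real) \<Rightarrow> bool" where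
  "expressible T a f \<longleftrightarrow> (\<exists>e. pvars e \<subseteq> T \<and> peval id e = a \<and> (\<forall>\<rho> :: 'a \<Rightarrow> real. peval \<rho> e = f \<rho>))"

lemma expressible_const: "expressible T (of_real c) (\<lambda>_. c)"
  unfolding expressible_def by (rule exI[of _ "PConst c"]) simp

lemma expressible_var: "t \<in> T \<Longrightarrow> expressible T t (\<lambda>\<rho>. \<rho> t)"
  unfolding expressible_def by (rule exI[of _ "PVar t"]) simp

lemma expressible_add:
  assumes "expressible T a f" "expressible T b h"
  shows "expressible T (a + b) (\<lambda>\<rho>. f \<rho> + h \<rho>)"
proof -
  obtain e e' where "pvars e \<subseteq> T" "peval id e = a" "\<forall>\<rho> :: 'a \<Rightarrow> real. peval \<rho> e = f \<rho>"
    "pvars e' \<subseteq> T" "peval id e' = b" "\<forall>\<rho> :: 'a \<Rightarrow> real. peval \<rho> e' = h \<rho>"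
    using assms unfolding expressible_def by blast
  thus ?thesis unfolding expressible_def by (intro exI[of _ "PAdd e e'"]) (simp add: id_def)
qed

lemma expressible_mult:
  assumes "expressible T a f" "expressible T b h"
  shows "expressible T (a * b) (\<lambda>\<rho>. f \<rho> * h \<rho>)"
proof -
  obtain e e' where "pvars e \<subseteq> T" "peval id e = a" "\<forall>\<rho> :: 'a \<Rightarrow> real. peval \<rho> e = f \<rho>"
    "pvars e' \<subseteq> T" "peval id e' = b" "\<forall>\<rho> :: 'a \<Rightarrow> real. peval \<rho> e' = h \<rho>"
    using assms unfolding expressible_def by blast
  thus ?thesis unfolding expressible_def by (intro exI[of _ "PMul e e'"]) (simp add: id_def)
qed

lemma expressible_power: "expressible T a f \<Longrightarrow> expressible T (a ^ n) (\<lambda>\<rho>. f \<rho> ^ n)"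
  using expressible_const[of T 1] by (induction n) (auto intro: expressible_mult)

lemma expressible_prod:
  "(\<And>i. i \<in> I \<Longrightarrow> expressible T (a i) (f i)) \<Longrightarrow> expressible T (\<Prod>i\<in>I. a i) (\<lambda>\<rho>. \<Prod>i\<in>I. f i \<rho>)"
  using expressible_const[of T 1]
  by (induction I rule: infinite_finite_induct) (auto intro: expressible_mult)

lemma expressible_sum:
  "(\<And>i. i \<in> I \<Longrightarrow> expressible T (a i) (f i)) \<Longrightarrow> expressible T (\<Sum>i\<in>I. a i) (\<lambda>\<rho>. \<Sum>i\<in>I. f i \<rho>)"
  using expressible_const[of T 0]
  by (induction I rule: infinite_finite_induct) (auto intro: expressible_add)

lemma expressible_mpoly:
  assumes "\<And>i. i \<in> mpoly_vars p \<Longrightarrow> t i \<in> T"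
  shows "expressible T (mpoly_eval p t) (\<lambda>\<rho>. mpoly_eval p (\<lambda>i. \<rho> (t i)))"
  unfolding mpoly_eval_def scaleR_conv_of_real of_real_eq_id id_apply
  by (intro expressible_sum expressible_mult expressible_const expressible_prod expressible_power expressible_var assms)
    (auto simp: mpoly_vars_def)

lemma generated_expressible:
  fixes T :: "'a::{comm_ring_1, real_algebra_1} set"
  assumes "generates_algebra (T \<union> {1})"
  shows "\<exists>f. expressible T a f"
proof -
  define B where "B = {a. \<exists>f. expressible T a f}"
  have "subspace B" unfolding subspace_def B_def
    using expressible_const[of T 0] expressible_add[of T] expressible_mult[of T, OF expressible_const]
    by (auto simp: scaleR_conv_of_real) blast+
  moreover have "\<forall>x\<in>B. \<forall>y\<in>B. x * y \<in> B" unfolding B_def using expressible_mult[of T] by blast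
  moreover have "T \<union> {1} \<subseteq> B"
    unfolding B_def using expressible_var[of _ T] expressible_const[of T 1] by auto
  ultimately have "(\<lambda>B. subspace B \<and> (\<forall>x\<in>B. \<forall>y\<in>B. x * y \<in> B)) hull (T \<union> {1}) \<subseteq> B"
    by (intro hull_minimal) auto
  thus ?thesis using assms by (auto simp: generates_algebra_def B_def)
qed

text \<open>From |f| <= (f^2 / r + r) / 2 the bound becomes linear in r, as
  \<open>regular_version\<close> requires with r the value of a seminorm. For r = 0 the function
  vanishes almost everywhere.\<close>

lemma absolute_moment_bound:
  assumes N: "finite_measure N" and f: "f \<in> borel_measurable N" and f2: "integrable N (\<lambda>w. (f w)^2)"
    and le: "(\<integral>w. (f w)^2 \<partial>N) \<le> r^2" and r: "0 \<le> r"
  shows "(\<integral>\<^sup>+w. ennreal \<bar>f w\<bar> \<partial>N) \<le> ennreal ((1 + measure N (space N)) / 2 * r)"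
proof (cases "r = 0")
  case True
  hence "(\<integral>w. (f w)^2 \<partial>N) = 0" using le by (intro order.antisym) simp_all
  hence "AE w in N. (f w)^2 = 0" using f2 by (subst (asm) integral_nonneg_eq_0_iff_AE) auto
  hence "AE w in N. ennreal \<bar>f w\<bar> = 0" by eventually_elim simp
  hence "(\<integral>\<^sup>+w. ennreal \<bar>f w\<bar> \<partial>N) = 0" using f by (subst nn_integral_0_iff_AE) auto
  thus ?thesis by simp
next
  case False
  hence r: "0 < r" using r by simp
  interpret finite_measure N by (rule N)
  have am: "\<bar>f w\<bar> \<le> ((f w)^2 / r + r) / 2" for w
  proof -
    have "0 \<le> (\<bar>f w\<bar> - r)^2" by simp
    thus ?thesis using r by (simp add: power2_diff field_simps power2_eq_square)
  qed
  have int: "integrable N (\<lambda>w. ((f w)^2 / r + r) / 2)" using f2 by simp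
  have "(\<integral>\<^sup>+w. ennreal \<bar>f w\<bar> \<partial>N) \<le> (\<integral>\<^sup>+w. ennreal (((f w)^2 / r + r) / 2) \<partial>N)"
    by (intro nn_integral_mono ennreal_leI am)
  also have "... = ennreal (\<integral>w. ((f w)^2 / r + r) / 2 \<partial>N)"
    using r by (intro nn_integral_eq_integral int AE_I2) simp
  also have "(\<integral>w. ((f w)^2 / r + r) / 2 \<partial>N) = ((\<integral>w. (f w)^2 \<partial>N) / r + r * measure N (space N)) / 2"
    using f2 by simp
  also have "... \<le> (r^2 / r + r * measure N (space N)) / 2"
    using le r by (intro divide_right_mono add_right_mono) auto
  also have "... = (1 + measure N (space N)) / 2 * r"
    using r by (simp add: power2_eq_square field_simps)
  finally show ?thesis by (simp add: ennreal_leI)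
qed

theorem theorem13:
  fixes T S :: "'a::{comm_ring_1, real_algebra_1} set"
    and X :: "'a topology"
    and L :: "'a \<Rightarrow> real"
  assumes "subspace T"
    and "generates_algebra (T \<union> {1})"
    and "S \<subseteq> T" and "independent S" and "span S = T"
    and "topspace X = T" and "nuclear_space X"
    and "linear L"
    and "(\<forall>a\<in>nonneg_on_characters. 0 \<le> L a) \<or>
         ((\<forall>a. 0 \<le> L (a\<^sup>2)) \<and> (\<forall>t\<in>S. carleman_condition L t))"
    and "\<exists>q. continuous_seminorm X q \<and> (\<forall>t\<in>T. L (t\<^sup>2) \<le> (q t)\<^sup>2)"
  shows "\<exists>\<mu>. space \<mu> = continuous_dual X \<and> sets \<mu> = sets (cylinder_algebra X) \<and>
      (\<forall>(k::nat) (t :: nat \<Rightarrow> 'a) p.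
         (\<forall>i<k. t i \<in> T) \<and> mpoly_vars p \<subseteq> {..<k} \<longrightarrow>
           integrable \<mu> (\<lambda>\<phi>. mpoly_eval p (\<lambda>i. \<phi> (t i))) \<and>
           L (mpoly_eval p t) = (\<integral>\<phi>. mpoly_eval p (\<lambda>i. \<phi> (t i)) \<partial>\<mu>)) \<and>
      (continuous_dual X \<subseteq> (\<lambda>\<phi>. restrict \<phi> T) ` characters \<longrightarrow>
         character_representing_measure T L \<mu>)"
proof -
  note T = \<open>subspace T\<close> and L = \<open>linear L\<close> and top = \<open>topspace X = T\<close> and S = \<open>span S = T\<close>
  obtain q where q: "continuous_seminorm X q" and Lq: "\<And>t. t \<in> T \<Longrightarrow> L (t^2) \<le> (q t)^2"
    using assms(10) by blast
  have X: "locally_convex_space X" using assms(7) by (simp add: nuclear_space_def)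
  obtain q' where q': "continuous_seminorm X q'" and nuc: "nuclear_canonical_map T q' q"
    using assms(7) q top unfolding nuclear_space_def by blast
  have sq: "seminorm_on T q" "seminorm_on T q'"
    using q q' top by (simp_all add: continuous_seminorm_def)
  \<comment> \<open>The two alternative assumptions on L enter through this positivity over the
    basis.\<close>
  have pos: "0 \<le> L (peval id e)" if "pvars e \<subseteq> S" "\<And>z :: 'a \<Rightarrow> real. 0 \<le> peval z e" for e
    using assms(9) Carleman_positive[OF L, of S e] character_positive[of L e] that by blast
  have "\<exists>(N :: (('a \<Rightarrow> real) set \<Rightarrow> bool) measure) W. finite_measure N \<and> (\<forall>w. linear (\<lambda>t. W t w)) \<and>
    (\<forall>e. pvars e \<subseteq> span S \<longrightarrow> integrable N (\<lambda>w. peval (\<lambda>t. W t w) e) \<and>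
       (\<integral>w. peval (\<lambda>t. W t w) e \<partial>N) = L (peval id e))"
    by (rule random_linear_functional[OF L assms(4)]) (rule pos)
  then obtain N :: "(('a \<Rightarrow> real) set \<Rightarrow> bool) measure" and W where N: "finite_measure N"
    and lin: "\<And>w. linear (\<lambda>t. W t w)"
    and moments: "\<And>e. pvars e \<subseteq> T \<Longrightarrow> integrable N (\<lambda>w. peval (\<lambda>t. W t w) e) \<and>
       (\<integral>w. peval (\<lambda>t. W t w) e \<partial>N) = L (peval id e)" unfolding S by blast
  have Wm: "W t \<in> borel_measurable N" if "t \<in> T" for t
    using moments[of "PVar t"] that by (simp add: borel_measurable_integrable)
  have bound: "(\<integral>\<^sup>+w. ennreal \<bar>W t w\<bar> \<partial>N) \<le> ennreal ((1 + measure N (space N)) / 2 * q t)" if t: "t \<in> T" for t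
    using moments[of "PMul (PVar t) (PVar t)"] t Lq[OF t] seminorm_onD(1)[OF sq(1) t]
    by (intro absolute_moment_bound N Wm) (simp_all add: power2_eq_square)
  have Wlin: "linear_functional_on T (\<lambda>t. W t w)" for w
    using linear_add[OF lin[of w]] linear_cmul[OF lin[of w]] by (simp add: linear_functional_on_def)
  obtain \<Psi> where \<Psi>: "\<forall>w. \<Psi> w \<in> extensional T \<and> linear_functional_on T (\<Psi> w) \<and> (\<exists>C. \<forall>x\<in>T. \<bar>\<Psi> w x\<bar> \<le> C * q' x)"
    and \<Psi>W: "\<forall>x\<in>T. (\<lambda>w. \<Psi> w x) \<in> borel_measurable N \<and> (AE w in N. \<Psi> w x = W x w)"
    using regular_version[OF T sq nuc Wlin Wm bound] by (auto simp: add_nonneg_nonneg)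
  have dual: "\<Psi> w \<in> continuous_dual X" for w
  proof -
    obtain C where "\<And>x. x \<in> topspace X \<Longrightarrow> \<bar>\<Psi> w x\<bar> \<le> C * q' x" using \<Psi> top by blast
    hence "continuous_map X euclideanreal (\<Psi> w)"
      using \<Psi> top by (intro continuous_map_bounded_functional[OF X _ q']) auto
    thus ?thesis using \<Psi> top by (simp add: continuous_dual_def)
  qed
  have \<Psi>m[measurable]: "\<Psi> \<in> measurable N (cylinder_algebra X)"
    by (rule measurable_cylinder_algebra[OF X dual]) (use \<Psi>W top in auto)
  define \<mu> where "\<mu> = distr N (cylinder_algebra X) \<Psi>"
  have space: "space \<mu> = continuous_dual X" by (simp add: \<mu>_def space_cylinder_algebra)
  have integral: "integrable \<mu> (\<lambda>\<phi>. peval \<phi> e) \<and> L (peval id e) = (\<integral>\<phi>. peval \<phi> e \<partial>\<mu>)"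
    if e: "pvars e \<subseteq> T" for e
  proof -
    have m: "(\<lambda>\<phi>. peval (\<lambda>v. \<phi> v) e) \<in> borel_measurable (cylinder_algebra X)"
      by (rule borel_measurable_peval[where Z = "\<lambda>v \<phi>. \<phi> v"], rule measurable_evaluation[OF X]) (use e top in auto)
    \<comment> \<open>\<Psi> and W agree almost everywhere for each single t, and an expression
      involves finitely many of them.\<close>
    have "AE w in N. \<forall>v\<in>pvars e. \<Psi> w v = W v w" using \<Psi>W e by (intro AE_finite_allI) auto
    hence eq: "AE w in N. peval (\<Psi> w) e = peval (\<lambda>t. W t w) e"
      by eventually_elim (rule peval_cong, blast)
    have m1: "(\<lambda>w. peval (\<Psi> w) e) \<in> borel_measurable N" using measurable_compose[OF \<Psi>m m] by simp
    have m2: "(\<lambda>w. peval (\<lambda>t. W t w) e) \<in> borel_measurable N"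
      using moments[OF e] by (simp add: borel_measurable_integrable)
    have "integrable \<mu> (\<lambda>\<phi>. peval \<phi> e) \<longleftrightarrow> integrable N (\<lambda>w. peval (\<Psi> w) e)"
      unfolding \<mu>_def by (rule integrable_distr_eq[OF \<Psi>m]) (use m in simp)
    moreover have "(\<integral>\<phi>. peval \<phi> e \<partial>\<mu>) = (\<integral>w. peval (\<Psi> w) e \<partial>N)"
      unfolding \<mu>_def by (rule integral_distr[OF \<Psi>m]) (use m in simp)
    ultimately show ?thesis
      using integrable_cong_AE[OF m1 m2 eq] integral_cong_AE[OF m1 m2 eq] moments[OF e] by simp
  qed
  show ?thesis
  proof (intro exI[of _ \<mu>] conjI allI impI)
    show "space \<mu> = continuous_dual X" by (rule space)
    show "sets \<mu> = sets (cylinder_algebra X)" by (simp add: \<mu>_def)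
  next
    fix k :: nat and t :: "nat \<Rightarrow> 'a" and p
    assume kt: "(\<forall>i<k. t i \<in> T) \<and> mpoly_vars p \<subseteq> {..<k}"
    hence "expressible T (mpoly_eval p t) (\<lambda>\<rho>. mpoly_eval p (\<lambda>i. \<rho> (t i)))"
      by (intro expressible_mpoly) auto
    then obtain e where "pvars e \<subseteq> T" "peval id e = mpoly_eval p t"
      "\<And>\<rho> :: 'a \<Rightarrow> real. peval \<rho> e = mpoly_eval p (\<lambda>i. \<rho> (t i))" unfolding expressible_def by blast
    thus "integrable \<mu> (\<lambda>\<phi>. mpoly_eval p (\<lambda>i. \<phi> (t i)))"
      "L (mpoly_eval p t) = (\<integral>\<phi>. mpoly_eval p (\<lambda>i. \<phi> (t i)) \<partial>\<mu>)" using integral[of e] by simp_all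
  next
    assume sub: "continuous_dual X \<subseteq> (\<lambda>\<phi>. restrict \<phi> T) ` characters"
    show "character_representing_measure T L \<mu>" unfolding character_representing_measure_def
    proof (intro conjI allI)
      show "space \<mu> \<subseteq> (\<lambda>\<phi>. restrict \<phi> T) ` characters" using sub space by simp
      fix f
      obtain e where e: "pvars e \<subseteq> T" "peval id e = f"
        using generated_expressible[OF assms(2), of f] unfolding expressible_def by blast
      \<comment> \<open>The extended character is multiplicative and restricts to l, so its value at
        f is obtained by evaluating at l any expression of f over T.\<close>
      have ext: "extend_character T l f = peval l e" if "l \<in> space \<mu>" for l
      proof -
        have l: "l \<in> (\<lambda>\<phi>. restrict \<phi> T) ` characters" using that sub space by blast
        have \<phi>: "extend_character T l \<in> characters" "restrict (extend_character T l) T = l"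
          unfolding extend_character_def using inv_into_into[OF l] f_inv_into_f[OF l] by auto
        have "extend_character T l f = peval (\<lambda>v. extend_character T l v) e"
          using peval_character[OF \<phi>(1), of id e] e(2) by simp
        also have "... = peval l e"
          by (rule peval_cong) (use e(1) \<phi>(2) in \<open>metis restrict_apply' subsetD\<close>)
        finally show ?thesis .
      qed
      have "integrable \<mu> (\<lambda>l. extend_character T l f) \<longleftrightarrow> integrable \<mu> (\<lambda>l. peval l e)"
        by (rule Bochner_Integration.integrable_cong) (simp_all add: ext)
      thus "integrable \<mu> (\<lambda>l. extend_character T l f)" using integral[OF e(1)] by simp
      have "(\<integral>l. extend_character T l f \<partial>\<mu>) = (\<integral>l. peval l e \<partial>\<mu>)"
        by (rule Bochner_Integration.integral_cong) (simp_all add: ext)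
      thus "L f = (\<integral>l. extend_character T l f \<partial>\<mu>)" using integral[OF e(1)] e(2) by simp
    qed
  qed
qed

end
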